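(* If the travel speed $s$ is an integer, then an optimal (minimum-makespan) schedule for two reclaimers, when the positions of the stockpiles are given and the stockpiles have to be reclaimed in a prespecified order, can be determined in pseudo-polynomial time, namely $O(nL^3)$.
   Context: Reclaimer scheduling model. Two pads $P_1,P_2$ are each modeled as $[0,L]$, $L$ a positive integer; $n$ stockpiles, each on one pad, stockpile $j$ occupying a given interval $[l_j,r_j]\subseteq[0,L]$ with integers $l_j<r_j$, stockpiles on the same pad non-overlapping. Reclaimers $R_0,R_1$ move on a rail represented by $[0,L]$; $R_0$ starts and ends at $0$, $R_1$ at $L$. Reclaim speed $1$, travel speed $s\ge1$. A schedule of $R_k$ with makespan $C_k$ is a continuous piecewise linear $H_k:[0,C_k]\to[0,L]$, $H_k(0)=H_k(C_k)=kL$ (extended by $kL$ afterwards), with pieces of slope $0$, $\pm s$ (travel) or $\pm1$ (reclaiming on either pad). A stockpile is reclaimed by one reclaimer traversing all of $[l_j,r_j]$ once at speed $1$ in either direction. Feasibility requires $H_0(t)\le H_1(t)$ for all $t$ and that the stockpiles are reclaimed in the prescribed order $1,2,\dots,n$ (reclaiming of $j+1$ starts after that of $j$ is finished). The objective is $\max(C_0,C_1)$. *)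

theory Defs
  imports Complex_Main
begin

datatype pad = P1 | P2

record stockpile =
  pad :: pad
  left :: nat
  right :: nat

text \<open>The list order is the prescribed reclaiming order; stockpiles are numbered from 0.\<close>

record inst =
  rail :: nat
  speed :: real
  piles :: "stockpile list"

definition num :: "inst \<Rightarrow> nat" where
  "num I = length (piles I)"

definition lft :: "inst \<Rightarrow> nat \<Rightarrow> nat" where
  "lft I j = left (piles I ! j)"

definition rgt :: "inst \<Rightarrow> nat \<Rightarrow> nat" where
  "rgt I j = right (piles I ! j)"

definition dur :: "inst \<Rightarrow> nat \<Rightarrow> real" where
  "dur I j = real (rgt I j) - real (lft I j)"

text \<open>Stockpiles on the same pad may touch, but their interiors are disjoint.\<close>

definition valid_inst :: "inst \<Rightarrow> bool" where
  "valid_inst I \<longleftrightarrow>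
     0 < rail I \<and> 1 \<le> speed I \<and>
     (\<forall>j<num I. lft I j < rgt I j \<and> rgt I j \<le> rail I) \<and>
     (\<forall>i<num I. \<forall>j<num I. i \<noteq> j \<and> pad (piles I ! i) = pad (piles I ! j) \<longrightarrow>
        rgt I i \<le> lft I j \<or> rgt I j \<le> lft I i)"

text \<open>
  The two reclaimers are numbered 0 and 1. A schedule consists of their paths and makespans
  and, for every stockpile, the reclaimer handling it and the time at which it starts doing so.
  Paths are only meaningful for nonnegative times.
\<close>

record schedule =
  path :: "nat \<Rightarrow> real \<Rightarrow> real"
  makespan :: "nat \<Rightarrow> real"
  worker :: "nat \<Rightarrow> nat"
  start :: "nat \<Rightarrow> real"

definition finish :: "inst \<Rightarrow> schedule \<Rightarrow> nat \<Rightarrow> real" where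
  "finish I S j = start S j + dur I j"

text \<open>Slope \<open>\<plusminus>1\<close> is reserved for reclaiming (unless the travel speed is 1 as well).\<close>

definition legal_piece :: "inst \<Rightarrow> schedule \<Rightarrow> nat \<Rightarrow> real \<Rightarrow> real \<Rightarrow> bool" where
  "legal_piece I S k a b \<longleftrightarrow>
     (\<exists>v. (\<forall>t\<in>{a..b}. path S k t = path S k a + v * (t - a)) \<and>
          (v \<in> {0, speed I, - speed I} \<or>
           v \<in> {1, -1} \<and>
             (\<exists>j<num I. worker S j = k \<and> {a..b} \<subseteq> {start S j..finish I S j})))"

definition legal_path :: "inst \<Rightarrow> schedule \<Rightarrow> nat \<Rightarrow> bool" where
  "legal_path I S k \<longleftrightarrow>
     0 \<le> makespan S k \<and>
     path S k 0 = real k * real (rail I) \<and>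
     (\<forall>t\<ge>makespan S k. path S k t = real k * real (rail I)) \<and>
     (\<forall>t\<in>{0..makespan S k}. path S k t \<in> {0..real (rail I)}) \<and>
     continuous_on {0..makespan S k} (path S k) \<and>
     (\<exists>(m::nat) \<tau>. \<tau> 0 = 0 \<and> \<tau> m = makespan S k \<and>
        (\<forall>i<m. \<tau> i \<le> \<tau> (Suc i) \<and> legal_piece I S k (\<tau> i) (\<tau> (Suc i))))"

definition reclaimed :: "inst \<Rightarrow> schedule \<Rightarrow> nat \<Rightarrow> bool" where
  "reclaimed I S j \<longleftrightarrow>
     worker S j < 2 \<and> 0 \<le> start S j \<and> finish I S j \<le> makespan S (worker S j) \<and>
     ((\<forall>t\<in>{start S j..finish I S j}. path S (worker S j) t = real (lft I j) + (t - start S j)) \<or>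
      (\<forall>t\<in>{start S j..finish I S j}. path S (worker S j) t = real (rgt I j) - (t - start S j)))"

definition feasible :: "inst \<Rightarrow> schedule \<Rightarrow> bool" where
  "feasible I S \<longleftrightarrow>
     (\<forall>k<2. legal_path I S k) \<and>
     (\<forall>t\<ge>0. path S 0 t \<le> path S 1 t) \<and>
     (\<forall>j<num I. reclaimed I S j) \<and>
     (\<forall>j. Suc j < num I \<longrightarrow> finish I S j \<le> start S (Suc j))"

definition objective :: "schedule \<Rightarrow> real" where
  "objective S = max (makespan S 0) (makespan S 1)"

definition optimal :: "inst \<Rightarrow> schedule \<Rightarrow> bool" where
  "optimal I S \<longleftrightarrow> feasible I S \<and> (\<forall>S'. feasible I S' \<longrightarrow> objective S \<le> objective S')"

text \<open>
  Structured programs for a word RAM: finitely many registers per program, an indirectly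
  addressed memory, and addition, truncated subtraction and multiplication as arithmetic.
  Evaluating one node of an expression costs one time unit, and so does every assignment and
  every test. A parameter \<open>W\<close> bounds all numbers: execution gets stuck as soon as an
  evaluated (sub)expression, and hence any address or any stored value, is not below \<open>W\<close>.
\<close>

record state =
  regs :: "nat \<Rightarrow> nat"
  mem :: "nat \<Rightarrow> nat"

datatype exp =
    Num nat
  | Reg nat
  | Mem exp
  | Add exp exp
  | Sub exp exp
  | Mul exp exp

fun eval :: "state \<Rightarrow> exp \<Rightarrow> nat" where
  "eval st (Num k) = k"
| "eval st (Reg x) = regs st x"
| "eval st (Mem e) = mem st (eval st e)"
| "eval st (Add e f) = eval st e + eval st f"
| "eval st (Sub e f) = eval st e - eval st f"
| "eval st (Mul e f) = eval st e * eval st f"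

fun cost :: "exp \<Rightarrow> nat" where
  "cost (Num k) = 1"
| "cost (Reg x) = 1"
| "cost (Mem e) = 1 + cost e"
| "cost (Add e f) = 1 + cost e + cost f"
| "cost (Sub e f) = 1 + cost e + cost f"
| "cost (Mul e f) = 1 + cost e + cost f"

fun subexps :: "exp \<Rightarrow> exp set" where
  "subexps (Num k) = {Num k}"
| "subexps (Reg x) = {Reg x}"
| "subexps (Mem e) = insert (Mem e) (subexps e)"
| "subexps (Add e f) = insert (Add e f) (subexps e \<union> subexps f)"
| "subexps (Sub e f) = insert (Sub e f) (subexps e \<union> subexps f)"
| "subexps (Mul e f) = insert (Mul e f) (subexps e \<union> subexps f)"

definition fits :: "nat \<Rightarrow> state \<Rightarrow> exp \<Rightarrow> bool" where
  "fits W st e \<longleftrightarrow> (\<forall>f\<in>subexps e. eval st f < W)"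

datatype com =
    Skip
  | Set nat exp
  | Store exp exp
  | Seq com com
  | If exp com com
  | While exp com

text \<open>
  \<open>exec W P st T st'\<close>: started in \<open>st\<close>, program \<open>P\<close> halts in \<open>st'\<close> after exactly \<open>T\<close> time
  units, all numbers staying below \<open>W\<close>. Tests succeed if the value is nonzero.
\<close>

inductive exec :: "nat \<Rightarrow> com \<Rightarrow> state \<Rightarrow> nat \<Rightarrow> state \<Rightarrow> bool" for W :: nat where
  Skip: "exec W Skip st 1 st"
| Set: "fits W st e \<Longrightarrow>
    exec W (Set x e) st (1 + cost e) (st\<lparr>regs := (regs st)(x := eval st e)\<rparr>)"
| Store: "fits W st a \<Longrightarrow> fits W st e \<Longrightarrow>
    exec W (Store a e) st (1 + cost a + cost e)
      (st\<lparr>mem := (mem st)(eval st a := eval st e)\<rparr>)"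
| Seq: "exec W P st T st' \<Longrightarrow> exec W Q st' T' st'' \<Longrightarrow> exec W (Seq P Q) st (T + T') st''"
| IfTrue: "fits W st b \<Longrightarrow> eval st b \<noteq> 0 \<Longrightarrow> exec W P st T st' \<Longrightarrow>
    exec W (If b P Q) st (1 + cost b + T) st'"
| IfFalse: "fits W st b \<Longrightarrow> eval st b = 0 \<Longrightarrow> exec W Q st T st' \<Longrightarrow>
    exec W (If b P Q) st (1 + cost b + T) st'"
| WhileFalse: "fits W st b \<Longrightarrow> eval st b = 0 \<Longrightarrow>
    exec W (While b P) st (1 + cost b) st"
| WhileTrue: "fits W st b \<Longrightarrow> eval st b \<noteq> 0 \<Longrightarrow> exec W P st T st' \<Longrightarrow>
    exec W (While b P) st' T' st'' \<Longrightarrow>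
    exec W (While b P) st (1 + cost b + T + T') st''"

inductive_cases SkipE: "exec W Skip st T st'"
inductive_cases SetE: "exec W (Set x e) st T st'"
inductive_cases StoreE: "exec W (Store a e) st T st'"
inductive_cases SeqE: "exec W (Seq P Q) st T st'"
inductive_cases IfE: "exec W (If b P Q) st T st'"
inductive_cases WhileE: "exec W (While b P) st T st'"

lemma exec_deterministic:
  "exec W P st T st' \<Longrightarrow> exec W P st U st'' \<Longrightarrow> U = T \<and> st'' = st'"
proof (induction arbitrary: U st'' rule: exec.induct)
  case Skip
  then show ?case by (auto elim: SkipE)
next
  case Set
  then show ?case by (auto elim: SetE)
next
  case Store
  then show ?case by (auto elim: StoreE)
next
  case (Seq P st T st1 Q T1 st2)
  from Seq.prems obtain U1 s1 U2 where
    "exec W P st U1 s1" "exec W Q s1 U2 st''" "U = U1 + U2" by (rule SeqE)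
  with Seq.IH(1)[of U1 s1] Seq.IH(2)[of U2 st''] show ?case by simp
next
  case (IfTrue st b P T st1 Q)
  from IfTrue.prems IfTrue.hyps obtain U1 where
    "exec W P st U1 st''" "U = 1 + cost b + U1" by (auto elim!: IfE)
  with IfTrue.IH[of U1 st''] show ?case by simp
next
  case (IfFalse st b Q T st1 P)
  from IfFalse.prems IfFalse.hyps obtain U1 where
    "exec W Q st U1 st''" "U = 1 + cost b + U1" by (auto elim!: IfE)
  with IfFalse.IH[of U1 st''] show ?case by simp
next
  case (WhileFalse st b P)
  from WhileFalse.prems show ?case by (rule WhileE) (use WhileFalse.hyps in simp_all)
next
  case (WhileTrue st b P T st1 T1 st2)
  from WhileTrue.prems WhileTrue.hyps obtain U1 s1 U2 where
    "exec W P st U1 s1" "exec W (While b P) s1 U2 st''" "U = 1 + cost b + U1 + U2"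
    by (auto elim: WhileE)
  with WhileTrue.IH(1)[of U1 s1] WhileTrue.IH(2)[of U2 st''] show ?case by simp
qed

definition int_speed :: "inst \<Rightarrow> nat" where
  "int_speed I = nat \<lfloor>speed I\<rfloor>"

definition pile_code :: "stockpile \<Rightarrow> nat list" where
  "pile_code p = [case pad p of P1 \<Rightarrow> 1 | P2 \<Rightarrow> 2, left p, right p]"

definition input_words :: "inst \<Rightarrow> nat list" where
  "input_words I = [num I, rail I, int_speed I] @ concat (map pile_code (piles I))"

definition encode :: "inst \<Rightarrow> state" where
  "encode I = \<lparr>regs = (\<lambda>x. 0),
     mem = (\<lambda>a. if a < length (input_words I) then input_words I ! a else 0)\<rparr>"

text \<open>Breakpoints are (time, position) pairs; the path is constant after the last one.\<close>

fun polyline :: "(real \<times> real) list \<Rightarrow> real \<Rightarrow> real" where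
  "polyline [] t = 0"
| "polyline [(a, x)] t = x"
| "polyline ((a, x) # (b, y) # ps) t =
     (if t < b then x + (y - x) * (t - a) / (b - a) else polyline ((b, y) # ps) t)"

text \<open>
  Register 0 holds the address of the output, which is, for \<open>n\<close> stockpiles, the sequence
  \<open>q, k\<^sub>1, \<sigma>\<^sub>1, \<dots>, k\<^sub>n, \<sigma>\<^sub>n, m\<^sub>0, B\<^sub>0, m\<^sub>1, B\<^sub>1\<close>. Here \<open>q\<close> is a common denominator of all times and
  positions, the \<open>j\<close>-th stockpile is reclaimed by reclaimer \<open>k\<^sub>j\<close> from time \<open>\<sigma>\<^sub>j / q\<close> on, and
  \<open>B\<^sub>k\<close> lists the \<open>m\<^sub>k\<close> breakpoints of the path of reclaimer \<open>k\<close> as pairs (time, position), both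
  multiplied by \<open>q\<close>; repeated breakpoints are harmless.
\<close>

definition breakpoints :: "real \<Rightarrow> (nat \<Rightarrow> nat) \<Rightarrow> nat \<Rightarrow> (real \<times> real) list" where
  "breakpoints q M a =
     map (\<lambda>i. (real (M (a + 1 + 2 * i)) / q, real (M (a + 2 + 2 * i)) / q)) [0..<M a]"

definition decode :: "nat \<Rightarrow> state \<Rightarrow> schedule" where
  "decode n st =
    (let M = mem st;
         a = regs st 0;
         q = real (M a);
         a\<^sub>0 = a + 1 + 2 * n;
         a\<^sub>1 = a\<^sub>0 + 1 + 2 * M a\<^sub>0;
         B = (\<lambda>k. breakpoints q M (if k = 0 then a\<^sub>0 else a\<^sub>1))
     in \<lparr>path = (\<lambda>k. polyline (B k)),
         makespan = (\<lambda>k. fst (last (B k))),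
         worker = (\<lambda>j. M (a + 1 + 2 * j)),
         start = (\<lambda>j. real (M (a + 2 + 2 * j)) / q)\<rparr>)"

end

theory Submission
  imports Defs
begin

text \<open>
  Positions are measured by the distance \<open>u\<close> of a reclaimer from its home \<open>kL\<close>, times in units of
  \<open>1/s\<close>. Since reclaimers are \<open>s\<close>-Lipschitz, a job started by \<open>k\<close> at distance \<open>b\<close> and at time \<open>t\<close>
  needs \<open>|b - u| \<le> t - f\<close> for the finishing time \<open>f\<close> and final distance \<open>u\<close> of the previous job of
  \<open>k\<close>, and \<open>b + u' - L \<le> t - f'\<close> for those of the other reclaimer. Conversely these conditions
  suffice: let every idle reclaimer retreat towards its home at full speed and come back just in
  time. All quantities being integers, and a waiting time beyond \<open>L\<close> being irrelevant, it suffices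
  to know, for every number of remaining jobs, both distances and the time since the idle reclaimer
  stopped, the least time to completion. This table has \<open>O(n L\<^sup>3)\<close> entries, each computed from four
  earlier ones.
\<close>

section \<open>Dynamic programming\<close>

text \<open>Optimality is proved through policies, which fix a reclaimer and a direction for each
  job. A feasible schedule induces the policy \<open>taken\<close>, whose simulation in scaled time
  is never later than the schedule itself; conversely every admissible policy is realised by actual
  paths. So minimising over discrete choices is exact. Integrality of s enters because a job lasts
  s(r - l) units of 1/s. Waits beyond L are irrelevant because each condition asks for a distance of
  at most L, so a wait of L already satisfies it. The conditions at job starts exclude collisions at
  all times by a tent argument: while away from home, k has at scaled time x a distance below both
  \<open>to + finish - x\<close> and \<open>from + x - begin\<close> for one of its jobs. For jobs
  of different reclaimers, the falling side of the earlier tent and the rising side of the later one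
  add up to at most L, whatever x is. The turning points of the retreats can be half-integral in
  scaled units, whence the output denominator 2s.\<close>

definition pick :: "(nat \<times> nat \<Rightarrow> nat) \<Rightarrow> nat \<times> nat" where
  "pick f =
    (let c = (0, 0);
         c = (if f (0, 1) < f c then (0, 1) else c);
         c = (if f (1, 0) < f c then (1, 0) else c)
     in if f (1, 1) < f c then (1, 1) else c)"

lemma pick_range: "fst (pick f) < 2" "snd (pick f) < 2"
  by (simp_all add: pick_def Let_def)

lemma pick_le:
  assumes "fst c < 2" "snd c < 2"
  shows "f (pick f) \<le> f c"
proof -
  have "c = (0,0) \<or> c = (0,1) \<or> c = (1,0) \<or> c = (1,1)"
    using assms by (cases c) (auto simp: less_2_cases_iff)
  then show ?thesis by (auto simp: pick_def Let_def)
qed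

locale scheduling =
  fixes I :: inst
  assumes valid: "valid_inst I" and integral: "speed I \<in> \<int>"
begin

abbreviation "n \<equiv> num I"
abbreviation "L \<equiv> rail I"
abbreviation "s \<equiv> int_speed I"

lemma speed_eq: "speed I = real s"
proof -
  have "1 \<le> speed I" using valid by (simp add: valid_inst_def)
  then show ?thesis using integral by (auto simp: int_speed_def elim!: Ints_cases)
qed

lemma s_pos: "1 \<le> s"
proof -
  have "1 \<le> speed I" using valid by (simp add: valid_inst_def)
  then show ?thesis by (simp add: speed_eq)
qed

lemma L_pos: "0 < L"
  using valid by (simp add: valid_inst_def)

lemma pile_bounds: "j < n \<Longrightarrow> lft I j < rgt I j" "j < n \<Longrightarrow> rgt I j \<le> L"
  using valid by (simp_all add: valid_inst_def)

definition home :: "nat \<Rightarrow> nat \<Rightarrow> nat" where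
  "home k z = (if k = 0 then z else L - z)"

text \<open>A choice \<open>c\<close> is a pair (reclaimer, direction), direction 0 being left to
  right.\<close>

definition from_pos :: "nat \<Rightarrow> nat \<times> nat \<Rightarrow> nat" where
  "from_pos j c = home (fst c) (if snd c = 0 then lft I j else rgt I j)"

definition to_pos :: "nat \<Rightarrow> nat \<times> nat \<Rightarrow> nat" where
  "to_pos j c = home (fst c) (if snd c = 0 then rgt I j else lft I j)"

definition work :: "nat \<Rightarrow> nat" where
  "work j = s * (rgt I j - lft I j)"

text \<open>One number carries both capped waits, as at least one of them is always 0:
  \<open>y\<close> is L plus the wait of 0 minus the wait of 1, and truncated subtraction recovers
  either.\<close>

definition lag :: "nat \<Rightarrow> nat \<Rightarrow> nat" where
  "lag y k = (if k = 0 then y - L else L - y)"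

text \<open>The delay between the present clock and the earliest start. The two truncated
  differences add up to the absolute value of b - u; each requirement is reduced by the time its
  reclaimer has already waited, and truncation at 0 means that no further delay is needed.\<close>

definition gap :: "nat \<Rightarrow> (nat \<Rightarrow> nat) \<Rightarrow> nat \<Rightarrow> nat \<times> nat \<Rightarrow> nat" where
  "gap j u y c =
    (let k = fst c; b = from_pos j c
     in max ((b - u k) + (u k - b) - lag y k) (b + u (1 - k) - L - lag y (1 - k)))"

text \<open>The worker's wait becomes 0 and the other's becomes \<open>t\<close> capped at L; in the
  case of reclaimer 0 the truncated subtraction does the capping.\<close>

definition next_y :: "nat \<Rightarrow> (nat \<Rightarrow> nat) \<Rightarrow> nat \<Rightarrow> nat \<times> nat \<Rightarrow> nat" where
  "next_y j u y c =
    (let t = lag y (1 - fst c) + gap j u y c + work j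
     in if fst c = 0 then L - t else L + min L t)"

primrec togo :: "nat \<Rightarrow> (nat \<Rightarrow> nat) \<Rightarrow> nat \<Rightarrow> nat" where
  "togo 0 = (\<lambda>u y. max (u 0 - lag y 0) (u 1 - lag y 1))"
| "togo (Suc i) = (\<lambda>u y.
    (let j = n - Suc i;
         f = (\<lambda>c. gap j u y c + work j + togo i (u(fst c := to_pos j c)) (next_y j u y c))
     in f (pick f)))"

definition option_cost :: "nat \<Rightarrow> (nat \<Rightarrow> nat) \<Rightarrow> nat \<Rightarrow> nat \<times> nat \<Rightarrow> nat" where
  "option_cost i u y c =
    (let j = n - Suc i
     in gap j u y c + work j + togo i (u(fst c := to_pos j c)) (next_y j u y c))"

lemma togo_Suc: "togo (Suc i) u y = option_cost i u y (pick (option_cost i u y))"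
  by (simp add: option_cost_def[abs_def] Let_def)

declare togo.simps(2)[simp del]

type_synonym policy = "nat \<Rightarrow> (nat \<Rightarrow> nat) \<Rightarrow> nat \<Rightarrow> nat \<times> nat"

text \<open>The second component records the exact finishing times. A policy does not see them, only
  the distances and the capped waits; they are what the paths are built from.\<close>

primrec sim ::
  "policy \<Rightarrow> nat \<Rightarrow> nat \<times> (nat \<Rightarrow> nat) \<times> (nat \<Rightarrow> nat) \<times> nat" where
  "sim \<pi> 0 = (0, \<lambda>_. 0, \<lambda>_. 0, L)"
| "sim \<pi> (Suc j) =
    (case sim \<pi> j of (t, F, u, y) \<Rightarrow>
       let c = \<pi> j u y; t' = t + gap j u y c + work j
       in (t', F(fst c := t'), u(fst c := to_pos j c), next_y j u y c))"

definition "clock \<pi> j = fst (sim \<pi> j)"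
definition "last_fin \<pi> j = fst (snd (sim \<pi> j))"
definition "posn \<pi> j = fst (snd (snd (sim \<pi> j)))"
definition "lagc \<pi> j = snd (snd (snd (sim \<pi> j)))"
definition "chc \<pi> j = \<pi> j (posn \<pi> j) (lagc \<pi> j)"
definition "begin_at \<pi> j = clock \<pi> j + gap j (posn \<pi> j) (lagc \<pi> j) (chc \<pi> j)"

lemma sim_0 [simp]:
  "clock \<pi> 0 = 0" "last_fin \<pi> 0 = (\<lambda>_. 0)" "posn \<pi> 0 = (\<lambda>_. 0)" "lagc \<pi> 0 = L"
  by (simp_all add: clock_def last_fin_def posn_def lagc_def)

lemma sim_Suc:
  "clock \<pi> (Suc j) = begin_at \<pi> j + work j"
  "last_fin \<pi> (Suc j) = (last_fin \<pi> j)(fst (chc \<pi> j) := clock \<pi> (Suc j))"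
  "posn \<pi> (Suc j) = (posn \<pi> j)(fst (chc \<pi> j) := to_pos j (chc \<pi> j))"
  "lagc \<pi> (Suc j) = next_y j (posn \<pi> j) (lagc \<pi> j) (chc \<pi> j)"
  by (simp_all add: clock_def last_fin_def posn_def lagc_def chc_def begin_at_def
      case_prod_unfold Let_def)

definition admissible :: "policy \<Rightarrow> bool" where
  "admissible \<pi> \<longleftrightarrow> (\<forall>j u y. fst (\<pi> j u y) < 2 \<and> snd (\<pi> j u y) < 2)"

lemma chc_range:
  assumes "admissible \<pi>"
  shows "fst (chc \<pi> j) < 2" "snd (chc \<pi> j) < 2"
  using assms by (auto simp: admissible_def chc_def)

lemma from_to_le: assumes "j < n" shows "from_pos j c \<le> L" "to_pos j c \<le> L"
  using pile_bounds[OF assms] by (auto simp: from_pos_def to_pos_def home_def)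

text \<open>Since s is at least 1, reclaiming is no faster than travelling, so a job counts as
  Lipschitz motion in scaled time.\<close>

lemma from_to_work:
  assumes "j < n"
  shows "from_pos j c \<le> to_pos j c + work j" "to_pos j c \<le> from_pos j c + work j"
proof -
  have "rgt I j - lft I j \<le> work j" using s_pos by (simp add: work_def)
  then show "from_pos j c \<le> to_pos j c + work j" "to_pos j c \<le> from_pos j c + work j"
    using pile_bounds[OF assms] by (auto simp: from_pos_def to_pos_def home_def)
qed

lemma lag_next:
  assumes "fst c < 2"
  shows "lag (next_y j u y c) (fst c) = 0"
    "lag (next_y j u y c) (1 - fst c) = min L (lag y (1 - fst c) + gap j u y c + work j)"
  using assms by (auto simp: lag_def next_y_def Let_def less_2_cases_iff)

lemma next_y_le: "next_y j u y c \<le> 2 * L"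
  by (auto simp: next_y_def Let_def)

lemma gap_ge:
  fixes c :: "nat \<times> nat"
  defines "k \<equiv> fst c"
  shows "from_pos j c \<le> u k + lag y k + gap j u y c"
    "u k \<le> from_pos j c + lag y k + gap j u y c"
    "from_pos j c + u (1 - k) \<le> L + lag y (1 - k) + gap j u y c"
  unfolding gap_def Let_def k_def by linarith+

lemma gap_le_L:
  assumes "j < n" "u (fst c) \<le> L" "u (1 - fst c) \<le> L"
  shows "gap j u y c \<le> L"
  using assms from_to_le(1)[OF assms(1), of c] by (auto simp: gap_def Let_def)

lemma posn_le:
  assumes "j \<le> n" shows "posn \<pi> j k \<le> L"
  using assms
proof (induction j)
  case (Suc j)
  then show ?case using from_to_le(2)[of j] by (auto simp: sim_Suc)
qed simp

lemma lagc_le: "lagc \<pi> j \<le> 2 * L"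
  by (cases j) (simp_all add: sim_Suc next_y_le)

lemma clock_le_begin: "clock \<pi> j \<le> begin_at \<pi> j"
  by (simp add: begin_at_def)

lemma clock_mono: "i \<le> j \<Longrightarrow> clock \<pi> i \<le> clock \<pi> j"
  by (induction j) (auto simp: le_Suc_eq sim_Suc begin_at_def intro: le_trans)

context
  fixes \<pi> assumes adm: "admissible \<pi>"
begin

text \<open>Capping can only understate a wait, so delays computed from \<open>lag\<close> are long
  enough for the true finishing times. That they are not too long is the business of
  \<open>add_lag_le\<close>.\<close>

lemma last_fin_inv:
  assumes "k < 2"
  shows "last_fin \<pi> j k + lag (lagc \<pi> j) k \<le> clock \<pi> j"
  using assms
proof (induction j)
  case 0
  then show ?case by (simp add: lag_def)
next
  case (Suc j)
  let ?c = "chc \<pi> j"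
  have c: "fst ?c < 2" using chc_range[OF adm] by simp
  show ?case
  proof (cases "k = fst ?c")
    case True
    then show ?thesis by (simp add: sim_Suc lag_next[OF c])
  next
    case False
    then have k: "k = 1 - fst ?c" using Suc.prems c by auto
    have "lag (lagc \<pi> (Suc j)) k \<le> lag (lagc \<pi> j) k + gap j (posn \<pi> j) (lagc \<pi> j) ?c + work j"
      unfolding sim_Suc k lag_next(2)[OF c] by simp
    then show ?thesis
      using Suc.IH[OF Suc.prems] False by (simp add: sim_Suc begin_at_def)
  qed
qed

lemma begin_worker:
  assumes "k = fst (chc \<pi> j)"
  shows "last_fin \<pi> j k + from_pos j (chc \<pi> j) \<le> posn \<pi> j k + begin_at \<pi> j"
    "last_fin \<pi> j k + posn \<pi> j k \<le> from_pos j (chc \<pi> j) + begin_at \<pi> j"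
  using gap_ge(1,2)[where j = j and c = "chc \<pi> j" and u = "posn \<pi> j" and y = "lagc \<pi> j"] last_fin_inv[of k j] assms
    chc_range[OF adm, of j]
  by (auto simp: begin_at_def)

lemma begin_other:
  assumes "k = 1 - fst (chc \<pi> j)"
  shows "last_fin \<pi> j k + from_pos j (chc \<pi> j) + posn \<pi> j k \<le> L + begin_at \<pi> j"
proof -
  have "k < 2" using assms by simp
  then show ?thesis
    using gap_ge(3)[where j = j and c = "chc \<pi> j" and u = "posn \<pi> j" and y = "lagc \<pi> j"]
      last_fin_inv[of k j]
    unfolding begin_at_def assms by linarith
qed

lemma last_fin_le: "k < 2 \<Longrightarrow> last_fin \<pi> j k \<le> clock \<pi> j"
  using last_fin_inv[of k j] by simp

definition "makesp = clock \<pi> n + togo 0 (posn \<pi> n) (lagc \<pi> n)"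

lemma makesp_ge: "k < 2 \<Longrightarrow> last_fin \<pi> n k + posn \<pi> n k \<le> makesp"
  using last_fin_inv[of k n] by (auto simp: makesp_def less_2_cases_iff max_def)

text \<open>The paths are Lipschitz, so the last finished job of a reclaimer carries the
  constraints of all its earlier ones.\<close>

lemma earlier_jobs:
  assumes "i < j" "j \<le> n" "k = fst (chc \<pi> i)"
  shows "to_pos i (chc \<pi> i) + clock \<pi> (Suc i) \<le> posn \<pi> j k + last_fin \<pi> j k"
  using assms
proof (induction j)
  case (Suc j)
  note p = Suc.prems
  show ?case
  proof (cases "i = j")
    case True
    then show ?thesis using p by (simp add: sim_Suc)
  next
    case False
    then have IH: "to_pos i (chc \<pi> i) + clock \<pi> (Suc i) \<le> posn \<pi> j k + last_fin \<pi> j k"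
      using Suc.IH p by simp
    show ?thesis
    proof (cases "fst (chc \<pi> j) = k")
      case True
      then show ?thesis
        using IH begin_worker(2)[of k j] from_to_work(1)[of j "chc \<pi> j"] p
        by (simp add: sim_Suc)
    qed (use IH in \<open>simp add: sim_Suc\<close>)
  qed
qed simp

end

end

section \<open>Optimality of the greedy choices\<close>

context scheduling
begin

lemma togo_step:
  assumes "admissible \<pi>" "j < n"
  shows "togo (n - j) (posn \<pi> j) (lagc \<pi> j)
    \<le> gap j (posn \<pi> j) (lagc \<pi> j) (chc \<pi> j) + work j
      + togo (n - Suc j) (posn \<pi> (Suc j)) (lagc \<pi> (Suc j))"
proof -
  have "n - j = Suc (n - Suc j)" "n - Suc (n - Suc j) = j" using assms(2) by auto
  then show ?thesis
    using pick_le[OF chc_range[OF assms(1), of j],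
        where f = "option_cost (n - Suc j) (posn \<pi> j) (lagc \<pi> j)"]
    by (simp only: togo_Suc) (simp add: option_cost_def sim_Suc)
qed

text \<open>The Bellman inequality \<open>togo_step\<close>, telescoped along an arbitrary
  policy.\<close>

lemma togo_lower:
  assumes "admissible \<pi>" "j \<le> n"
  shows "togo n (\<lambda>_. 0) L \<le> clock \<pi> j + togo (n - j) (posn \<pi> j) (lagc \<pi> j)"
  using assms(2)
proof (induction j)
  case (Suc j)
  then show ?case using togo_step[OF assms(1), of j]
    by (simp add: sim_Suc(1) begin_at_def del: fun_upd_apply)
qed simp

definition greedy :: policy where
  "greedy j u y = pick (option_cost (n - Suc j) u y)"

lemma greedy_admissible: "admissible greedy"
  by (simp add: admissible_def greedy_def pick_range)

text \<open>The same telescoping with equality, because the greedy policy takes the minimiser that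
  defines \<open>togo\<close>.\<close>

lemma greedy_invariant:
  assumes "j \<le> n"
  shows "clock greedy j + togo (n - j) (posn greedy j) (lagc greedy j) = togo n (\<lambda>_. 0) L"
  using assms
proof (induction j)
  case (Suc j)
  have e: "n - j = Suc (n - Suc j)" "n - Suc (n - Suc j) = j" using Suc.prems by auto
  have "togo (n - j) (posn greedy j) (lagc greedy j)
      = option_cost (n - Suc j) (posn greedy j) (lagc greedy j) (chc greedy j)"
    unfolding e(1) togo_Suc by (simp add: chc_def greedy_def)
  also have "\<dots> = gap j (posn greedy j) (lagc greedy j) (chc greedy j) + work j
      + togo (n - Suc j) (posn greedy (Suc j)) (lagc greedy (Suc j))"
    by (simp add: option_cost_def sim_Suc e(2))
  finally show ?case using Suc by (simp add: sim_Suc(1) begin_at_def)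
qed simp

lemma makesp_greedy: "makesp greedy = togo n (\<lambda>_. 0) L"
  using greedy_invariant[of n] by (simp add: makesp_def[OF greedy_admissible])

section \<open>Lower bound: comparing a feasible schedule with the simulation of its policy\<close>

definition rhome :: "nat \<Rightarrow> real \<Rightarrow> real" where
  "rhome k x = (if k = 0 then x else real L - x)"

text \<open>Why the cap loses nothing. Here \<open>t\<close> is the simulated clock,
  \<open>x\<close> the scaled real time of an event, \<open>y\<close> the scaled time at which a
  reclaimer last finished, \<open>d\<close> the distance required since then, \<open>l\<close> its
  lag and \<open>m\<close> the cap. A capped lag makes d - l vanish; an uncapped one lets t - l be
  replaced by y.\<close>

lemma add_lag_le:
  fixes t d l m :: nat and x y :: real
  assumes "real t \<le> x" "l = m \<or> real t \<le> y + real l" "d \<le> m" "y + real d \<le> x"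
  shows "real (t + (d - l)) \<le> x"
proof (cases "d \<le> l")
  case False
  then have "real (t + (d - l)) = real t + real d - real l" by (simp add: of_nat_diff)
  then show ?thesis using assms False by linarith
qed (use assms in simp)

lemma abs_rhome_diff: "\<bar>rhome k x - rhome k y\<bar> = \<bar>x - y\<bar>"
  by (simp add: rhome_def abs_minus_commute)

lemma rhome_home: "z \<le> L \<Longrightarrow> rhome k (real z) = real (home k z)"
  by (simp add: rhome_def home_def of_nat_diff)

context
  fixes S :: schedule
  assumes feas: "feasible I S"
begin

text \<open>All legal slopes are at most s in absolute value because s is at least 1, and the path
  is constant after the makespan. The induction over breakpoints splits an interval that straddles
  one.\<close>

lemma path_lipschitz:
  assumes "k < 2" "0 \<le> t" "t \<le> t'"
  shows "\<bar>path S k t' - path S k t\<bar> \<le> real s * (t' - t)"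
proof -
  let ?C = "makespan S k"
  have lp: "legal_path I S k" using feas assms(1) by (simp add: feasible_def)
  then obtain m \<tau> where \<tau>: "\<tau> 0 = (0::real)" "\<tau> m = ?C"
    "\<And>i. i < m \<Longrightarrow> \<tau> i \<le> \<tau> (Suc i) \<and> legal_piece I S k (\<tau> i) (\<tau> (Suc i))"
    unfolding legal_path_def by blast
  have tail: "t \<ge> ?C \<Longrightarrow> path S k t = path S k ?C" for t
    using lp unfolding legal_path_def by auto
  have *: "\<bar>path S k t' - path S k t\<bar> \<le> real s * (t' - t)"
    if "i \<le> m" "0 \<le> t" "t \<le> t'" "t' \<le> \<tau> i" for i t t'
    using that
  proof (induction i arbitrary: t t')
    case 0
    then have "t = 0" "t' = 0" using \<tau>(1) by auto
    then show ?case by simp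
  next
    case (Suc i)
    from \<tau>(3)[of i] Suc.prems obtain v where
      v: "\<forall>t\<in>{\<tau> i..\<tau> (Suc i)}. path S k t = path S k (\<tau> i) + v * (t - \<tau> i)"
      "v \<in> {0, speed I, - speed I} \<or> v \<in> {1, -1}" and le: "\<tau> i \<le> \<tau> (Suc i)"
      unfolding legal_piece_def by auto
    have vs: "\<bar>v\<bar> \<le> real s" using v(2) speed_eq s_pos by auto
    have lin: "\<bar>path S k b - path S k a\<bar> \<le> real s * (b - a)"
      if "\<tau> i \<le> a" "a \<le> b" "b \<le> \<tau> (Suc i)" for a b
    proof -
      have "path S k a = path S k (\<tau> i) + v * (a - \<tau> i)"
        "path S k b = path S k (\<tau> i) + v * (b - \<tau> i)"
        using that by (auto intro!: bspec[OF v(1)])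
      then have "path S k b - path S k a = v * (b - a)"
        by (simp add: algebra_simps)
      then show ?thesis using vs that by (simp add: abs_mult mult_right_mono)
    qed
    consider "t' \<le> \<tau> i" | "\<tau> i \<le> t" | "t \<le> \<tau> i" "\<tau> i \<le> t'" by linarith
    then show ?case
    proof cases
      case 1
      then show ?thesis using Suc by simp
    next
      case 2
      then show ?thesis using lin Suc.prems by simp
    next
      case 3
      have "\<bar>path S k (\<tau> i) - path S k t\<bar> \<le> real s * (\<tau> i - t)"
        using Suc.IH[of t "\<tau> i"] Suc.prems 3 by simp
      moreover have "\<bar>path S k t' - path S k (\<tau> i)\<bar> \<le> real s * (t' - \<tau> i)"
        using lin[of "\<tau> i" t'] Suc.prems 3 by simp
      ultimately show ?thesis by (simp add: algebra_simps abs_le_iff)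
    qed
  qed
  have up: "\<bar>path S k t' - path S k t\<bar> \<le> real s * (t' - t)"
    if "0 \<le> t" "t \<le> t'" "t' \<le> ?C" for t t'
    using *[of m t t'] \<tau>(2) that by simp
  consider "t' \<le> ?C" | "?C \<le> t" | "t \<le> ?C" "?C \<le> t'" by linarith
  then show ?thesis
  proof cases
    case 1
    then show ?thesis using up assms by simp
  next
    case 2
    then show ?thesis using tail[of t] tail[of t'] assms by simp
  next
    case 3
    have "real s * (?C - t) \<le> real s * (t' - t)" using 3 by (simp add: mult_left_mono)
    then show ?thesis using up[of t ?C] tail[of t'] 3 assms by simp
  qed
qed

lemma rhome_lipschitz:
  assumes "k < 2" "0 \<le> t" "t \<le> t'"
  shows "\<bar>rhome k (path S k t') - rhome k (path S k t)\<bar> \<le> real s * (t' - t)"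
  using path_lipschitz[OF assms] by (simp add: abs_rhome_diff)

lemma rhome_sum:
  assumes "k < 2" "0 \<le> t"
  shows "rhome k (path S k t) + rhome (1 - k) (path S (1 - k) t) \<le> real L"
  using feas assms by (auto simp: feasible_def rhome_def less_2_cases_iff)

text \<open>The choices are read off from the schedule, ignoring the simulated state; the default
  beyond the last job keeps the policy admissible.\<close>

definition taken :: policy where
  "taken j u y = (if j < n then (worker S j,
     if \<forall>t\<in>{start S j..finish I S j}. path S (worker S j) t = real (lft I j) + (t - start S j)
     then 0 else 1) else (0, 0))"

lemma job_data:
  assumes "j < n"
  defines "k \<equiv> worker S j"
  shows "k < 2" "0 \<le> start S j" "start S j \<le> finish I S j"
    "finish I S j \<le> makespan S k"
    "rhome k (path S k (start S j)) = real (from_pos j (taken j u y))"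
    "rhome k (path S k (finish I S j)) = real (to_pos j (taken j u y))"
    "real s * finish I S j = real s * start S j + real (work j)"
proof -
  have r: "reclaimed I S j" using feas assms by (simp add: feasible_def)
  have pb: "lft I j < rgt I j" "rgt I j \<le> L" using pile_bounds assms by auto
  have d: "dur I j = real (rgt I j) - real (lft I j)" by (simp add: dur_def)
  show "k < 2" "0 \<le> start S j" "finish I S j \<le> makespan S k"
    using r by (auto simp: reclaimed_def k_def)
  show le: "start S j \<le> finish I S j" using pb d by (simp add: finish_def)
  show "real s * finish I S j = real s * start S j + real (work j)"
    using pb unfolding d finish_def work_def by (simp add: of_nat_diff algebra_simps)
  have f: "finish I S j - start S j = real (rgt I j) - real (lft I j)"
    using d by (simp add: finish_def)
  let ?fwd = "\<forall>t\<in>{start S j..finish I S j}. path S k t = real (lft I j) + (t - start S j)"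
  have ends: "if ?fwd
    then path S k (start S j) = real (lft I j) \<and> path S k (finish I S j) = real (rgt I j)
    else path S k (start S j) = real (rgt I j) \<and> path S k (finish I S j) = real (lft I j)"
  proof (cases ?fwd)
    case True
    then have "path S k (start S j) = real (lft I j) + (start S j - start S j)"
      "path S k (finish I S j) = real (lft I j) + (finish I S j - start S j)"
      using le by (meson atLeastAtMost_iff order_refl)+
    then show ?thesis using True f by simp
  next
    case False
    then have "\<forall>t\<in>{start S j..finish I S j}. path S k t = real (rgt I j) - (t - start S j)"
      using r unfolding reclaimed_def k_def[symmetric] by blast
    then have "path S k (start S j) = real (rgt I j) - (start S j - start S j)"
      "path S k (finish I S j) = real (rgt I j) - (finish I S j - start S j)"
      using le by (meson atLeastAtMost_iff order_refl)+
    then show ?thesis using f unfolding if_not_P[OF False] by simp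
  qed
  have t: "taken j u y = (k, if ?fwd then 0 else 1)"
    using assms(1) by (simp add: taken_def k_def)
  show "rhome k (path S k (start S j)) = real (from_pos j (taken j u y))"
    "rhome k (path S k (finish I S j)) = real (to_pos j (taken j u y))"
    unfolding t using ends pb
    by (cases ?fwd; simp only: if_True if_False from_pos_def to_pos_def rhome_home[symmetric]
        fst_conv snd_conv; simp add: rhome_home)+
qed

lemma taken_admissible: "admissible taken"
  using job_data(1) by (auto simp: admissible_def taken_def)

primrec real_fin :: "nat \<Rightarrow> nat \<Rightarrow> real" where
  "real_fin 0 = (\<lambda>_. 0)"
| "real_fin (Suc j) = (real_fin j)(worker S j := finish I S j)"

primrec now :: "nat \<Rightarrow> real" where
  "now 0 = 0"
| "now (Suc j) = finish I S j"

lemma now_le_start: "j < n \<Longrightarrow> now j \<le> start S j"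
  using feas job_data(2)[of 0] by (cases j) (auto simp: feasible_def)

text \<open>Lags are capped at \<open>L\<close>; the disjunction says that a capped lag carries no information.\<close>

lemma simulation_early:
  assumes "j \<le> n"
  shows "real (clock taken j) \<le> real s * now j \<and>
    (\<forall>k<2. 0 \<le> real_fin j k \<and> real_fin j k \<le> now j \<and> real_fin j k \<le> makespan S k \<and>
       rhome k (path S k (real_fin j k)) = real (posn taken j k) \<and>
       (lag (lagc taken j) k = L \<or>
        real (clock taken j) \<le> real s * real_fin j k + real (lag (lagc taken j) k)))"
  using assms
proof (induction j)
  case 0
  have "legal_path I S k" if "k < 2" for k
    using feas that by (simp add: feasible_def)
  then show ?case by (auto simp: legal_path_def lag_def rhome_def less_2_cases_iff)
next
  case (Suc j)
  let ?k = "worker S j" and ?c = "chc taken j"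
  have jn: "j < n" using Suc.prems by simp
  note IH = Suc.IH[OF less_imp_le[OF jn]]
  note jd = job_data[OF jn]
  have k: "fst ?c = ?k" "?k < 2" using jn jd(1) by (simp_all add: chc_def taken_def)
  note ns = now_le_start[OF jn]
  have b: "rhome ?k (path S ?k (start S j)) = real (from_pos j ?c)"
    and e: "rhome ?k (path S ?k (finish I S j)) = real (to_pos j ?c)"
    using jd(5,6) by (simp_all add: chc_def)
  have o2: "1 - ?k < 2" by simp
  have ck: "real (clock taken j) \<le> real s * start S j"
    using IH ns mult_left_mono[OF ns, of "real s"] by simp
  have l0: "real L \<ge> real (from_pos j ?c)" "real L \<ge> real (posn taken j ?k)"
    "real L \<ge> real (posn taken j (1 - ?k))"
    using from_to_le(1)[OF jn, of ?c] posn_le[of j taken] jn by auto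
  have fe: "0 \<le> real_fin j k" "real_fin j k \<le> start S j" if "k < 2" for k
    using IH that ns by force+
  have w: "\<bar>real (from_pos j ?c) - real (posn taken j ?k)\<bar> \<le> real s * (start S j - real_fin j ?k)"
    using rhome_lipschitz[OF k(2) fe[OF k(2)]] b IH k(2) by simp
  \<comment> \<open>When the job starts, the two distances from home add up to at most L, and the
    other reclaimer has not come closer to home than its speed allows since its last job.\<close>
  have x: "real (from_pos j ?c) + real (posn taken j (1 - ?k))
      \<le> L + real s * (start S j - real_fin j (1 - ?k))"
  proof -
    have "\<bar>rhome (1 - ?k) (path S (1 - ?k) (start S j)) - real (posn taken j (1 - ?k))\<bar>
        \<le> real s * (start S j - real_fin j (1 - ?k))"
      using rhome_lipschitz[OF o2 fe[OF o2]] IH by simp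
    then show ?thesis using rhome_sum[OF k(2) jd(2)] b by linarith
  qed
  have lagw: "lag (lagc taken j) ?k = L \<or>
        real (clock taken j) \<le> real s * real_fin j ?k + real (lag (lagc taken j) ?k)"
    and lago: "lag (lagc taken j) (1 - ?k) = L \<or>
        real (clock taken j) \<le> real s * real_fin j (1 - ?k) + real (lag (lagc taken j) (1 - ?k))"
    using IH k(2) o2 by blast+
  \<comment> \<open>The two facts \<open>1\<close> and \<open>2\<close> are the two arguments of the
    maximum in \<open>gap\<close>, each an instance of \<open>add_lag_le\<close>.\<close>
  have start: "real (begin_at taken j) \<le> real s * start S j"
  proof -
    let ?d = "(from_pos j ?c - posn taken j ?k) + (posn taken j ?k - from_pos j ?c)"
    let ?x = "from_pos j ?c + posn taken j (1 - ?k) - L"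
    have "real ?d = \<bar>real (from_pos j ?c) - real (posn taken j ?k)\<bar>" by linarith
    then have 1: "real (clock taken j + (?d - lag (lagc taken j) ?k)) \<le> real s * start S j"
      using w l0 by (intro add_lag_le[OF ck lagw]) (auto simp: right_diff_distrib)
    have "real s * real_fin j (1 - ?k) \<le> real s * start S j"
      using fe[OF o2] by (intro mult_left_mono) auto
    then have "real s * real_fin j (1 - ?k) + real ?x \<le> real s * start S j"
      using x unfolding right_diff_distrib by linarith
    then have 2: "real (clock taken j + (?x - lag (lagc taken j) (1 - ?k))) \<le> real s * start S j"
      using l0 by (intro add_lag_le[OF ck lago]) auto
    show ?thesis using 1 2 by (simp add: begin_at_def gap_def Let_def max_def k(1))
  qed
  have clk: "real (clock taken (Suc j)) \<le> real s * finish I S j"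
    using start jd(7) by (simp add: sim_Suc)
  have "0 \<le> real_fin (Suc j) k \<and> real_fin (Suc j) k \<le> now (Suc j) \<and>
       real_fin (Suc j) k \<le> makespan S k \<and>
       rhome k (path S k (real_fin (Suc j) k)) = real (posn taken (Suc j) k) \<and>
       (lag (lagc taken (Suc j)) k = L \<or>
        real (clock taken (Suc j)) \<le> real s * real_fin (Suc j) k + real (lag (lagc taken (Suc j)) k))"
    if k2: "k < 2" for k
  proof (cases "k = ?k")
    case True
    then show ?thesis using jd e clk k by (simp add: sim_Suc)
  next
    case False
    then have ko: "k = 1 - ?k" using k2 k(2) by auto
    \<comment> \<open>The idle reclaimer's lag grows by exactly the advance of the clock, so the
      invariant survives unless the cap is reached, and then its first alternative holds.\<close>
    have "lag (lagc taken (Suc j)) k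
        = min L (lag (lagc taken j) k + (clock taken (Suc j) - clock taken j))"
      using lag_next(2)[of ?c j "posn taken j" "lagc taken j"] k ko
      by (simp add: sim_Suc begin_at_def add_ac)
    moreover have "clock taken j \<le> clock taken (Suc j)" by (rule clock_mono) simp
    ultimately have "lag (lagc taken (Suc j)) k = L \<or>
        real (clock taken (Suc j)) \<le> real s * real_fin j k + real (lag (lagc taken (Suc j)) k)"
      using lago unfolding ko[symmetric] by (auto simp: min_def of_nat_diff)
    moreover have "real_fin j k \<le> finish I S j" using fe(2)[OF k2] jd(3) by simp
    ultimately show ?thesis using IH k2 False k by (simp add: sim_Suc)
  qed
  then show ?case using clk by simp
qed

text \<open>The ride home is treated like a start condition at distance 0: by its makespan each
  reclaimer has covered its last recorded distance. Then \<open>togo_lower\<close> applies with no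
  job remaining.\<close>

lemma objective_lower: "real (togo n (\<lambda>_. 0) L) \<le> real s * objective S"
proof -
  note sim = simulation_early[of n, simplified]
  have lp: "legal_path I S k" if "k < 2" for k
    using feas that by (simp add: feasible_def)
  have nw: "now n \<le> objective S"
  proof (cases n)
    case 0
    then show ?thesis using lp[of 0] by (simp add: legal_path_def objective_def le_max_iff_disj)
  next
    case (Suc m)
    then have "m < n" by simp
    then show ?thesis using job_data(1,4)[of m] Suc
      by (auto simp: objective_def le_max_iff_disj less_2_cases_iff)
  qed
  have clk: "real (clock taken n) \<le> real s * objective S"
    using sim mult_left_mono[OF nw, of "real s"] by simp
  have k: "real (clock taken n + (posn taken n k - lag (lagc taken n) k)) \<le> real s * objective S"
    if "k < 2" for k
  proof -
    let ?C = "makespan S k"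
    have "\<bar>rhome k (path S k ?C) - rhome k (path S k (real_fin n k))\<bar>
        \<le> real s * (?C - real_fin n k)"
      using rhome_lipschitz[OF that] sim that by blast
    moreover have "rhome k (path S k ?C) = 0"
      using lp[OF that] that by (auto simp: legal_path_def rhome_def less_2_cases_iff)
    ultimately have "real (posn taken n k) \<le> real s * (?C - real_fin n k)"
      using sim that by simp
    moreover have "real s * ?C \<le> real s * objective S"
      using that by (intro mult_left_mono) (auto simp: objective_def less_2_cases_iff)
    moreover have "posn taken n k \<le> L" by (rule posn_le) simp
    moreover have "lag (lagc taken n) k = L \<or>
        real (clock taken n) \<le> real s * real_fin n k + real (lag (lagc taken n) k)"
      using sim that by blast
    ultimately show ?thesis
      by (intro add_lag_le[OF clk, of _ L "real s * real_fin n k"]) (auto simp: right_diff_distrib)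
  qed
  have "togo n (\<lambda>_. 0) L \<le> clock taken n + togo 0 (posn taken n) (lagc taken n)"
    using togo_lower[OF taken_admissible, of n] by simp
  then show ?thesis using k[of 0] k[of 1] by (auto simp: max_def split: if_splits)
qed

end

end

section \<open>The schedule as polylines\<close>

definition poly_points :: "nat \<Rightarrow> (nat \<Rightarrow> real) \<Rightarrow> (nat \<Rightarrow> real) \<Rightarrow> (real \<times> real) list" where
  "poly_points N f g = map (\<lambda>i. (f i, g i)) [0..<N]"

lemma poly_points_Suc_Suc:
  "poly_points (Suc (Suc N)) f g
    = (f 0, g 0) # (f 1, g 1) # poly_points N (\<lambda>i. f (Suc (Suc i))) (\<lambda>i. g (Suc (Suc i)))"
  "poly_points (Suc N) (\<lambda>i. f (Suc i)) (\<lambda>i. g (Suc i))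
    = (f 1, g 1) # poly_points N (\<lambda>i. f (Suc (Suc i))) (\<lambda>i. g (Suc (Suc i)))"
  unfolding poly_points_def map_upt_Suc by simp_all

text \<open>Times may repeat; the equation then forces equal positions, so pieces of length zero are
  compatible with any slope. This permits a uniform number of points per job.\<close>

definition slopes :: "nat \<Rightarrow> (nat \<Rightarrow> real) \<Rightarrow> (nat \<Rightarrow> real) \<Rightarrow> (nat \<Rightarrow> real) \<Rightarrow> bool" where
  "slopes N f g v \<longleftrightarrow>
    (\<forall>i. Suc i < N \<longrightarrow> f i \<le> f (Suc i) \<and> g (Suc i) = g i + v i * (f (Suc i) - f i))"

lemma slopes_mono:
  assumes "slopes N f g v" "i \<le> j" "j < N"
  shows "f i \<le> f j"
  using assms(2,3)
proof (induction j)
  case (Suc j)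
  then show ?case using assms(1) by (force simp: slopes_def le_Suc_eq)
qed simp

lemma polyline_after:
  assumes "slopes (Suc N) f g v" "f N \<le> t"
  shows "polyline (poly_points (Suc N) f g) t = g N"
  using assms
proof (induction N arbitrary: f g v)
  case 0
  then show ?case by (simp add: poly_points_def)
next
  case (Suc N)
  have s: "slopes (Suc N) (\<lambda>i. f (Suc i)) (\<lambda>i. g (Suc i)) (\<lambda>i. v (Suc i))"
    using Suc.prems(1) by (simp add: slopes_def)
  have "f 1 \<le> t" using slopes_mono[OF Suc.prems(1), of 1 "Suc N"] Suc.prems(2) by simp
  then show ?case using Suc.IH[OF s] Suc.prems(2)
    unfolding poly_points_Suc_Suc by simp
qed

lemma polyline_piece:
  assumes "slopes N f g v" "Suc i < N" "f i \<le> t" "t \<le> f (Suc i)"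
  shows "polyline (poly_points N f g) t = g i + v i * (t - f i)"
  using assms
proof (induction N arbitrary: f g v i)
  case (Suc N')
  then obtain N where N: "N' = Suc N" by (cases N') auto
  let ?f = "\<lambda>i. f (Suc i)" and ?g = "\<lambda>i. g (Suc i)" and ?v = "\<lambda>i. v (Suc i)"
  have s: "slopes (Suc N) ?f ?g ?v"
    using Suc.prems(1) unfolding N by (simp add: slopes_def)
  note IH = Suc.IH[OF s[folded N], unfolded N]
  have s0: "f 0 \<le> f 1" "g 1 = g 0 + v 0 * (f 1 - f 0)"
    using Suc.prems(1,2) unfolding N by (simp_all add: slopes_def)
  have unf: "polyline (poly_points (Suc N') f g) t =
      (if t < f 1 then g 0 + (g 1 - g 0) * (t - f 0) / (f 1 - f 0)
       else polyline (poly_points (Suc N) ?f ?g) t)"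
    unfolding N poly_points_Suc_Suc by simp
  show ?case
  proof (cases i)
    case 0
    show ?thesis
    proof (cases "t < f 1")
      case True
      then show ?thesis unfolding unf using 0 s0 Suc.prems(3) by simp
    next
      case False
      then have t: "t = f 1" using Suc.prems(4) 0 by simp
      \<comment> \<open>At t = \<open>f 1\<close> the strict test of \<open>polyline\<close> has
        already passed to the tail, whose value there has to be found separately for a single point
        and for a further piece.\<close>
      have "polyline (poly_points (Suc N) ?f ?g) t = g 1"
      proof (cases N)
        case 0
        then show ?thesis by (simp add: poly_points_def)
      next
        case (Suc M)
        have "f 1 \<le> f (Suc (Suc 0))" using s Suc by (simp add: slopes_def)
        then show ?thesis using IH[of 0] t Suc by simp
      qed
      then show ?thesis unfolding unf using False 0 s0 t by simp
    qed
  next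
    case (Suc i')
    have "f 1 \<le> f i" using slopes_mono[OF Suc.prems(1), of 1 i] Suc.prems(2) Suc by simp
    then have "\<not> t < f 1" using Suc.prems(3) by simp
    then show ?thesis unfolding unf using IH[of i'] Suc.prems Suc N by simp
  qed
qed simp

lemma find_piece:
  fixes f :: "nat \<Rightarrow> real"
  assumes "f 0 \<le> t" "t \<le> f N" "0 < N"
  obtains i where "i < N" "f i \<le> t" "t \<le> f (Suc i)"
proof -
  have "\<exists>i<N. f i \<le> t \<and> t \<le> f (Suc i)"
    using assms(2,3)
  proof (induction N)
    case (Suc N)
    show ?case
    proof (cases "t \<le> f N \<and> 0 < N")
      case True
      then show ?thesis using Suc.IH less_SucI by blast
    next
      case False
      then have "f N \<le> t" using assms(1) by (cases N) auto
      then show ?thesis using Suc.prems by blast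
    qed
  qed simp
  then show ?thesis using that by blast
qed

lemma polyline_continuous:
  assumes "slopes (Suc N) f g v"
  shows "continuous_on {f 0..f N} (polyline (poly_points (Suc N) f g))"
proof -
  let ?p = "polyline (poly_points (Suc N) f g)"
  have "i \<le> N \<Longrightarrow> continuous_on {f 0..f i} ?p" for i
  proof (induction i)
    case (Suc i)
    have le: "f 0 \<le> f i" "f i \<le> f (Suc i)"
      using Suc.prems slopes_mono[OF assms] by auto
    have "continuous_on {f i..f (Suc i)} ?p \<longleftrightarrow>
        continuous_on {f i..f (Suc i)} (\<lambda>t. g i + v i * (t - f i))"
      using Suc.prems by (intro continuous_on_cong refl polyline_piece[OF assms]) auto
    then have "continuous_on {f i..f (Suc i)} ?p" by (simp add: continuous_intros)
    moreover have "{f 0..f (Suc i)} = {f 0..f i} \<union> {f i..f (Suc i)}"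
      using le by auto
    ultimately show ?case
      using Suc by (simp add: continuous_on_closed_Un)
  qed simp
  then show ?thesis by simp
qed

lemma polyline_range:
  assumes "slopes (Suc N) f g v" "0 < N" "f 0 \<le> t" "t \<le> f N"
    and "\<And>i. i \<le> N \<Longrightarrow> a \<le> g i \<and> g i \<le> b"
  shows "a \<le> polyline (poly_points (Suc N) f g) t \<and> polyline (poly_points (Suc N) f g) t \<le> b"
proof -
  obtain i where i: "i < N" "f i \<le> t" "t \<le> f (Suc i)"
    using find_piece[of f t N] assms by blast
  have p: "polyline (poly_points (Suc N) f g) t = g i + v i * (t - f i)"
    using polyline_piece[OF assms(1)] i by simp
  have e: "g (Suc i) = g i + v i * (f (Suc i) - f i)" using assms(1) i by (simp add: slopes_def)
  have g: "a \<le> g i" "g i \<le> b" "a \<le> g (Suc i)" "g (Suc i) \<le> b" using assms(5) i(1) by auto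
  show ?thesis
  proof (cases "0 \<le> v i")
    case True
    then have "0 \<le> v i * (t - f i)" "v i * (t - f i) \<le> v i * (f (Suc i) - f i)"
      using i by (auto intro: mult_left_mono)
    then show ?thesis using p e g by linarith
  next
    case False
    then have "v i * (t - f i) \<le> 0" "v i * (f (Suc i) - f i) \<le> v i * (t - f i)"
      using i by (auto intro: mult_left_mono_neg simp: mult_nonpos_nonneg)
    then show ?thesis using p e g by linarith
  qed
qed

section \<open>Retreat-and-return paths that realise a policy\<close>

context scheduling
begin

text \<open>A leg ends where the next obligation begins: at a job or, for j = n, at home at the
  makespan. For the reclaimer idle in job j it ends where it starts, so that both paths have four
  points per job.\<close>

definition target_time :: "policy \<Rightarrow> nat \<Rightarrow> nat \<Rightarrow> nat" where
  "target_time \<pi> k j =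
    (if j = n then makesp \<pi> else if fst (chc \<pi> j) = k then begin_at \<pi> j else last_fin \<pi> j k)"

definition target_pos :: "policy \<Rightarrow> nat \<Rightarrow> nat \<Rightarrow> nat" where
  "target_pos \<pi> k j =
    (if j = n then 0 else if fst (chc \<pi> j) = k then from_pos j (chc \<pi> j) else posn \<pi> j k)"

text \<open>Twice the position at which a reclaimer turns that first moves towards its home at full
  speed and later returns just in time.\<close>

definition turn :: "policy \<Rightarrow> nat \<Rightarrow> nat \<Rightarrow> nat" where
  "turn \<pi> k j = posn \<pi> j k + target_pos \<pi> k j - (target_time \<pi> k j - last_fin \<pi> j k)"

text \<open>Everything is doubled since turning points can be half-integral. The two middle points
  coincide when the reclaimer turns before reaching home, and otherwise delimit its stay at
  home.\<close>

definition leg_time :: "policy \<Rightarrow> nat \<Rightarrow> nat \<Rightarrow> nat \<Rightarrow> nat" where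
  "leg_time \<pi> k j r =
    [2 * last_fin \<pi> j k,
     2 * last_fin \<pi> j k + (2 * posn \<pi> j k - turn \<pi> k j),
     2 * target_time \<pi> k j - (2 * target_pos \<pi> k j - turn \<pi> k j),
     2 * target_time \<pi> k j] ! r"

definition leg_home :: "policy \<Rightarrow> nat \<Rightarrow> nat \<Rightarrow> nat \<Rightarrow> nat" where
  "leg_home \<pi> k j r =
    [2 * posn \<pi> j k, turn \<pi> k j, turn \<pi> k j, 2 * target_pos \<pi> k j] ! r"

definition point_time :: "policy \<Rightarrow> nat \<Rightarrow> nat \<Rightarrow> real" where
  "point_time \<pi> k i = real (leg_time \<pi> k (i div 4) (i mod 4)) / (2 * real s)"

definition point_pos :: "policy \<Rightarrow> nat \<Rightarrow> nat \<Rightarrow> real" where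
  "point_pos \<pi> k i = rhome k (real (leg_home \<pi> k (i div 4) (i mod 4)) / 2)"

text \<open>Piece 3 of each block joins leg j to leg j + 1: it is the job itself, with a slope
  depending on its direction only, and it has length zero for the idle reclaimer.\<close>

definition slope :: "policy \<Rightarrow> nat \<Rightarrow> nat \<Rightarrow> real" where
  "slope \<pi> k i =
    (let c = chc \<pi> (i div 4); \<epsilon> = (if k = 0 then 1 else -1) in
     [- \<epsilon> * real s, 0, \<epsilon> * real s,
      if fst c = k then (if snd c = 0 then 1 else -1) else 0] ! (i mod 4))"

context
  fixes \<pi> assumes adm: "admissible \<pi>"
begin

lemma leg_feasible:
  assumes "j \<le> n" "k < 2"
  shows "last_fin \<pi> j k + target_pos \<pi> k j \<le> posn \<pi> j k + target_time \<pi> k j"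
    "last_fin \<pi> j k + posn \<pi> j k \<le> target_pos \<pi> k j + target_time \<pi> k j"
    "last_fin \<pi> j k \<le> target_time \<pi> k j"
    "target_pos \<pi> k j \<le> L"
proof -
  have "j \<noteq> n \<Longrightarrow> fst (chc \<pi> j) = k \<Longrightarrow> last_fin \<pi> j k \<le> begin_at \<pi> j"
    using last_fin_le[OF adm assms(2), of j] clock_le_begin[of \<pi> j] by simp
  then show "last_fin \<pi> j k + target_pos \<pi> k j \<le> posn \<pi> j k + target_time \<pi> k j"
    "last_fin \<pi> j k + posn \<pi> j k \<le> target_pos \<pi> k j + target_time \<pi> k j"
    "last_fin \<pi> j k \<le> target_time \<pi> k j"
    using begin_worker[OF adm, of k j] makesp_ge[OF adm assms(2)]
    by (auto simp: target_time_def target_pos_def)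
  show "target_pos \<pi> k j \<le> L"
    using assms(1) from_to_le(1)[of j "chc \<pi> j"] posn_le[of j \<pi> k] by (auto simp: target_pos_def)
qed

text \<open>The last item is the dichotomy used later: either truncation left 0, a stay at home, or
  the outward and return lines meet exactly at the turn.\<close>

lemma turn_facts:
  assumes "j \<le> n" "k < 2"
  shows "turn \<pi> k j \<le> 2 * posn \<pi> j k" "turn \<pi> k j \<le> 2 * target_pos \<pi> k j"
    "posn \<pi> j k + target_pos \<pi> k j + last_fin \<pi> j k \<le> turn \<pi> k j + target_time \<pi> k j"
    "2 * target_pos \<pi> k j \<le> turn \<pi> k j + 2 * target_time \<pi> k j"
    "turn \<pi> k j = 0 \<or>
      turn \<pi> k j + target_time \<pi> k j = posn \<pi> j k + target_pos \<pi> k j + last_fin \<pi> j k"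
  using leg_feasible[OF assms] unfolding turn_def by linarith+

lemma target_next:
  assumes "j < n" "k < 2"
  shows "fst (chc \<pi> j) = k \<Longrightarrow> last_fin \<pi> (Suc j) k = target_time \<pi> k j + work j
      \<and> posn \<pi> (Suc j) k = to_pos j (chc \<pi> j) \<and> target_pos \<pi> k j = from_pos j (chc \<pi> j)
      \<and> target_time \<pi> k j = begin_at \<pi> j"
    "fst (chc \<pi> j) \<noteq> k \<Longrightarrow> last_fin \<pi> (Suc j) k = target_time \<pi> k j
      \<and> posn \<pi> (Suc j) k = target_pos \<pi> k j
      \<and> target_time \<pi> k j = last_fin \<pi> j k \<and> target_pos \<pi> k j = posn \<pi> j k"
  using assms by (simp_all add: target_time_def target_pos_def sim_Suc)

lemma index_cases:
  fixes i :: nat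
  obtains j r where "i = 4 * j + r" "r < 4" "j = i div 4" "r = i mod 4"
  using that[of "i div 4" "i mod 4"] by simp

lemma s_real_pos: "0 < real s"
  using s_pos by simp

lemma s_point_time: "real s * point_time \<pi> k i = real (leg_time \<pi> k (i div 4) (i mod 4)) / 2"
  using s_real_pos by (simp add: point_time_def)

lemma rhome_rhome: "rhome k (rhome k x) = x"
  by (simp add: rhome_def)

text \<open>Measured in time multiplied by s and in distance from home, travel has slope 1 or -1 for
  both reclaimers and all data are halves of naturals; real paths are recovered from this by
  rescaling.\<close>

lemma step_scaled:
  assumes "i < 4 * n + 3" "k < 2"
  defines "f \<equiv> \<lambda>i. real (leg_time \<pi> k (i div 4) (i mod 4)) / 2"
    and "g \<equiv> \<lambda>i. real (leg_home \<pi> k (i div 4) (i mod 4)) / 2"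
    and "c \<equiv> chc \<pi> (i div 4)"
  shows "f i \<le> f (Suc i)"
    "i mod 4 = 0 \<Longrightarrow> g (Suc i) = g i - (f (Suc i) - f i)"
    "i mod 4 = 1 \<Longrightarrow> g (Suc i) = g i"
    "i mod 4 = 2 \<Longrightarrow> g (Suc i) = g i + (f (Suc i) - f i)"
    "i mod 4 = 3 \<Longrightarrow> fst c \<noteq> k \<Longrightarrow> f (Suc i) = f i \<and> g (Suc i) = g i"
    "i mod 4 = 3 \<Longrightarrow> fst c = k \<Longrightarrow> f i = real (begin_at \<pi> (i div 4))
      \<and> f (Suc i) = f i + real (work (i div 4))
      \<and> g i = real (from_pos (i div 4) c) \<and> g (Suc i) = real (to_pos (i div 4) c)"
proof -
  obtain j r where i: "i = 4 * j + r" "r < 4" "j = i div 4" "r = i mod 4" by (rule index_cases)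
  have j: "j \<le> n" using i assms(1) by linarith
  note F = leg_feasible[OF j assms(2)] and H = turn_facts[OF j assms(2)]
  have r: "r = 0 \<or> r = 1 \<or> r = 2 \<or> r = 3" using i(2) by linarith
  have sd: "i div 4 = j" "i mod 4 = r"
    "Suc i div 4 = (if r = 3 then Suc j else j)" "Suc i mod 4 = (if r = 3 then 0 else Suc r)"
    using i(1,2) r by auto
  have jn: "r = 3 \<Longrightarrow> j < n" using i assms(1) by linarith
  have l1: "leg_time \<pi> k j 0 \<le> leg_time \<pi> k j 1" "leg_time \<pi> k j 1 \<le> leg_time \<pi> k j 2"
    "leg_time \<pi> k j 2 \<le> leg_time \<pi> k j 3"
    using F H by (simp_all add: leg_time_def)
  have l2: "real (leg_time \<pi> k j 1) = real (leg_time \<pi> k j 0) + (real (leg_home \<pi> k j 0) - real (leg_home \<pi> k j 1))"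
    "real (leg_time \<pi> k j 3) = real (leg_time \<pi> k j 2) + (real (leg_home \<pi> k j 3) - real (leg_home \<pi> k j 2))"
    "leg_home \<pi> k j 2 = leg_home \<pi> k j 1"
    using F H by (simp_all add: leg_time_def leg_home_def of_nat_diff)
  have next0: "j < n \<Longrightarrow> leg_time \<pi> k j 3 \<le> leg_time \<pi> k (Suc j) 0"
    using target_next[of j k] assms(2) by (cases "fst (chc \<pi> j) = k") (auto simp: leg_time_def)
  show "f i \<le> f (Suc i)"
    using r l1 next0 jn unfolding f_def sd by (auto simp: numeral_2_eq_2 numeral_3_eq_3)
  show "i mod 4 = 0 \<Longrightarrow> g (Suc i) = g i - (f (Suc i) - f i)"
    "i mod 4 = 1 \<Longrightarrow> g (Suc i) = g i"
    "i mod 4 = 2 \<Longrightarrow> g (Suc i) = g i + (f (Suc i) - f i)"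
    using l2 unfolding f_def g_def sd
    by (auto simp: numeral_2_eq_2 numeral_3_eq_3 field_simps)
  show "i mod 4 = 3 \<Longrightarrow> fst c \<noteq> k \<Longrightarrow> f (Suc i) = f i \<and> g (Suc i) = g i"
    "i mod 4 = 3 \<Longrightarrow> fst c = k \<Longrightarrow> f i = real (begin_at \<pi> (i div 4))
      \<and> f (Suc i) = f i + real (work (i div 4))
      \<and> g i = real (from_pos (i div 4) c) \<and> g (Suc i) = real (to_pos (i div 4) c)"
    using target_next[of j k] jn assms(2) unfolding f_def g_def c_def sd
    by (auto simp: leg_time_def leg_home_def)
qed

lemma job_ends:
  assumes "j < n" "fst c = k"
  shows "rhome k (real (to_pos j c))
      = rhome k (real (from_pos j c)) + (if snd c = 0 then 1 else -1) * dur I j"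
    "rhome k (real (from_pos j c)) = real (if snd c = 0 then lft I j else rgt I j)"
  using pile_bounds[OF assms(1)] assms(2)
  by (auto simp: from_pos_def to_pos_def rhome_def home_def of_nat_diff dur_def)

lemma work_dur: "j < n \<Longrightarrow> real (work j) = real s * dur I j"
  using pile_bounds[of j] by (simp add: work_def dur_def of_nat_diff)

lemma point_slopes:
  assumes "k < 2"
  shows "slopes (Suc (4 * n + 3)) (point_time \<pi> k) (point_pos \<pi> k) (slope \<pi> k)"
  unfolding slopes_def
proof (intro allI impI conjI)
  fix i assume "Suc i < Suc (4 * n + 3)"
  then have i: "i < 4 * n + 3" by simp
  note st = step_scaled[OF i assms, folded s_point_time]
  show "point_time \<pi> k i \<le> point_time \<pi> k (Suc i)"
    using st(1) s_real_pos by simp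
  let ?\<Delta> = "point_time \<pi> k (Suc i) - point_time \<pi> k i"
  have r: "i mod 4 = 0 \<or> i mod 4 = 1 \<or> i mod 4 = 2 \<or> i mod 4 = 3" by linarith
  show "point_pos \<pi> k (Suc i) = point_pos \<pi> k i + slope \<pi> k i * ?\<Delta>"
  proof (cases "i mod 4 = 3")
    case False
    then show ?thesis using r st(2,3,4) unfolding point_pos_def
      by (auto simp: slope_def Let_def rhome_def algebra_simps)
  next
    case True
    let ?j = "i div 4"
    let ?c = "chc \<pi> ?j"
    have j: "?j < n" using i True by presburger
    show ?thesis
    proof (cases "fst ?c = k")
      case False
      then show ?thesis using st(5) True by (simp add: point_pos_def slope_def Let_def)
    next
      case c: True
      have "real s * ?\<Delta> = real s * dur I ?j"
        using st(6)[OF True c] work_dur[OF j] by (simp add: right_diff_distrib)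
      then have d: "?\<Delta> = dur I ?j" using s_real_pos by simp
      then show ?thesis
        using st(6)[OF True c] job_ends(1)[OF j c] c True
        unfolding d by (simp add: point_pos_def slope_def Let_def)
    qed
  qed
qed

lemma point_ends:
  assumes "k < 2"
  shows "point_time \<pi> k 0 = 0" "point_time \<pi> k (4 * n + 3) = real (makesp \<pi>) / real s"
    "point_pos \<pi> k 0 = real k * real L" "point_pos \<pi> k (4 * n + 3) = real k * real L"
proof -
  have "(4 * n + 3) div 4 = n" "(4 * n + 3) mod 4 = 3" by auto
  then show "point_time \<pi> k 0 = 0" "point_time \<pi> k (4 * n + 3) = real (makesp \<pi>) / real s"
    "point_pos \<pi> k 0 = real k * real L" "point_pos \<pi> k (4 * n + 3) = real k * real L"
    using assms
    by (auto simp: point_time_def point_pos_def leg_time_def leg_home_def target_time_def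
        target_pos_def rhome_def less_2_cases_iff)
qed

lemma point_pos_range:
  assumes "k < 2" "i \<le> 4 * n + 3"
  shows "0 \<le> point_pos \<pi> k i \<and> point_pos \<pi> k i \<le> real L"
proof -
  obtain j r where i: "i = 4 * j + r" "r < 4" "j = i div 4" "r = i mod 4" by (rule index_cases)
  have j: "j \<le> n" using i assms(2) by linarith
  have r: "r = 0 \<or> r = 1 \<or> r = 2 \<or> r = 3" using i(2) by linarith
  have "leg_home \<pi> k j r \<le> 2 * L"
    using r leg_feasible(4)[OF j assms(1)] turn_facts(1)[OF j assms(1)] posn_le[OF j, of \<pi> k]
    by (auto simp: leg_home_def)
  then show ?thesis unfolding point_pos_def i(3)[symmetric] i(4)[symmetric]
    by (auto simp: rhome_def)
qed

text \<open>Every point of a path satisfies such a bound, and the bounds for the two reclaimers add up to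
  at most \<open>L\<close>.\<close>

definition near :: "nat \<Rightarrow> real \<Rightarrow> real \<Rightarrow> bool" where
  "near k x z \<longleftrightarrow> z \<le> 0 \<or> (\<exists>j<n. fst (chc \<pi> j) = k \<and>
     z \<le> real (to_pos j (chc \<pi> j)) + real (clock \<pi> (Suc j)) - x \<and>
     z \<le> real (from_pos j (chc \<pi> j)) + x - real (begin_at \<pi> j))"

text \<open>The induction goes back to the last job of k before j, which set \<open>posn\<close> and
  \<open>last_fin\<close>. Without such a job both are 0 and z is not positive. The rising side of
  that job's tent holds too, since \<open>to\<close> is at most \<open>from\<close> plus
  \<open>work\<close>.\<close>

lemma near_leave:
  assumes "j \<le> n" "real (last_fin \<pi> j k) \<le> x" "z \<le> real (posn \<pi> j k) - (x - real (last_fin \<pi> j k))"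
  shows "near k x z"
  using assms
proof (induction j)
  case 0
  then show ?case by (simp add: near_def)
next
  case (Suc j)
  show ?case
  proof (cases "fst (chc \<pi> j) = k")
    case True
    have "real (last_fin \<pi> (Suc j) k) = real (clock \<pi> (Suc j))"
      "posn \<pi> (Suc j) k = to_pos j (chc \<pi> j)"
      "real (clock \<pi> (Suc j)) = real (begin_at \<pi> j) + real (work j)"
      using True by (simp_all add: sim_Suc)
    moreover have "real (to_pos j (chc \<pi> j)) \<le> real (from_pos j (chc \<pi> j)) + real (work j)"
      using from_to_work(2)[of j] Suc.prems(1) by (metis Suc_le_lessD of_nat_add of_nat_le_iff)
    ultimately have "z \<le> real (to_pos j (chc \<pi> j)) + real (clock \<pi> (Suc j)) - x"
      "z \<le> real (from_pos j (chc \<pi> j)) + x - real (begin_at \<pi> j)"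
      using Suc.prems(2,3) by simp_all
    then show ?thesis unfolding near_def using True Suc.prems(1) by auto
  next
    case False
    then show ?thesis using Suc by (simp add: sim_Suc)
  qed
qed

lemma near_job:
  assumes "j < n" "fst (chc \<pi> j) = k" "real (begin_at \<pi> j) \<le> x" "x \<le> real (clock \<pi> (Suc j))"
    and "z \<le> real (from_pos j (chc \<pi> j)) + (x - real (begin_at \<pi> j))"
    and "z \<le> real (to_pos j (chc \<pi> j)) + (real (clock \<pi> (Suc j)) - x)"
  shows "near k x z"
  unfolding near_def using assms by (intro disjI2 exI[of _ j]) simp

lemma near_arrive:
  assumes "j < n" "fst (chc \<pi> j) = k" "x \<le> real (begin_at \<pi> j)"
    and "z \<le> real (from_pos j (chc \<pi> j)) - (real (begin_at \<pi> j) - x)"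
  shows "near k x z"
proof -
  have "real (from_pos j (chc \<pi> j)) \<le> real (to_pos j (chc \<pi> j)) + real (work j)"
    using from_to_work(1)[OF assms(1)] by (metis of_nat_add of_nat_le_iff)
  moreover have "real (clock \<pi> (Suc j)) = real (begin_at \<pi> j) + real (work j)"
    by (simp add: sim_Suc)
  ultimately show ?thesis unfolding near_def using assms
    by (intro disjI2 exI[of _ j]) simp
qed

text \<open>If both distances are positive, take the falling side for the earlier of the two jobs
  and the rising side for the later; x cancels, and \<open>earlier_jobs\<close> with
  \<open>begin_other\<close> bounds the rest. Otherwise the bound L on the other distance
  suffices.\<close>

lemma near_sum:
  assumes "near 0 x z" "near 1 x z'" "z \<le> real L" "z' \<le> real L"
  shows "z + z' \<le> real L"
proof (cases "z \<le> 0 \<or> z' \<le> 0")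
  case False
  have key: "real (to_pos i (chc \<pi> i)) + real (clock \<pi> (Suc i)) + real (from_pos j (chc \<pi> j))
      \<le> real L + real (begin_at \<pi> j)"
    if "i < j" "j < n" "fst (chc \<pi> i) \<noteq> fst (chc \<pi> j)" for i j
  proof -
    have o: "fst (chc \<pi> i) = 1 - fst (chc \<pi> j)"
      using that(3) chc_range(1)[OF adm, of i] chc_range(1)[OF adm, of j] by linarith
    have "to_pos i (chc \<pi> i) + clock \<pi> (Suc i) + from_pos j (chc \<pi> j) \<le> L + begin_at \<pi> j"
      using earlier_jobs[OF adm that(1) less_imp_le[OF that(2)] refl] begin_other[OF adm refl, of j]
      unfolding o by linarith
    then show ?thesis by linarith
  qed
  obtain j j' where j: "j < n" "fst (chc \<pi> j) = 0" "j' < n" "fst (chc \<pi> j') = 1"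
     "z \<le> real (to_pos j (chc \<pi> j)) + real (clock \<pi> (Suc j)) - x"
     "z \<le> real (from_pos j (chc \<pi> j)) + x - real (begin_at \<pi> j)"
     "z' \<le> real (to_pos j' (chc \<pi> j')) + real (clock \<pi> (Suc j')) - x"
     "z' \<le> real (from_pos j' (chc \<pi> j')) + x - real (begin_at \<pi> j')"
    using assms(1,2) False unfolding near_def by auto
  then have "j < j' \<or> j' < j" by (metis nat_neq_iff zero_neq_one)
  then show ?thesis using key[of j j'] key[of j' j] j by auto
qed (use assms in auto)

lemma home_near:
  assumes "k < 2" "0 \<le> t" "t \<le> real (makesp \<pi>) / real s"
  shows "near k (real s * t)
    (rhome k (polyline (poly_points (Suc (4 * n + 3)) (point_time \<pi> k) (point_pos \<pi> k)) t))"
proof -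
  obtain i where i: "i < 4 * n + 3" "point_time \<pi> k i \<le> t" "t \<le> point_time \<pi> k (Suc i)"
    using find_piece[of "point_time \<pi> k" t "4 * n + 3"] point_ends[OF assms(1)] assms by auto
  let ?j = "i div 4" and ?r = "i mod 4"
  let ?c = "chc \<pi> ?j" and ?x = "real s * t"
  let ?h = "real (leg_home \<pi> k ?j ?r) / 2" and ?f = "real (leg_time \<pi> k ?j ?r) / 2"
  let ?z = "rhome k (polyline (poly_points (Suc (4 * n + 3)) (point_time \<pi> k) (point_pos \<pi> k)) t)"
  have z0: "?z = rhome k (rhome k ?h + slope \<pi> k i * (t - point_time \<pi> k i))"
    using polyline_piece[OF point_slopes[OF assms(1)] _ i(2,3)] i(1) by (simp add: point_pos_def)
  have z: "?z = ?h + (if k = 0 then 1 else -1) * slope \<pi> k i * (t - point_time \<pi> k i)"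
    unfolding z0 by (simp add: rhome_def)
  have xs: "?f \<le> ?x" "?x \<le> real (leg_time \<pi> k (Suc i div 4) (Suc i mod 4)) / 2"
    "real s * (t - point_time \<pi> k i) = ?x - ?f"
    using i(2,3) s_real_pos unfolding s_point_time[symmetric]
    by (auto simp: right_diff_distrib)
  note st = step_scaled[OF i(1) assms(1)]
  have j: "?j \<le> n" using i(1) by linarith
  note F = leg_feasible[OF j assms(1)] and H = turn_facts[OF j assms(1)]
  have leave: "near k ?x z" if "?x = real (last_fin \<pi> ?j k) + d" "0 \<le> d" "z \<le> real (posn \<pi> ?j k) - d" for z d
    using near_leave[OF j, of k ?x z] that by simp
  consider "?r = 0" | "?r = 1" | "?r = 2" | "?r = 3" by linarith
  then show ?thesis
  proof cases
    case 1
    then have "?z = ?h - (?x - ?f)" unfolding z xs(3)[symmetric] by (simp add: slope_def Let_def)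
    then show ?thesis using xs(1) 1 by (intro leave[of "?x - ?f"]) (auto simp: leg_time_def leg_home_def)
  next
    case 2
    then have zz: "?z = real (turn \<pi> k ?j) / 2" unfolding z by (simp add: slope_def Let_def leg_home_def)
    show ?thesis
    proof (cases "turn \<pi> k ?j = 0")
      case True
      then show ?thesis using zz by (simp add: near_def)
    next
      case False
      \<comment> \<open>A turn away from home has no plateau, so the time is exactly that of the
        turn, which also lies on the leaving line.\<close>
      have sd: "Suc i div 4 = ?j" "Suc i mod 4 = 2" using 2 by presburger+
      have "real (turn \<pi> k ?j) + real (target_time \<pi> k ?j)
          = real (posn \<pi> ?j k) + real (target_pos \<pi> k ?j) + real (last_fin \<pi> ?j k)"
        using H(5) False by linarith
      then have "?x = real (last_fin \<pi> ?j k) + (real (posn \<pi> ?j k) - real (turn \<pi> k ?j) / 2)"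
        using xs(1,2) 2 H unfolding sd by (simp add: leg_time_def of_nat_diff)
      then show ?thesis using zz H(1) by (intro leave) auto
    qed
  next
    case 3
    have sd: "Suc i div 4 = ?j" "Suc i mod 4 = 3" using 3 by presburger+
    have "?z = ?h + (?x - ?f)" using 3 unfolding z xs(3)[symmetric] by (simp add: slope_def Let_def)
    then have zz: "?z = real (target_pos \<pi> k ?j) - (real (target_time \<pi> k ?j) - ?x)"
      using 3 H
      by (simp add: leg_time_def leg_home_def of_nat_diff diff_divide_distrib add_divide_distrib)
    have x: "?x \<le> real (target_time \<pi> k ?j)" using xs(2) unfolding sd by (simp add: leg_time_def)
    show ?thesis
    proof (cases "?j = n \<or> fst ?c \<noteq> k")
      case True
      then show ?thesis
      proof
        assume "?j = n"
        then show ?thesis using zz x by (simp add: near_def target_pos_def)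
      next
        assume c: "fst ?c \<noteq> k"
        show ?thesis
        proof (cases "?j = n")
          case True
          then show ?thesis using zz x by (simp add: near_def target_pos_def)
        next
          case False
          \<comment> \<open>The leg of the idle reclaimer is a single point, covered as leaving with
            delay 0.\<close>
          then have tt: "target_time \<pi> k ?j = last_fin \<pi> ?j k" "target_pos \<pi> k ?j = posn \<pi> ?j k"
            using c by (simp_all add: target_time_def target_pos_def)
          have "?f \<le> ?x" "?f = real (target_time \<pi> k ?j) - (real (target_pos \<pi> k ?j) - real (turn \<pi> k ?j) / 2)"
            using xs(1) 3 H by (simp_all add: leg_time_def of_nat_diff)
          moreover have "turn \<pi> k ?j = 2 * posn \<pi> ?j k" unfolding turn_def tt by simp
          ultimately show ?thesis using zz x unfolding tt by (intro leave[of 0]) auto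
        qed
      qed
    next
      case False
      then have "?j < n" "fst ?c = k" using j by auto
      then show ?thesis using near_arrive[of ?j k ?x ?z] zz x by (simp add: target_time_def target_pos_def)
    qed
  next
    case 4
    have jn: "?j < n" using 4 i(1) by presburger
    have sd: "Suc i div 4 = Suc ?j" "Suc i mod 4 = 0" using 4 by presburger+
    show ?thesis
    proof (cases "fst ?c = k")
      case False
      have "?x = ?f" using xs(1,2) st(5)[OF 4 False] by linarith
      then have "?x = real (last_fin \<pi> ?j k)" "?z = real (posn \<pi> ?j k)"
        using 4 False target_next(2)[OF jn assms(1) False] unfolding z
        by (simp_all add: leg_time_def leg_home_def slope_def Let_def)
      then show ?thesis by (intro leave[of 0]) auto
    next
      case True
      note st6 = st(6)[OF 4 True]
      have x: "real (begin_at \<pi> ?j) \<le> ?x" "?x \<le> real (clock \<pi> (Suc ?j))"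
        using xs(1,2) st6 by (simp_all add: sim_Suc)
      \<comment> \<open>Reclaiming has real speed 1, hence at most 1 in scaled time as s is at least
        1. Measuring from the start and from the end of the job gives the two sides of the
        tent.\<close>
      have t: "0 \<le> t - point_time \<pi> k i" "t - point_time \<pi> k i \<le> ?x - real (begin_at \<pi> ?j)"
      proof -
        show "0 \<le> t - point_time \<pi> k i" using i(2) by simp
        then have "1 * (t - point_time \<pi> k i) \<le> real s * (t - point_time \<pi> k i)"
          using s_pos by (intro mult_right_mono) auto
        then show "t - point_time \<pi> k i \<le> ?x - real (begin_at \<pi> ?j)"
          using xs(3) st6 by simp
      qed
      have zh: "?z = real (from_pos ?j ?c) + (if k = 0 then 1 else -1) * slope \<pi> k i * (t - point_time \<pi> k i)"
        using st6 unfolding z by simp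
      have "?z \<le> real (from_pos ?j ?c) + (?x - real (begin_at \<pi> ?j))"
        using zh t True 4 by (auto simp: slope_def Let_def)
      moreover have "?z \<le> real (to_pos ?j ?c) + (real (clock \<pi> (Suc ?j)) - ?x)"
      proof -
        let ?u = "point_time \<pi> k (Suc i) - t"
        have u: "0 \<le> ?u" "real s * ?u = real (clock \<pi> (Suc ?j)) - ?x"
          using i(3) st6 unfolding right_diff_distrib s_point_time by (auto simp: sim_Suc)
        then have "1 * ?u \<le> real (clock \<pi> (Suc ?j)) - ?x"
          using s_pos unfolding u(2)[symmetric] by (intro mult_right_mono) auto
        moreover have "rhome k (point_pos \<pi> k (Suc i)) = real (to_pos ?j ?c)"
          using st6 by (simp add: point_pos_def rhome_rhome)
        moreover have "point_pos \<pi> k (Suc i) = point_pos \<pi> k i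
            + slope \<pi> k i * (point_time \<pi> k (Suc i) - point_time \<pi> k i)"
          using point_slopes[OF assms(1)] i(1) by (simp add: slopes_def)
        moreover have "slope \<pi> k i = 1 \<or> slope \<pi> k i = -1"
          using True 4 by (simp add: slope_def Let_def)
        ultimately show ?thesis using u(1) z0
          by (auto simp: rhome_def point_pos_def split: if_splits)
      qed
      ultimately show ?thesis using near_job[OF jn True x] by simp
    qed
  qed
qed

context
  fixes S :: schedule
  assumes paths: "\<And>k. k < 2 \<Longrightarrow>
      path S k = polyline (poly_points (Suc (4 * n + 3)) (point_time \<pi> k) (point_pos \<pi> k))"
    and ends: "\<And>k. k < 2 \<Longrightarrow> makespan S k = real (makesp \<pi>) / real s"
    and jobs: "\<And>j. j < n \<Longrightarrow> worker S j = fst (chc \<pi> j)"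
      "\<And>j. j < n \<Longrightarrow> start S j = real (begin_at \<pi> j) / real s"
begin

lemma path_piece:
  assumes "k < 2" "i < 4 * n + 3" "point_time \<pi> k i \<le> t" "t \<le> point_time \<pi> k (Suc i)"
  shows "path S k t = point_pos \<pi> k i + slope \<pi> k i * (t - point_time \<pi> k i)"
  using polyline_piece[OF point_slopes[OF assms(1)] _ assms(3,4)] assms(2) paths[OF assms(1)] by simp

lemma job_piece:
  assumes "j < n" "fst (chc \<pi> j) = k"
  defines "i \<equiv> 4 * j + 3"
  shows "point_time \<pi> k i = start S j" "point_time \<pi> k (Suc i) = finish I S j"
    "point_pos \<pi> k i = real (if snd (chc \<pi> j) = 0 then lft I j else rgt I j)"
    "slope \<pi> k i = (if snd (chc \<pi> j) = 0 then 1 else -1)"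
proof -
  have k: "k < 2" using assms(2) chc_range(1)[OF adm, of j] by simp
  have i: "i < 4 * n + 3" "i div 4 = j" "i mod 4 = 3" using assms(1) unfolding i_def by auto
  note st = step_scaled(6)[OF i(1) k i(3), unfolded i(2), OF assms(2), folded i(2), folded s_point_time,
      unfolded i(2)]
  have "real s * start S j = real (begin_at \<pi> j)" using jobs(2)[OF assms(1)] s_real_pos by simp
  then have "real s * point_time \<pi> k i = real s * start S j"
    "real s * point_time \<pi> k (Suc i) = real s * finish I S j"
    using st work_dur[OF assms(1)] by (simp_all add: finish_def distrib_left)
  then show "point_time \<pi> k i = start S j" "point_time \<pi> k (Suc i) = finish I S j"
    using s_real_pos by simp_all
  show "point_pos \<pi> k i = real (if snd (chc \<pi> j) = 0 then lft I j else rgt I j)"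
    using st job_ends(2)[OF assms(1,2)] by (simp add: point_pos_def i(2))
  show "slope \<pi> k i = (if snd (chc \<pi> j) = 0 then 1 else -1)"
    using assms(2) by (simp add: slope_def Let_def i)
qed

lemma points_reclaimed:
  assumes "j < n"
  shows "reclaimed I S j"
proof -
  let ?k = "fst (chc \<pi> j)"
  have k: "?k < 2" by (rule chc_range[OF adm])
  note jp = job_piece[OF assms refl]
  have "path S ?k t = real (if snd (chc \<pi> j) = 0 then lft I j else rgt I j)
      + (if snd (chc \<pi> j) = 0 then 1 else -1) * (t - start S j)"
    if "t \<in> {start S j..finish I S j}" for t
    using path_piece[OF k, of "4 * j + 3" t] that assms unfolding jp by simp
  moreover have "finish I S j \<le> makespan S ?k"
    using slopes_mono[OF point_slopes[OF k], of "Suc (4 * j + 3)" "4 * n + 3"] assms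
    unfolding jp ends[OF k] point_ends(2)[OF k] by simp
  moreover have "0 \<le> start S j" using jobs(2)[OF assms] s_real_pos by simp
  ultimately show ?thesis
    using k jobs(1)[OF assms] unfolding reclaimed_def by (cases "snd (chc \<pi> j) = 0") auto
qed

lemma points_legal_path:
  assumes k: "k < 2"
  shows "legal_path I S k"
proof -
  let ?N = "4 * n + 3" and ?f = "point_time \<pi> k" and ?g = "point_pos \<pi> k"
  note sl = point_slopes[OF k] and pe = point_ends[OF k]
  have C: "makespan S k = ?f ?N" using ends[OF k] pe by simp
  have pos: "0 \<le> makespan S k" using ends[OF k] s_real_pos by simp
  have le: "?f 0 \<le> ?f 1" using sl by (simp add: slopes_def)
  have "path S k 0 = real k * real L"
    using path_piece[OF k, of 0 0] le pe by simp
  moreover have "\<forall>t\<ge>makespan S k. path S k t = real k * real L"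
    using polyline_after[OF sl] pe paths[OF k] C by simp
  moreover have "\<forall>t\<in>{0..makespan S k}. path S k t \<in> {0..real L}"
    using polyline_range[OF sl, of _ 0 "real L"] pe(1) C paths[OF k] point_pos_range[OF k] by simp
  moreover have "continuous_on {0..makespan S k} (path S k)"
    using polyline_continuous[OF sl] pe(1) C paths[OF k] by simp
  moreover have "\<forall>i<?N. ?f i \<le> ?f (Suc i) \<and> legal_piece I S k (?f i) (?f (Suc i))"
  proof (intro allI impI conjI)
    fix i assume i: "i < ?N"
    show fi: "?f i \<le> ?f (Suc i)" using sl i by (simp add: slopes_def)
    have lin: "\<forall>t\<in>{?f i..?f (Suc i)}. path S k t = path S k (?f i) + slope \<pi> k i * (t - ?f i)"
    proof
      fix t assume "t \<in> {?f i..?f (Suc i)}"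
      then show "path S k t = path S k (?f i) + slope \<pi> k i * (t - ?f i)"
        using path_piece[OF k i, of t] path_piece[OF k i, of "?f i"] fi by simp
    qed
    let ?j = "i div 4"
    have r: "i mod 4 = 0 \<or> i mod 4 = 1 \<or> i mod 4 = 2 \<or> i mod 4 = 3" by linarith
    show "legal_piece I S k (?f i) (?f (Suc i))"
    proof (cases "i mod 4 = 3 \<and> fst (chc \<pi> ?j) = k")
      case True
      then have j: "?j < n" and ij: "i = 4 * ?j + 3" using i by presburger+
      have "{?f i..?f (Suc i)} \<subseteq> {start S ?j..finish I S ?j}"
        using job_piece(1,2)[OF j, of k] True unfolding ij[symmetric] by simp
      moreover have "slope \<pi> k i \<in> {1, -1}" using True by (simp add: slope_def Let_def)
      ultimately show ?thesis
        unfolding legal_piece_def using lin j jobs(1)[OF j] True by blast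
    next
      case False
      then have "slope \<pi> k i \<in> {0, speed I, - speed I}"
        using r unfolding slope_def Let_def speed_eq by auto
      then show ?thesis unfolding legal_piece_def using lin by blast
    qed
  qed
  ultimately show ?thesis using pos pe(1) C unfolding legal_path_def
    by (intro conjI exI[of _ ?N] exI[of _ ?f]) simp_all
qed

lemma points_feasible: "feasible I S"
proof -
  have "path S 0 t \<le> path S 1 t" if "0 \<le> t" for t
  proof (cases "t \<le> real (makesp \<pi>) / real s")
    case True
    have r: "\<forall>k<2. path S k t \<in> {0..real L}"
      using points_legal_path True that ends unfolding legal_path_def by auto
    have "rhome 0 (path S 0 t) + rhome 1 (path S 1 t) \<le> real L"
      using home_near[of 0 t] home_near[of 1 t] True that paths r
      by (intro near_sum[of "real s * t"]) (auto simp: rhome_def)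
    then show ?thesis by (simp add: rhome_def)
  next
    case False
    have "path S k t = real k * real L" if "k < 2" for k
      using points_legal_path[OF that] ends[OF that] False unfolding legal_path_def by simp
    then show ?thesis by simp
  qed
  moreover have "finish I S j \<le> start S (Suc j)" if "Suc j < n" for j
  proof -
    have "finish I S j = real (clock \<pi> (Suc j)) / real s"
      using jobs(2)[of j] work_dur[of j] that s_real_pos
      by (simp add: finish_def sim_Suc(1) add_divide_distrib)
    then show ?thesis
      using jobs(2)[OF that] clock_le_begin[of \<pi> "Suc j"] s_real_pos
      by (simp add: divide_right_mono)
  qed
  ultimately show ?thesis
    using points_legal_path points_reclaimed by (simp add: feasible_def)
qed

lemma points_objective: "objective S = real (makesp \<pi>) / real s"
  using ends[of 0] ends[of 1] by (simp add: objective_def)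

end

end

lemma greedy_optimal:
  assumes "\<And>k. k < 2 \<Longrightarrow> path S k
      = polyline (poly_points (Suc (4 * n + 3)) (point_time greedy k) (point_pos greedy k))"
    and "\<And>k. k < 2 \<Longrightarrow> makespan S k = real (makesp greedy) / real s"
    and "\<And>j. j < n \<Longrightarrow> worker S j = fst (chc greedy j)"
    and "\<And>j. j < n \<Longrightarrow> start S j = real (begin_at greedy j) / real s"
  shows "optimal I S"
proof -
  have "objective S \<le> objective S'" if "feasible I S'" for S'
    using objective_lower[OF that] s_pos points_objective[OF greedy_admissible assms]
    unfolding makesp_greedy by (simp add: divide_le_eq mult.commute)
  then show ?thesis
    using points_feasible[OF greedy_admissible assms] by (simp add: optimal_def)
qed

end

section \<open>Running programs on the word RAM\<close>

fun loop_free :: "com \<Rightarrow> bool" where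
  "loop_free (Seq P Q) = (loop_free P \<and> loop_free Q)"
| "loop_free (If b P Q) = (loop_free P \<and> loop_free Q)"
| "loop_free (While b P) = False"
| "loop_free _ = True"

text \<open>Meant for loop-free programs; the \<open>While\<close> clauses here and in
  \<open>time_bound\<close> and \<open>growth\<close> are dummies.\<close>

fun sem :: "com \<Rightarrow> state \<Rightarrow> state" where
  "sem Skip st = st"
| "sem (Set x e) st = st\<lparr>regs := (regs st)(x := eval st e)\<rparr>"
| "sem (Store a e) st = st\<lparr>mem := (mem st)(eval st a := eval st e)\<rparr>"
| "sem (Seq P Q) st = sem Q (sem P st)"
| "sem (If b P Q) st = (if eval st b \<noteq> 0 then sem P st else sem Q st)"
| "sem (While b P) st = st"

fun time_bound :: "com \<Rightarrow> nat" where
  "time_bound Skip = 1"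
| "time_bound (Set x e) = 1 + cost e"
| "time_bound (Store a e) = 1 + cost a + cost e"
| "time_bound (Seq P Q) = time_bound P + time_bound Q"
| "time_bound (If b P Q) = 1 + cost b + max (time_bound P) (time_bound Q)"
| "time_bound (While b P) = 0"

text \<open>Static estimates of the size of numbers: with all registers and memory cells at most \<open>K \<ge> 2\<close>,
  an expression \<open>e\<close> evaluates to at most \<open>K ^ exponent e\<close>. Hence the word bound only has to be checked
  semantically at the heads of loops.\<close>

fun exponent :: "exp \<Rightarrow> nat" where
  "exponent (Num k) = k + 1"
| "exponent (Reg x) = 1"
| "exponent (Mem e) = 1 + exponent e"
| "exponent (Add e f) = exponent e + exponent f"
| "exponent (Sub e f) = exponent e + exponent f"
| "exponent (Mul e f) = exponent e + exponent f"

fun growth :: "com \<Rightarrow> nat" where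
  "growth Skip = 1"
| "growth (Set x e) = exponent e"
| "growth (Store a e) = exponent a + exponent e"
| "growth (Seq P Q) = growth P * growth Q"
| "growth (If b P Q) = exponent b * growth P * growth Q"
| "growth (While b P) = 1"

definition bounded :: "nat \<Rightarrow> state \<Rightarrow> bool" where
  "bounded K st \<longleftrightarrow> (\<forall>x. regs st x \<le> K) \<and> (\<forall>a. mem st a \<le> K)"

lemma exponent_pos: "1 \<le> exponent e"
  by (induction e) auto

lemma growth_pos: "1 \<le> growth P"
  by (induction P) (use exponent_pos in \<open>auto intro: le_trans[OF _ trans_le_add1] simp: Suc_le_eq\<close>)

lemma eval_le:
  assumes "2 \<le> K" "bounded K st"
  shows "eval st e \<le> K ^ exponent e"
proof -
  have two: "2 \<le> K ^ exponent e" for e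
    using assms(1) power_increasing[OF exponent_pos, of K e] by simp
  have sum: "a + b \<le> K ^ (exponent e + exponent f)"
    if "a \<le> K ^ exponent e" "b \<le> K ^ exponent f" for a b e f
  proof -
    have "x + y \<le> x * y" if "2 \<le> x" "2 \<le> y" for x y :: nat
      using that by (metis add.commute add_le_mono le_trans mult_2 mult_le_mono nat_le_linear
          mult.commute mult_le_mono1 add_mono)
    then show ?thesis using that two[of e] two[of f] unfolding power_add by (meson add_mono le_trans)
  qed
  show ?thesis
  proof (induction e)
    case (Num k)
    have "k < 2 ^ k" by (rule less_exp)
    also have "(2::nat) ^ k \<le> K ^ k" using assms(1) by (rule power_mono) simp
    also have "K ^ k \<le> K ^ (k + 1)" using assms(1) by (intro power_increasing) auto
    finally show ?case by simp
  next
    case (Reg x)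
    then show ?case using assms(2) by (simp add: bounded_def)
  next
    case (Mem e)
    have "mem st (eval st e) \<le> K ^ 1" using assms(2) by (simp add: bounded_def)
    also have "\<dots> \<le> K ^ exponent (Mem e)" using assms(1) by (intro power_increasing) auto
    finally show ?case by simp
  next
    case (Add e f)
    then show ?case using sum by simp
  next
    case (Sub e f)
    then have "eval st e - eval st f \<le> K ^ (exponent e + exponent f)"
      using sum by (meson diff_le_self le_add1 le_trans)
    then show ?case by simp
  next
    case (Mul e f)
    then show ?case by (simp add: power_add mult_mono)
  qed
qed

text \<open>This is why \<open>Mem\<close> and \<open>Sub\<close> charge for their arguments
  although their own values would need less: \<open>fits\<close> tests every subexpression.\<close>

lemma exponent_subexp: "f \<in> subexps e \<Longrightarrow> exponent f \<le> exponent e"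
  by (induction e) auto

lemma fits_power:
  assumes "2 \<le> M" "bounded (M ^ a) st" "1 \<le> a" "a * exponent e < d"
  shows "fits (M ^ d) st e"
  unfolding fits_def
proof
  fix f assume f: "f \<in> subexps e"
  have "2 \<le> M ^ a" using assms(1,3) power_increasing[of 1 a M] by simp
  then have "eval st f \<le> (M ^ a) ^ exponent f" using eval_le assms(2) by blast
  also have "\<dots> = M ^ (a * exponent f)" by (simp add: power_mult)
  also have "\<dots> < M ^ d"
  proof (rule power_strict_increasing)
    show "a * exponent f < d" using exponent_subexp[OF f] assms(4) by (meson le_less_trans mult_le_mono2)
  qed (use assms(1) in simp)
  finally show "eval st f < M ^ d" .
qed

lemma bounded_mono: "bounded K st \<Longrightarrow> K \<le> K' \<Longrightarrow> bounded K' st"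
  by (auto simp: bounded_def intro: le_trans)

text \<open>Growth multiplies along a sequence because the bound after the first program is the base
  for the second. For a branch, the product of factors that are all at least 1 dominates both
  outcomes.\<close>

lemma bounded_sem:
  assumes "2 \<le> K" "bounded K st"
  shows "bounded (K ^ growth P) (sem P st)"
  using assms
proof (induction P arbitrary: K st)
  case Skip
  then show ?case by simp
next
  case (Set x e)
  have "K ^ 1 \<le> K ^ exponent e" using Set.prems(1) exponent_pos by (intro power_increasing) auto
  then show ?case
    using Set.prems eval_le[OF Set.prems, of e] by (auto simp: bounded_def intro: le_trans)
next
  case (Store a e)
  have "K ^ 1 \<le> K ^ (exponent a + exponent e)" "K ^ exponent e \<le> K ^ (exponent a + exponent e)"
    using Store.prems(1) exponent_pos[of a] by (intro power_increasing; simp)+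
  then show ?case
    using Store.prems eval_le[OF Store.prems, of e] by (auto simp: bounded_def intro: le_trans)
next
  case (Seq P Q)
  have "2 \<le> K ^ growth P"
    using Seq.prems(1) power_increasing[OF growth_pos, of K P] by simp
  then show ?case using Seq by (simp add: power_mult)
next
  case (If b P Q)
  have e: "1 \<le> exponent b" "1 \<le> growth P" "1 \<le> growth Q"
    using exponent_pos growth_pos by auto
  then have "growth P \<le> exponent b * growth P * growth Q" "growth Q \<le> exponent b * growth P * growth Q"
    by (simp_all add: Suc_le_eq)
  then have "K ^ growth P \<le> K ^ growth (If b P Q)" "K ^ growth Q \<le> K ^ growth (If b P Q)"
    using If.prems(1) power_increasing by simp_all
  then have "bounded (K ^ growth (If b P Q)) (sem P st)" "bounded (K ^ growth (If b P Q)) (sem Q st)"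
    using If.IH[OF If.prems] bounded_mono by blast+
  then show ?case by (simp del: growth.simps)
next
  case (While b P)
  then show ?case by simp
qed

fun writes :: "com \<Rightarrow> nat set" where
  "writes (Set x e) = {x}"
| "writes (Seq P Q) = writes P \<union> writes Q"
| "writes (If b P Q) = writes P \<union> writes Q"
| "writes _ = {}"

fun no_store :: "com \<Rightarrow> bool" where
  "no_store (Store a e) = False"
| "no_store (Seq P Q) = (no_store P \<and> no_store Q)"
| "no_store (If b P Q) = (no_store P \<and> no_store Q)"
| "no_store _ = True"

lemma regs_sem: "x \<notin> writes P \<Longrightarrow> regs (sem P st) x = regs st x"
  by (induction P arbitrary: st) auto

lemma mem_sem: "no_store P \<Longrightarrow> mem (sem P st) = mem st"
  by (induction P arbitrary: st) auto

definition runs :: "nat \<Rightarrow> com \<Rightarrow> state \<Rightarrow> nat \<Rightarrow> (state \<Rightarrow> bool) \<Rightarrow> bool" where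
  "runs W P st B Q \<longleftrightarrow> (\<exists>T st'. exec W P st T st' \<and> T \<le> B \<and> Q st')"

text \<open>The word bound becomes one static inequality between the program text and d, so d can be
  chosen independently of the instance.\<close>

lemma runs_loop_free:
  assumes "loop_free P" "2 \<le> M" "bounded (M ^ a) st" "1 \<le> a" "a * growth P < d" "Q (sem P st)"
  shows "runs (M ^ d) P st (time_bound P) Q"
proof -
  have "\<exists>T\<le>time_bound P. exec (M ^ d) P st T (sem P st)"
    using assms(1,3-5)
  proof (induction P arbitrary: a st)
    case Skip
    show ?case using exec.Skip by auto
  next
    case (Set x e)
    then show ?case using exec.Set[OF fits_power[OF assms(2)]] by fastforce
  next
    case (Store b e)
    then have "a * exponent b < d" "a * exponent e < d" by (auto simp: distrib_left)
    then show ?case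
      using Store.prems exec.Store[OF fits_power[OF assms(2)] fits_power[OF assms(2)]] by fastforce
  next
    case (Seq P Q)
    have "a * growth P \<le> a * growth (Seq P Q)" using growth_pos[of Q] by simp
    then have "a * growth P < d" using Seq.prems(4) by (rule le_less_trans)
    then obtain T1 where T1: "T1 \<le> time_bound P" "exec (M ^ d) P st T1 (sem P st)"
      using Seq.IH(1)[of a st] Seq.prems by auto
    have K: "2 \<le> M ^ a" using assms(2) Seq.prems(3) power_increasing[of 1 a M] by simp
    have "bounded (M ^ (a * growth P)) (sem P st)"
      using bounded_sem[OF K Seq.prems(2)] by (simp add: power_mult)
    moreover have "1 \<le> a * growth P" using Seq.prems(3) growth_pos[of P] by (simp add: Suc_le_eq)
    ultimately obtain T2 where T2: "T2 \<le> time_bound Q" "exec (M ^ d) Q (sem P st) T2 (sem Q (sem P st))"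
      using Seq.IH(2)[of "a * growth P" "sem P st"] Seq.prems by (force simp: mult.assoc)
    show ?case using exec.Seq[OF T1(2) T2(2)] T1(1) T2(1) by (auto intro: add_mono)
  next
    case (If b P Q)
    have e: "0 < exponent b" "0 < growth P" "0 < growth Q"
      using exponent_pos growth_pos by (auto simp: Suc_le_eq[symmetric])
    then have "exponent b \<le> growth (If b P Q)" "growth P \<le> growth (If b P Q)" "growth Q \<le> growth (If b P Q)"
      by simp_all
    then have l: "a * exponent b < d" "a * growth P < d" "a * growth Q < d"
      using If.prems(4) by (meson le_less_trans mult_le_mono2)+
    note f = fits_power[OF assms(2) If.prems(2,3) l(1)]
    show ?case
    proof (cases "eval st b \<noteq> 0")
      case True
      obtain T where T: "T \<le> time_bound P" "exec (M ^ d) P st T (sem P st)"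
        using If.IH(1)[of a st] If.prems l by auto
      then show ?thesis using exec.IfTrue[OF f True T(2), of Q] True
        by (intro exI[of _ "1 + cost b + T"]) auto
    next
      case False
      obtain T where T: "T \<le> time_bound Q" "exec (M ^ d) Q st T (sem Q st)"
        using If.IH(2)[of a st] If.prems l by auto
      then show ?thesis using exec.IfFalse[OF f _ T(2), of P] False
        by (intro exI[of _ "1 + cost b + T"]) auto
    qed
  next
    case (While b P)
    then show ?case by simp
  qed
  then show ?thesis using assms(6) by (auto simp: runs_def)
qed

lemma runs_Seq:
  assumes "runs W P st B R" "\<And>st'. R st' \<Longrightarrow> runs W P' st' B' Q"
  shows "runs W (Seq P P') st (B + B') Q"
  using assms unfolding runs_def by (meson add_mono exec.Seq)

definition set_reg :: "nat \<Rightarrow> nat \<Rightarrow> state \<Rightarrow> state" where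
  "set_reg x v st = st\<lparr>regs := (regs st)(x := v)\<rparr>"

lemma set_reg_simps [simp]:
  "regs (set_reg x v st) = (regs st)(x := v)" "mem (set_reg x v st) = mem st"
  by (simp_all add: set_reg_def)

text \<open>The loop variable is assumed to be 0 initially and is reset to 0 at the end.\<close>

definition For :: "nat \<Rightarrow> nat \<Rightarrow> com \<Rightarrow> com" where
  "For x m P = Seq (While (Sub (Reg m) (Reg x)) (Seq P (Set x (Add (Reg x) (Num 1)))))
     (Set x (Num 0))"

text \<open>A round costs 4 for the test, B for the body and 4 for the increment; the failing test
  and the reset cost 4 + 2. The invariant is demanded after the increment, so it may fix the counter
  itself.\<close>

lemma runs_For:
  assumes body: "\<And>i st. i < N \<Longrightarrow> Inv i st \<Longrightarrow>
      runs W P st B (\<lambda>st'. regs st' x = i \<and> Inv (Suc i) (set_reg x (Suc i) st'))"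
    and head: "\<And>i st. Inv i st \<Longrightarrow> regs st x = i \<and> regs st m = N"
    and W: "N + 2 \<le> W" and init: "Inv 0 st"
    and final: "\<And>st. Inv N st \<Longrightarrow> Q (set_reg x 0 st)"
  shows "runs W (For x m P) st (N * (B + 8) + 6) Q"
proof -
  let ?b = "Sub (Reg m) (Reg x)" and ?inc = "Set x (Add (Reg x) (Num 1))"
  have "runs W (While ?b (Seq P ?inc)) st ((N - i) * (B + 8) + 4) (Inv N)"
    if "i \<le> N" "Inv i st" for i st
    using that
  proof (induction "N - i" arbitrary: i st)
    case 0
    then have "i = N" "eval st ?b = 0" "fits W st ?b"
      using head[of i st] W by (auto simp: fits_def)
    then show ?case using 0 exec.WhileFalse[of W st ?b] unfolding runs_def by fastforce
  next
    case (Suc l)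
    have i: "i < N" using Suc.hyps(2) by simp
    have b: "eval st ?b \<noteq> 0" "fits W st ?b"
      using head[OF Suc.prems(2)] i W by (auto simp: fits_def)
    obtain T st1 where 1: "exec W P st T st1" "T \<le> B" "regs st1 x = i"
      "Inv (Suc i) (set_reg x (Suc i) st1)"
      using body[OF i Suc.prems(2)] unfolding runs_def by blast
    have "fits W st1 (Add (Reg x) (Num 1))" using 1(3) i W by (auto simp: fits_def)
    then have 2: "exec W ?inc st1 4 (set_reg x (Suc i) st1)"
      using exec.Set[of W st1 "Add (Reg x) (Num 1)" x] 1(3)
      by (simp add: set_reg_def numeral_eq_Suc)
    obtain T' st2 where 3: "exec W (While ?b (Seq P ?inc)) (set_reg x (Suc i) st1) T' st2"
      "T' \<le> (N - Suc i) * (B + 8) + 4" "Inv N st2"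
      using Suc.hyps(1)[of "Suc i"] Suc.hyps(2) 1(4) i unfolding runs_def by force
    have "exec W (While ?b (Seq P ?inc)) st (1 + cost ?b + (T + 4) + T') st2"
      by (rule exec.WhileTrue[OF b(2,1) exec.Seq[OF 1(1) 2] 3(1)])
    moreover have "N - i = Suc (N - Suc i)" using i by simp
    then have "1 + cost ?b + (T + 4) + T' \<le> (N - i) * (B + 8) + 4"
      using 1(2) 3(2) by simp
    ultimately show ?case using 3(3) unfolding runs_def by blast
  qed
  from this[OF _ init] have "runs W (While ?b (Seq P ?inc)) st (N * (B + 8) + 4) (Inv N)" by simp
  then have "runs W (For x m P) st ((N * (B + 8) + 4) + 2) Q"
    unfolding For_def
  proof (rule runs_Seq)
    fix st' assume "Inv N st'"
    moreover have "fits W st' (Num 0)" using W by (simp add: fits_def)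
    ultimately show "runs W (Set x (Num 0)) st' 2 Q"
      using exec.Set[of W st' "Num 0" x] final[of st']
      by (auto simp: runs_def set_reg_def numeral_2_eq_2)
  qed
  then show ?thesis by (simp add: add.commute add.left_commute)
qed

text \<open>Zeroing temporaries lets the loop invariants be equations for all registers at once
  (\<open>loop_regs\<close>, \<open>pass_regs\<close>).\<close>

definition clear :: "nat list \<Rightarrow> com" where
  "clear xs = foldr (\<lambda>x. Seq (Set x (Num 0))) xs Skip"

lemma loop_free_clear: "loop_free (clear xs)"
  by (induction xs) (simp_all add: clear_def)

lemma sem_clear:
  "mem (sem (clear xs) st) = mem st"
  "regs (sem (clear xs) st) x = (if x \<in> set xs then 0 else regs st x)"
  by (induction xs arbitrary: st) (auto simp: clear_def)

section \<open>The program\<close>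

text \<open>
  Register 0 holds the output address \<open>3 n + 3\<close>, 1 to 3 hold \<open>n\<close>, \<open>L\<close>, \<open>s\<close>, 4 the address of the table,
  5 to 7 its dimensions, 8 the number of remaining jobs, \<open>9 + k\<close> the distance of reclaimer \<open>k\<close> from
  its home, and 11 the number \<open>L + \<delta>\<^sub>0 - \<delta>\<^sub>1\<close>, where \<open>\<delta>\<^sub>k \<le> L\<close> is the time since \<open>k\<close> finished its last
  job, one of them being 0. Registers 13 to 28 are temporary; 22 to 27 describe the best choice.
  In the final pass, 12 is the current job, 30 the clock, \<open>31 + k\<close> the time at which \<open>k\<close> finished its
  last job, and \<open>33 + k\<close> and 37 are the output positions for the path of \<open>k\<close> and for the jobs.
\<close>

definition addr_exp :: "exp \<Rightarrow> exp \<Rightarrow> exp \<Rightarrow> exp \<Rightarrow> exp" where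
  "addr_exp i a b y =
    Add (Reg 4) (Add (Mul (Add (Mul (Add (Mul i (Reg 6)) a) (Reg 6)) b) (Reg 7)) y)"

definition lag_exp :: "nat \<Rightarrow> exp" where
  "lag_exp k = (if k = 0 then Sub (Reg 11) (Reg 2) else Sub (Reg 2) (Reg 11))"

definition home_exp :: "nat \<Rightarrow> exp \<Rightarrow> exp" where
  "home_exp k e = (if k = 0 then e else Sub (Reg 2) e)"

definition max_exp :: "exp \<Rightarrow> exp \<Rightarrow> exp" where
  "max_exp e f = Add e (Sub f e)"

fun seqs :: "com list \<Rightarrow> com" where
  "seqs [] = Skip"
| "seqs [P] = P"
| "seqs (P # Q # Ps) = Seq P (seqs (Q # Ps))"

text \<open>The input is n, L, s and then three words per pile (pad, left, right), so pile j has its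
  ends at 4 + 3j and 5 + 3j; here j is n minus the number of remaining jobs.\<close>

definition load_job :: com where
  "load_job = seqs
    [Set 13 (Mem (Add (Num 4) (Mul (Num 3) (Sub (Reg 1) (Reg 8))))),
     Set 14 (Mem (Add (Num 5) (Mul (Num 3) (Sub (Reg 1) (Reg 8))))),
     Set 28 (Mul (Reg 3) (Sub (Reg 14) (Reg 13)))]"

text \<open>Register \<open>10 - k\<close> holds the distance of the other reclaimer. In the second
  assignment to register 20, L + min L t is computed as L + t - (t - L). The final lookup is in the
  layer with one job fewer.\<close>

definition test_choice :: "nat \<Rightarrow> nat \<Rightarrow> com" where
  "test_choice k d = seqs
    [Set 15 (home_exp k (Reg (if d = 0 then 13 else 14))),
     Set 16 (home_exp k (Reg (if d = 0 then 14 else 13))),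
     Set 17 (Sub (Add (Sub (Reg 15) (Reg (9 + k))) (Sub (Reg (9 + k)) (Reg 15))) (lag_exp k)),
     Set 18 (Sub (Sub (Add (Reg 15) (Reg (10 - k))) (Reg 2)) (lag_exp (1 - k))),
     Set 19 (max_exp (Reg 17) (Reg 18)),
     Set 20 (Add (Add (lag_exp (1 - k)) (Reg 19)) (Reg 28)),
     Set 20 (if k = 0 then Sub (Reg 2) (Reg 20)
             else Sub (Add (Reg 2) (Reg 20)) (Sub (Reg 20) (Reg 2))),
     Set 21 (Add (Add (Reg 19) (Reg 28)) (Mem (addr_exp (Sub (Reg 8) (Num 1))
        (if k = 0 then Reg 16 else Reg 9) (if k = 0 then Reg 10 else Reg 16) (Reg 20))))]"

definition keep :: "nat \<Rightarrow> nat \<Rightarrow> com" where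
  "keep k d = seqs
    [Set 22 (Reg 21), Set 23 (Num k), Set 24 (Reg 15), Set 25 (Reg 16), Set 26 (Reg 19),
     Set 27 (Reg 20)]"

definition keep_better :: "nat \<Rightarrow> nat \<Rightarrow> com" where
  "keep_better k d = If (Sub (Reg 22) (Reg 21)) (keep k d) Skip"

definition choose_best :: com where
  "choose_best = seqs
    [load_job, test_choice 0 0, keep 0 0, test_choice 0 1, keep_better 0 1,
     test_choice 1 0, keep_better 1 0, test_choice 1 1, keep_better 1 1]"

definition final_cost :: exp where
  "final_cost = max_exp (Sub (Reg 9) (lag_exp 0)) (Sub (Reg 10) (lag_exp 1))"

definition fill_cell :: com where
  "fill_cell = seqs
    [If (Reg 8) choose_best (Set 22 final_cost),
     Store (addr_exp (Reg 8) (Reg 9) (Reg 10) (Reg 11)) (Reg 22),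
     clear [13..<29]]"

definition fill_table :: com where
  "fill_table = For 8 5 (For 9 6 (For 10 6 (For 11 7 fill_cell)))"

text \<open>The input fills 3n + 3 words. The output has one word for the denominator, 2n for the
  jobs and, for each reclaimer, a counter and 4n + 4 breakpoints of two words: 18n + 19 in all. So
  the table starts at 21n + 22.\<close>

definition set_up :: com where
  "set_up = seqs
    [Set 1 (Mem (Num 0)), Set 2 (Mem (Num 1)), Set 3 (Mem (Num 2)),
     Set 0 (Add (Mul (Num 3) (Reg 1)) (Num 3)),
     Set 4 (Add (Mul (Num 21) (Reg 1)) (Num 22)),
     Set 5 (Add (Reg 1) (Num 1)), Set 6 (Add (Reg 2) (Num 1)),
     Set 7 (Add (Mul (Num 2) (Reg 2)) (Num 1))]"

definition set_up_output :: com where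
  "set_up_output = seqs
    [Set 11 (Reg 2),
     Store (Reg 0) (Mul (Num 2) (Reg 3)),
     Store (Add (Reg 0) (Add (Mul (Num 2) (Reg 1)) (Num 1))) (Add (Mul (Num 4) (Reg 1)) (Num 4)),
     Store (Add (Reg 0) (Add (Mul (Num 10) (Reg 1)) (Num 10))) (Add (Mul (Num 4) (Reg 1)) (Num 4)),
     Set 33 (Add (Reg 0) (Add (Mul (Num 2) (Reg 1)) (Num 2))),
     Set 34 (Add (Reg 0) (Add (Mul (Num 10) (Reg 1)) (Num 11))),
     Set 37 (Add (Reg 0) (Num 1))]"

text \<open>Converts a doubled distance from home into a position times 2s. Doubled scaled times are
  already multiples of 1/(2s) and are stored unchanged.\<close>

definition flip_exp :: "nat \<Rightarrow> exp \<Rightarrow> exp" where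
  "flip_exp k e = Mul (Reg 3) (if k = 0 then e else Sub (Mul (Num 2) (Reg 2)) e)"

text \<open>Every job yields four breakpoints for each reclaimer; those of the idle one coincide.\<close>

definition leg :: "nat \<Rightarrow> nat \<Rightarrow> nat \<Rightarrow> com" where
  "leg k x z =
    (let P = Reg (33 + k); u = Mul (Num 2) (Reg (9 + k)); b = Mul (Num 2) (Reg z);
         f = Mul (Num 2) (Reg (31 + k)); g = Mul (Num 2) (Reg x); H = Reg 35
     in seqs
      [Set 35 (Sub (Add (Reg (9 + k)) (Reg z)) (Sub (Reg x) (Reg (31 + k)))),
       Store P f, Store (Add P (Num 1)) (flip_exp k u),
       Store (Add P (Num 2)) (Add f (Sub u H)), Store (Add P (Num 3)) (flip_exp k H),
       Store (Add P (Num 4)) (Sub g (Sub b H)), Store (Add P (Num 5)) (flip_exp k H),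
       Store (Add P (Num 6)) g, Store (Add P (Num 7)) (flip_exp k b),
       Set (33 + k) (Add P (Num 8))])"

text \<open>Registers \<open>32 - k\<close> and \<open>10 - k\<close> are the idle reclaimer's own
  finishing time and distance, so its leg collapses to a point.\<close>

definition advance :: "nat \<Rightarrow> com" where
  "advance k = seqs
    [leg k 36 24, leg (1 - k) (32 - k) (10 - k),
     Set (31 + k) (Add (Reg 36) (Reg 28)), Set (9 + k) (Reg 25)]"

text \<open>The table stores costs only; the choice is recomputed here, at constant cost per
  job.\<close>

definition do_job :: com where
  "do_job = seqs
    [Set 8 (Sub (Reg 1) (Reg 12)),
     choose_best,
     Set 36 (Add (Reg 30) (Reg 26)),
     Store (Reg 37) (Reg 23),
     Store (Add (Reg 37) (Num 1)) (Mul (Num 2) (Reg 36)),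
     If (Reg 23) (advance 1) (advance 0),
     Set 30 (Add (Reg 36) (Reg 28)),
     Set 11 (Reg 27),
     Set 37 (Add (Reg 37) (Num 2)),
     clear (8 # 35 # 36 # [13..<29])]"

text \<open>Register 24 is 0 at this point, so it supplies home as the target of both last
  legs.\<close>

definition finish_up :: com where
  "finish_up = seqs
    [Set 36 (Add (Reg 30) final_cost), leg 0 36 24, leg 1 36 24]"

definition prog :: com where
  "prog = Seq set_up (Seq fill_table (Seq set_up_output (Seq (For 12 1 do_job) finish_up)))"

section \<open>Correctness of one choice, and the size of table entries\<close>

lemma pick_cong:
  assumes "\<And>k d. k < 2 \<Longrightarrow> d < 2 \<Longrightarrow> f (k, d) = g (k, d)"
  shows "pick f = pick g"
  unfolding pick_def Let_def using assms by simp

definition pos :: "nat \<Rightarrow> nat \<Rightarrow> nat \<Rightarrow> nat" where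
  "pos a b k = (if k = 0 then a else b)"

lemma pos_simps [simp]: "pos a b 0 = a" "pos a b (Suc 0) = b" "pos a b 1 = b"
  by (simp_all add: pos_def)

context scheduling
begin

lemma gap_cong:
  assumes "u 0 = u' 0" "u 1 = u' 1" "fst c < 2"
  shows "gap j u y c = gap j u' y c"
  using assms by (auto simp: gap_def Let_def less_2_cases_iff)

text \<open>Table entries belong to functions of the form \<open>pos a b\<close>, while an updated
  \<open>u\<close> agrees with such a function only at 0 and 1.\<close>

lemma togo_cong:
  assumes "u 0 = u' 0" "u 1 = u' 1"
  shows "togo i u y = togo i u' y"
  using assms
proof (induction i arbitrary: u u' y)
  case (Suc i)
  have "option_cost i u y c = option_cost i u' y c" if c: "fst c < 2" for c
  proof -
    have "next_y (n - Suc i) u y c = next_y (n - Suc i) u' y c"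
      using gap_cong[OF Suc.prems c] by (simp add: next_y_def)
    moreover have "togo i (u(fst c := x)) z = togo i (u'(fst c := x)) z" for x z
      by (rule Suc.IH) (use Suc.prems in simp_all)
    ultimately show ?thesis
      using gap_cong[OF Suc.prems c] by (simp add: option_cost_def Let_def del: fun_upd_apply)
  qed
  moreover from this have "pick (option_cost i u y) = pick (option_cost i u' y)"
    by (intro pick_cong) simp
  ultimately show ?case using pick_range(1) by (simp add: togo_Suc)
qed simp

text \<open>Always taking choice (0, 0) costs at most L + sL per job, and the ride home at most L;
  needed for the word bound.\<close>

lemma togo_le:
  assumes "i \<le> n" "u 0 \<le> L" "u 1 \<le> L"
  shows "togo i u y \<le> (i + 1) * (2 * s * L)"
  using assms
proof (induction i arbitrary: u y)
  case 0
  have "L \<le> 2 * s * L" using s_pos by simp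
  then show ?case using 0 by (auto simp: max_def intro!: le_trans[OF diff_le_self] elim: le_trans)
next
  case (Suc i)
  let ?j = "n - Suc i" and ?c = "(0, 0) :: nat \<times> nat"
  have j: "?j < n" using Suc.prems by simp
  have "togo (Suc i) u y \<le> option_cost i u y ?c"
    unfolding togo_Suc by (rule pick_le) simp_all
  also have "\<dots> \<le> L + s * L + (i + 1) * (2 * s * L)"
  proof -
    have "gap ?j u y ?c \<le> L" using gap_le_L[OF j, of u ?c] Suc.prems by simp
    moreover have "work ?j \<le> s * L"
      unfolding work_def using pile_bounds(2)[OF j] by (intro mult_le_mono2) simp
    moreover have "togo i (u(fst ?c := to_pos ?j ?c)) (next_y ?j u y ?c) \<le> (i + 1) * (2 * s * L)"
      using Suc.prems from_to_le(2)[OF j] by (intro Suc.IH) auto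
    ultimately show ?thesis unfolding option_cost_def Let_def by linarith
  qed
  also have "\<dots> \<le> (Suc i + 1) * (2 * s * L)"
  proof -
    have "L \<le> s * L" using s_pos by simp
    then show ?thesis by simp
  qed
  finally show ?case .
qed

definition idx :: "nat \<Rightarrow> nat \<Rightarrow> nat \<Rightarrow> nat \<Rightarrow> nat" where
  "idx i a b y = ((i * (L + 1) + a) * (L + 1) + b) * (2 * L + 1) + y"

abbreviation "table_base \<equiv> 21 * n + 22"

definition input_ok :: "state \<Rightarrow> bool" where
  "input_ok st \<longleftrightarrow> (\<forall>j<n. mem st (4 + 3 * j) = lft I j \<and> mem st (5 + 3 * j) = rgt I j)"

definition layer_ok :: "nat \<Rightarrow> state \<Rightarrow> bool" where
  "layer_ok i st \<longleftrightarrow> (\<forall>a\<le>L. \<forall>b\<le>L. \<forall>y\<le>2*L.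
     mem st (table_base + idx i a b y) = togo i (pos a b) y)"

lemma layer_okD:
  "layer_ok i st \<Longrightarrow> a \<le> L \<Longrightarrow> b \<le> L \<Longrightarrow> y \<le> 2 * L \<Longrightarrow>
    mem st (table_base + idx i a b y) = togo i (pos a b) y"
  by (simp add: layer_ok_def)

definition globals_ok :: "state \<Rightarrow> bool" where
  "globals_ok st \<longleftrightarrow> regs st 0 = 3 * n + 3 \<and> regs st 1 = n \<and> regs st 2 = L \<and> regs st 3 = s \<and>
     regs st 4 = table_base \<and> regs st 5 = n + 1 \<and> regs st 6 = L + 1 \<and> regs st 7 = 2 * L + 1"

lemma eval_addr:
  assumes "globals_ok st"
  shows "eval st (addr_exp e f g h) = table_base + idx (eval st e) (eval st f) (eval st g) (eval st h)"
  using assms by (simp add: addr_exp_def idx_def globals_ok_def)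

lemma eval_max [simp]: "eval st (max_exp e f) = max (eval st e) (eval st f)"
  by (simp add: max_exp_def max_def)

definition chosen :: "nat \<Rightarrow> (nat \<Rightarrow> nat) \<Rightarrow> nat \<Rightarrow> nat \<times> nat \<Rightarrow> state \<Rightarrow> bool" where
  "chosen i u y c st \<longleftrightarrow> (let j = n - Suc i in
     regs st 22 = option_cost i u y c \<and> regs st 23 = fst c \<and> regs st 24 = from_pos j c \<and>
     regs st 25 = to_pos j c \<and> regs st 26 = gap j u y c \<and> regs st 27 = next_y j u y c)"

definition ready :: "nat \<Rightarrow> (nat \<Rightarrow> nat) \<Rightarrow> nat \<Rightarrow> state \<Rightarrow> bool" where
  "ready i u y st \<longleftrightarrow> i < n \<and> globals_ok st \<and> layer_ok i st \<and> regs st 8 = Suc i \<and>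
     regs st 9 = u 0 \<and> regs st 10 = u 1 \<and> regs st 11 = y \<and> u 0 \<le> L \<and> u 1 \<le> L \<and>
     regs st 13 = lft I (n - Suc i) \<and> regs st 14 = rgt I (n - Suc i) \<and>
     regs st 28 = work (n - Suc i)"

definition tried :: "nat \<Rightarrow> (nat \<Rightarrow> nat) \<Rightarrow> nat \<Rightarrow> nat \<times> nat \<Rightarrow> state \<Rightarrow> bool" where
  "tried i u y c st \<longleftrightarrow> (let j = n - Suc i in
     regs st 21 = option_cost i u y c \<and> regs st 15 = from_pos j c \<and>
     regs st 16 = to_pos j c \<and> regs st 19 = gap j u y c \<and> regs st 20 = next_y j u y c)"

definition same_except :: "nat set \<Rightarrow> state \<Rightarrow> state \<Rightarrow> bool" where
  "same_except X st st' \<longleftrightarrow> mem st' = mem st \<and> (\<forall>x. x \<notin> X \<longrightarrow> regs st' x = regs st x)"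

lemma same_exceptI: "no_store P \<Longrightarrow> writes P \<subseteq> X \<Longrightarrow> same_except X st (sem P st)"
  using regs_sem mem_sem by (auto simp: same_except_def)

lemma test_choice_correct:
  assumes r: "ready i u y st" and "k < 2" "d < 2"
  shows "tried i u y (k, d) (sem (test_choice k d) st)" "same_except {15..21} st (sem (test_choice k d) st)"
proof -
  let ?j = "n - Suc i"
  let ?st = "sem (test_choice k d) st"
  note rr = r[unfolded ready_def globals_ok_def]
  have j: "?j < n" using rr by simp
  have k: "k = 0 \<or> k = 1" using assms(2) by auto
  have d: "d = 0 \<or> d = 1" using assms(3) by auto
  show "same_except {15..21} st ?st"
    by (rule same_exceptI) (auto simp: test_choice_def)
  let ?c = "(k, d)" and ?set = "\<lambda>x e st. sem (Set x e) st"
  let ?b = "from_pos ?j ?c" and ?t = "lag y (1 - k) + gap ?j u y ?c + work ?j"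
  define s1 where "s1 = ?set 15 (home_exp k (Reg (if d = 0 then 13 else 14))) st"
  define s2 where "s2 = ?set 16 (home_exp k (Reg (if d = 0 then 14 else 13))) s1"
  define s3 where "s3 = ?set 17
    (Sub (Add (Sub (Reg 15) (Reg (9 + k))) (Sub (Reg (9 + k)) (Reg 15))) (lag_exp k)) s2"
  define s4 where "s4 = ?set 18 (Sub (Sub (Add (Reg 15) (Reg (10 - k))) (Reg 2)) (lag_exp (1 - k))) s3"
  define s5 where "s5 = ?set 19 (max_exp (Reg 17) (Reg 18)) s4"
  define s6 where "s6 = ?set 20 (Add (Add (lag_exp (1 - k)) (Reg 19)) (Reg 28)) s5"
  define s7 where "s7 = ?set 20 (if k = 0 then Sub (Reg 2) (Reg 20)
    else Sub (Add (Reg 2) (Reg 20)) (Sub (Reg 20) (Reg 2))) s6"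
  have st: "?st = ?set 21 (Add (Add (Reg 19) (Reg 28)) (Mem (addr_exp (Sub (Reg 8) (Num 1))
        (if k = 0 then Reg 16 else Reg 9) (if k = 0 then Reg 10 else Reg 16) (Reg 20)))) s7"
    unfolding test_choice_def seqs.simps sem.simps(4)
      s7_def s6_def s5_def s4_def s3_def s2_def s1_def ..
  have upd: "regs (sem (Set x e) st) = (regs st)(x := v)" if "eval st e = v" for x e st v
    using that by simp
  have r1: "regs s1 = (regs st)(15 := ?b)"
    unfolding s1_def
    by (rule upd) (use k d in \<open>elim disjE; simp add: rr home_exp_def from_pos_def home_def\<close>)
  have r2: "regs s2 = (regs s1)(16 := to_pos ?j ?c)"
    unfolding s2_def
    by (rule upd) (use k d in \<open>elim disjE; simp add: r1 rr home_exp_def to_pos_def home_def\<close>)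
  have r3: "regs s3 = (regs s2)(17 := (?b - u k) + (u k - ?b) - lag y k)"
    unfolding s3_def
    by (rule upd) (use k in \<open>elim disjE; simp add: r2 r1 rr lag_exp_def lag_def\<close>)
  have r4: "regs s4 = (regs s3)(18 := ?b + u (1 - k) - L - lag y (1 - k))"
    unfolding s4_def
    by (rule upd) (use k in \<open>elim disjE; simp add: r3 r2 r1 rr lag_exp_def lag_def\<close>)
  have r5: "regs s5 = (regs s4)(19 := gap ?j u y ?c)"
    unfolding s5_def by (rule upd) (simp add: r4 r3 gap_def Let_def)
  have r6: "regs s6 = (regs s5)(20 := ?t)"
    unfolding s6_def
    by (rule upd) (use k in \<open>elim disjE; simp add: r5 r4 r3 r2 r1 rr lag_exp_def lag_def\<close>)
  have cap: "L + t - (t - L) = L + min L t" for t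
    by simp
  have t6: "regs s6 20 = ?t" "regs s6 2 = L"
    by (simp_all add: r6 r5 r4 r3 r2 r1 rr)
  have "next_y ?j u y ?c = (if k = 0 then L - ?t else L + min L ?t)"
    by (simp only: next_y_def Let_def fst_conv)
  then have "eval s6 (if k = 0 then Sub (Reg 2) (Reg 20)
    else Sub (Add (Reg 2) (Reg 20)) (Sub (Reg 20) (Reg 2))) = next_y ?j u y ?c"
    by (simp only: eval.simps t6 cap split: if_split) simp
  then have r7: "regs s7 = (regs s6)(20 := next_y ?j u y ?c)"
    unfolding s7_def by (rule upd)
  have m: "mem s7 = mem st"
    unfolding s7_def s6_def s5_def s4_def s3_def s2_def s1_def
    by (simp only: mem_sem no_store.simps)
  have g: "globals_ok s7"
    using r by (simp add: ready_def globals_ok_def r7 r6 r5 r4 r3 r2 r1)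
  have lt: "togo i (pos (if k = 0 then to_pos ?j ?c else u 0) (if k = 0 then u 1 else to_pos ?j ?c)) y'
      = togo i (u(k := to_pos ?j ?c)) y'" for y'
    using k by (intro togo_cong) auto
  have "eval s7 (addr_exp (Sub (Reg 8) (Num 1)) (if k = 0 then Reg 16 else Reg 9)
      (if k = 0 then Reg 10 else Reg 16) (Reg 20)) = table_base + idx i
      (if k = 0 then to_pos ?j ?c else u 0) (if k = 0 then u 1 else to_pos ?j ?c) (next_y ?j u y ?c)"
    unfolding eval_addr[OF g] by (simp add: r7 r6 r5 r4 r3 r2 r1 rr)
  moreover have "mem st (table_base + idx i (if k = 0 then to_pos ?j ?c else u 0)
      (if k = 0 then u 1 else to_pos ?j ?c) (next_y ?j u y ?c))
      = togo i (u(k := to_pos ?j ?c)) (next_y ?j u y ?c)"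
    unfolding lt[symmetric]
  proof (rule layer_okD)
    show "layer_ok i st" using r by (simp add: ready_def)
  qed (use from_to_le(2)[OF j] rr next_y_le in auto)
  ultimately have "regs ?st = (regs s7)(21 := option_cost i u y ?c)"
    unfolding st by (simp add: m option_cost_def Let_def r7 r6 r5 r4 r3 r2 r1 rr del: fun_upd_apply)
      (simp add: r7 r6 r5 r4 r3 r2 r1 rr)
  then show "tried i u y ?c ?st"
    by (simp add: tried_def Let_def r7 r6 r5 r4 r3 r2 r1)
qed

lemma ready_same:
  assumes "ready i u y st" "same_except X st st'" "X \<subseteq> {15..27}"
  shows "ready i u y st'"
proof -
  have "regs st' x = regs st x" if "x \<notin> {15..27}" for x
    using that assms(2,3) unfolding same_except_def by blast
  moreover have "mem st' = mem st" using assms(2) by (simp add: same_except_def)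
  ultimately show ?thesis
    using assms(1) unfolding ready_def globals_ok_def layer_ok_def by simp
qed

lemma same_trans:
  "same_except X st st' \<Longrightarrow> same_except Y st' st'' \<Longrightarrow> same_except (X \<union> Y) st st''"
  by (simp add: same_except_def)

lemma keep_correct:
  assumes "tried i u y (k, d) st"
  shows "chosen i u y (k, d) (sem (keep k d) st)" "same_except {22..27} st (sem (keep k d) st)"
proof -
  show "chosen i u y (k, d) (sem (keep k d) st)"
    using assms by (simp add: keep_def tried_def chosen_def Let_def)
  show "same_except {22..27} st (sem (keep k d) st)"
    by (rule same_exceptI) (auto simp: keep_def)
qed

lemma test_keep_correct:
  assumes "ready i u y st" "chosen i u y c st" "k < 2" "d < 2"
  defines "st' \<equiv> sem (keep_better k d) (sem (test_choice k d) st)"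
  shows "chosen i u y (if option_cost i u y (k, d) < option_cost i u y c then (k, d) else c) st'"
    "same_except {15..27} st st'"
proof -
  let ?st = "sem (test_choice k d) st"
  note t = test_choice_correct[OF assms(1,3,4)]
  note kp = keep_correct[OF t(1)]
  have c: "chosen i u y c ?st"
    using t(2) assms(2) by (simp add: chosen_def same_except_def)
  have v: "regs ?st 21 = option_cost i u y (k, d)" "regs ?st 22 = option_cost i u y c"
    using t(1) c by (simp_all add: tried_def chosen_def Let_def)
  show "chosen i u y (if option_cost i u y (k, d) < option_cost i u y c then (k, d) else c) st'"
    using c kp(1) v by (simp add: st'_def keep_better_def)
  have "{15..21} \<union> {22..27} = {15..27::nat}" by auto
  then have "same_except {15..27} st (sem (keep k d) ?st)"
    using same_trans[OF t(2) kp(2)] by simp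
  moreover have "same_except {15..27} st ?st" using t(2) by (auto simp: same_except_def)
  ultimately show "same_except {15..27} st st'"
    unfolding st'_def keep_better_def by simp
qed

text \<open>The program compares the options in the order in which \<open>pick\<close> scans them,
  with the same strict test, so even ties are resolved alike; the output depends on the choice and
  not only on its cost.\<close>

lemma choose_best_correct:
  assumes "i < n" "globals_ok st" "input_ok st" "layer_ok i st" "regs st 8 = Suc i"
    "regs st 9 = u 0" "regs st 10 = u 1" "regs st 11 = y" "u 0 \<le> L" "u 1 \<le> L"
  shows "chosen i u y (pick (option_cost i u y)) (sem choose_best st)"
    "same_except {13..28} st (sem choose_best st)"
    "regs (sem choose_best st) 28 = work (n - Suc i)"
proof -
  let ?oc = "option_cost i u y"
  define st1 where "st1 = sem load_job st"
  define st2 where "st2 = sem (keep 0 0) (sem (test_choice 0 0) st1)"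
  define st3 where "st3 = sem (keep_better 0 1) (sem (test_choice 0 1) st2)"
  define st4 where "st4 = sem (keep_better 1 0) (sem (test_choice 1 0) st3)"
  define st5 where "st5 = sem (keep_better 1 1) (sem (test_choice 1 1) st4)"
  have st5: "sem choose_best st = st5"
    by (simp add: choose_best_def st1_def st2_def st3_def st4_def st5_def)
  have j: "n - Suc i < n" using assms(1) by simp
  have "3 * (n - Suc i) + 4 = 4 + 3 * (n - Suc i)" "3 * (n - Suc i) + 5 = 5 + 3 * (n - Suc i)" by simp_all
  then have r1: "ready i u y st1"
    using assms j unfolding ready_def st1_def load_job_def
    by (simp add: globals_ok_def layer_ok_def input_ok_def work_def)
  have e1: "same_except {13..28} st st1"
    unfolding st1_def by (rule same_exceptI) (auto simp: load_job_def)
  have un: "{15..21} \<union> {22..27} = {15..27::nat}" by auto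
  have lt: "(0::nat) < 2" "(1::nat) < 2" by simp_all
  note t = test_choice_correct[OF r1 lt(1,1)]
  have c2: "chosen i u y (0, 0) st2" "same_except {15..27} st1 st2"
    using keep_correct[OF t(1)] same_trans[OF t(2) keep_correct(2)[OF t(1)]]
    unfolding st2_def un by simp_all
  note r2 = ready_same[OF r1 c2(2) order_refl]
  note c3 = test_keep_correct[OF r2 c2(1) lt(1,2), folded st3_def]
  note r3 = ready_same[OF r2 c3(2) order_refl]
  note c4 = test_keep_correct[OF r3 c3(1) lt(2,1), folded st4_def]
  note r4 = ready_same[OF r3 c4(2) order_refl]
  note c5 = test_keep_correct[OF r4 c4(1) lt(2,2), folded st5_def]
  note r5 = ready_same[OF r4 c5(2) order_refl]
  show "regs (sem choose_best st) 28 = work (n - Suc i)"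
    using r5 unfolding st5 by (simp add: ready_def)
  show "chosen i u y (pick ?oc) (sem choose_best st)"
    using c5(1) unfolding st5 pick_def Let_def .
  show "same_except {13..28} st (sem choose_best st)"
    using same_trans[OF e1 same_trans[OF c2(2) same_trans[OF c3(2) same_trans[OF c4(2) c5(2)]]]]
    unfolding st5 by (auto simp: same_except_def)
qed

section \<open>Filling the table in the order of addresses\<close>

lemma mixed_radix_inj:
  fixes a b a' b' m :: nat
  assumes "a * m + b = a' * m + b'" "b < m" "b' < m"
  shows "a = a' \<and> b = b'"
proof -
  have "(a * m + b) div m = a" "(a' * m + b') div m = a'" using assms(2,3) by simp_all
  then show ?thesis using assms(1) by (metis add_left_imp_eq)
qed

lemma idx_inj:
  assumes "idx i a b y = idx i' a' b' y'" "a \<le> L" "b \<le> L" "y \<le> 2 * L" "a' \<le> L" "b' \<le> L" "y' \<le> 2 * L"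
  shows "i = i' \<and> a = a' \<and> b = b' \<and> y = y'"
  using assms unfolding idx_def
  by (metis less_Suc_eq_le Suc_eq_plus1 mixed_radix_inj)

definition loop_regs :: "nat \<Rightarrow> nat \<Rightarrow> nat \<Rightarrow> nat \<Rightarrow> nat \<Rightarrow> nat" where
  "loop_regs i a b y = (\<lambda>_. 0)(0 := 3 * n + 3, 1 := n, 2 := L, 3 := s, 4 := table_base,
     5 := n + 1, 6 := L + 1, 7 := 2 * L + 1, 8 := i, 9 := a, 10 := b, 11 := y)"

lemma fill_cell_correct:
  assumes st: "regs st = loop_regs i a b y" and "i \<le> n" "a \<le> L" "b \<le> L"
    and "input_ok st" "i \<noteq> 0 \<Longrightarrow> layer_ok (i - 1) st"
  shows "regs (sem fill_cell st) = regs st"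
    "mem (sem fill_cell st) = (mem st)(table_base + idx i a b y := togo i (pos a b) y)"
proof -
  let ?b = "If (Reg 8) choose_best (Set 22 final_cost)"
  let ?st = "sem ?b st"
  have g: "globals_ok st" using st by (simp add: globals_ok_def loop_regs_def)
  have *: "regs ?st 22 = togo i (pos a b) y \<and> same_except {13..28} st ?st"
  proof (cases i)
    case 0
    then show ?thesis
      using st by (simp add: loop_regs_def final_cost_def same_except_def lag_exp_def lag_def)
  next
    case (Suc i')
    have i': "i' < n" and l: "layer_ok i' st" using Suc assms(2,6) by auto
    have "chosen i' (pos a b) y (pick (option_cost i' (pos a b) y)) (sem choose_best st)"
      "same_except {13..28} st (sem choose_best st)"
      using choose_best_correct[OF i' g assms(5) l, of "pos a b" y] st Suc assms(3,4)
      by (simp_all add: loop_regs_def)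
    then show ?thesis
      using st Suc by (simp add: loop_regs_def chosen_def togo_Suc Let_def)
  qed
  then have g': "globals_ok ?st"
    using g by (simp add: globals_ok_def same_except_def del: sem.simps)
  have lo: "regs ?st x = regs st x" if "x \<notin> {13..28}" for x
    using * that unfolding same_except_def by blast
  have "regs (sem fill_cell st) x = regs st x" for x
  proof (cases "x \<in> {13..28}")
    case True
    then have "regs st x = 0" using st by (simp add: loop_regs_def)
    moreover have "x \<in> set [13..<29]" using True unfolding set_upt by simp
    ultimately show ?thesis
      unfolding fill_cell_def seqs.simps sem.simps(4) sem_clear by simp
  next
    case False
    then have "x \<notin> set [13..<29]" unfolding set_upt by auto
    then show ?thesis
      using lo[OF False] unfolding fill_cell_def seqs.simps sem.simps(4) sem_clear sem.simps(3)
      by simp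
  qed
  then show "regs (sem fill_cell st) = regs st" by auto
  show "mem (sem fill_cell st) = (mem st)(table_base + idx i a b y := togo i (pos a b) y)"
    using * lo[of 8] lo[of 9] lo[of 10] lo[of 11] st
    unfolding fill_cell_def seqs.simps sem.simps(4) sem_clear sem.simps(3) eval_addr[OF g']
    by (simp add: same_except_def loop_regs_def del: sem.simps(5))
qed

lemma set_loop_regs:
  "(loop_regs i a b y)(8 := v) = loop_regs v a b y"
  "(loop_regs i a b y)(9 := v) = loop_regs i v b y"
  "(loop_regs i a b y)(10 := v) = loop_regs i a v y"
  "(loop_regs i a b y)(11 := v) = loop_regs i a b v"
  by (auto simp: loop_regs_def)

text \<open>With fewer remaining jobs all addresses are smaller, so a filled prefix of the table
  contains the whole layer that the next entry consults.\<close>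

lemma idx_less_layer:
  assumes "i' < i" "a \<le> L" "b \<le> L" "y \<le> 2 * L"
  shows "idx i' a b y < idx i a' b' y'"
proof -
  have "(i' * (L + 1) + a) * (L + 1) + b < Suc (i' * (L + 1) + a) * (L + 1)" using assms by simp
  also have "\<dots> \<le> (i * (L + 1)) * (L + 1)"
  proof (rule mult_le_mono1)
    have "Suc (i' * (L + 1) + a) \<le> Suc i' * (L + 1)" using assms by simp
    also have "\<dots> \<le> i * (L + 1)" using assms by (intro mult_le_mono1) simp
    finally show "Suc (i' * (L + 1) + a) \<le> i * (L + 1)" .
  qed
  also have "\<dots> \<le> (i * (L + 1) + a') * (L + 1) + b'" by (simp add: algebra_simps)
  finally have "Suc ((i' * (L + 1) + a) * (L + 1) + b) * (2 * L + 1)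
      \<le> ((i * (L + 1) + a') * (L + 1) + b') * (2 * L + 1)" by (intro mult_le_mono1) simp
  then show ?thesis using assms(4) unfolding idx_def by simp
qed

abbreviation "M \<equiv> n + L + s"

lemma M_facts: "2 \<le> M" "n + 2 \<le> M" "L + 1 \<le> M" "s + 1 \<le> M"
  using L_pos s_pos by simp_all

text \<open>Numbers kept between blocks are of two kinds: doubled times and scaled positions,
  bounded through \<open>togo_le\<close>, and counters, addresses or input words, below 32M. As M is
  at least 2, both bounds are at most M^6, and 2 M^6 is at most M^8.\<close>

lemma power_8_bound: "2 * ((n + 1) * (2 * s * L)) + 32 * M \<le> M ^ 8"
proof -
  note M = M_facts(1)
  have "(n + 1) * (s * L) \<le> M * (M * M)"
    using M_facts by (intro mult_le_mono) simp_all
  then have 1: "2 * ((n + 1) * (2 * s * L)) \<le> 4 * M ^ 3" by (simp add: power3_eq_cube)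
  have 2: "4 * M ^ 3 \<le> M ^ 2 * M ^ 3" "32 * M \<le> M ^ 5 * M ^ 1"
    using power_mono[OF M, of 2] power_mono[OF M, of 5] by (intro mult_le_mono; simp)+
  have "M ^ 2 * M ^ 3 \<le> M ^ 6" "M ^ 5 * M ^ 1 \<le> M ^ 6"
    unfolding power_add[symmetric] using M by (intro power_increasing; simp)+
  moreover have "2 * M ^ 6 \<le> M ^ 2 * M ^ 6"
    using power_mono[OF M, of 2] by (intro mult_le_mono1) simp
  moreover have "M ^ 2 * M ^ 6 = M ^ 8" by (simp flip: power_add)
  ultimately show ?thesis using 1 2 by linarith
qed

lemma le_M8: "x \<le> 32 * M \<Longrightarrow> x \<le> M ^ 8" "x \<le> 2 * ((n + 1) * (2 * s * L)) \<Longrightarrow> x \<le> M ^ 8"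
  using power_8_bound by linarith+

definition filled :: "nat \<Rightarrow> state \<Rightarrow> bool" where
  "filled N st \<longleftrightarrow> (\<forall>i a b y. a \<le> L \<longrightarrow> b \<le> L \<longrightarrow> y \<le> 2 * L \<longrightarrow> idx i a b y < N \<longrightarrow>
     mem st (table_base + idx i a b y) = togo i (pos a b) y)"

definition mem_small :: "state \<Rightarrow> bool" where
  "mem_small st \<longleftrightarrow> (\<forall>x. mem st x \<le> M ^ 8)"

definition fill_inv :: "nat \<Rightarrow> nat \<Rightarrow> nat \<Rightarrow> nat \<Rightarrow> state \<Rightarrow> bool" where
  "fill_inv i a b y st \<longleftrightarrow> regs st = loop_regs i a b y \<and> filled (idx i a b y) st \<and>
     input_ok st \<and> mem_small st"

lemma fill_inv_layer:
  assumes "fill_inv (Suc i) a b y st"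
  shows "layer_ok i st"
  using assms idx_less_layer[of i "Suc i"] unfolding fill_inv_def filled_def layer_ok_def by simp

lemma fill_inv_bounded:
  assumes "fill_inv i a b y st" "i \<le> n" "a \<le> L" "b \<le> L" "y \<le> 2 * L"
  shows "bounded (M ^ 8) st"
proof -
  have "loop_regs i a b y x \<le> 32 * M" for x
    using assms(2-5) M_facts by (auto simp: loop_regs_def)
  then show ?thesis
    using assms(1) le_M8(1) by (auto simp: bounded_def fill_inv_def mem_small_def)
qed

lemma fill_cell_inv:
  assumes inv: "fill_inv i a b y st" and le: "i \<le> n" "a \<le> L" "b \<le> L" "y \<le> 2 * L"
  shows "fill_inv i a b (Suc y) (set_reg 11 (Suc y) (sem fill_cell st))"
proof -
  have l: "layer_ok (i - 1) st" if "i \<noteq> 0"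
    using fill_inv_layer[of "i - 1" a b y st] inv that by simp
  have fc: "regs (sem fill_cell st) = regs st"
    "mem (sem fill_cell st) = (mem st)(table_base + idx i a b y := togo i (pos a b) y)"
    using fill_cell_correct[of st i a b y] inv l le by (simp_all add: fill_inv_def)
  have "togo i (pos a b) y \<le> (n + 1) * (2 * s * L)"
    using togo_le[of i "pos a b" y] le
    by (intro le_trans[OF _ mult_le_mono1[of "i + 1" "n + 1" "2 * s * L"]]) simp_all
  then have sm: "togo i (pos a b) y \<le> M ^ 8" by (intro le_M8(2)) simp
  have "filled (idx i a b (Suc y)) (sem fill_cell st)"
    unfolding filled_def
  proof (intro allI impI)
    fix i' a' b' y'
    assume *: "a' \<le> L" "b' \<le> L" "y' \<le> 2 * L" "idx i' a' b' y' < idx i a b (Suc y)"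
    show "mem (sem fill_cell st) (table_base + idx i' a' b' y') = togo i' (pos a' b') y'"
    proof (cases "idx i' a' b' y' = idx i a b y")
      case True
      then show ?thesis using idx_inj[OF True] * le by (simp add: fc(2))
    next
      case False
      then have "idx i' a' b' y' < idx i a b y" using *(4) by (simp add: idx_def)
      then show ?thesis using False * inv unfolding fc(2) fill_inv_def filled_def by simp
    qed
  qed
  moreover have "input_ok (sem fill_cell st)"
    using inv unfolding fill_inv_def input_ok_def fc(2) by simp
  moreover have "mem_small (sem fill_cell st)"
    using inv sm unfolding fill_inv_def mem_small_def fc(2) by simp
  ultimately show ?thesis
    using inv fc(1) unfolding fill_inv_def
    by (simp add: set_loop_regs filled_def input_ok_def mem_small_def)
qed

text \<open>A finished inner loop has the same address as the next step of the outer one; hence one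
  prefix invariant \<open>fill_inv\<close> serves all four nested loops.\<close>

lemma idx_carry:
  "idx i a b (2 * L + 1) = idx i a (Suc b) 0"
  "idx i a (L + 1) 0 = idx i (Suc a) 0 0"
  "idx i (L + 1) 0 0 = idx (Suc i) 0 0 0"
  by (simp_all add: idx_def algebra_simps)

lemma mem_preds:
  "filled N (set_reg x v st) = filled N st" "input_ok (set_reg x v st) = input_ok st"
  "mem_small (set_reg x v st) = mem_small st"
  by (simp_all add: filled_def input_ok_def mem_small_def)

lemma fill_inv_set:
  "fill_inv i a b (2 * L + 1) st \<Longrightarrow> fill_inv i a (Suc b) 0 (set_reg 10 (Suc b) (set_reg 11 0 st))"
  "fill_inv i a (L + 1) 0 st \<Longrightarrow> fill_inv i (Suc a) 0 0 (set_reg 9 (Suc a) (set_reg 10 0 st))"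
  "fill_inv i (L + 1) 0 0 st \<Longrightarrow> fill_inv (Suc i) 0 0 0 (set_reg 8 (Suc i) (set_reg 9 0 st))"
  by (simp_all only: fill_inv_def set_reg_simps set_loop_regs idx_carry mem_preds simp_thms)

lemma fill_inv_heads:
  assumes "fill_inv i a b y st"
  shows "regs st 8 = i" "regs st 9 = a" "regs st 10 = b" "regs st 11 = y"
    "regs st 5 = n + 1" "regs st 6 = L + 1" "regs st 7 = 2 * L + 1"
  using assms by (simp_all add: fill_inv_def loop_regs_def)

definition fill_time :: nat where
  "fill_time = (n + 1) * (((L + 1) * (((L + 1) * (((2 * L + 1) * (time_bound fill_cell + 8) + 6) + 8) + 6)
     + 8) + 6) + 8) + 6"

lemma fill_table_runs:
  assumes d: "8 * growth fill_cell < d" "8 \<le> d" and inv: "fill_inv 0 0 0 0 st"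
    and Q: "\<And>st. regs st = loop_regs 0 0 0 0 \<Longrightarrow> filled (idx (Suc n) 0 0 0) st \<Longrightarrow>
      input_ok st \<Longrightarrow> mem_small st \<Longrightarrow> Q st"
  shows "runs (M ^ d) fill_table st fill_time Q"
proof -
  have "M ^ 8 \<le> M ^ d" using d(2) M_facts(1) by (intro power_increasing) simp_all
  then have K: "x \<le> 32 * M \<Longrightarrow> x \<le> M ^ d" for x using le_M8(1) le_trans by blast
  have W: "2 * L + 1 + 2 \<le> M ^ d" "L + 1 + 2 \<le> M ^ d" "n + 1 + 2 \<le> M ^ d"
    using M_facts by (intro K; simp)+
  have lf: "loop_free fill_cell"
    by (simp add: fill_cell_def loop_free_clear choose_best_def load_job_def test_choice_def
        keep_def keep_better_def)
  have 1: "runs (M ^ d) (For 11 7 fill_cell) st ((2 * L + 1) * (time_bound fill_cell + 8) + 6)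
      (\<lambda>st'. regs st' 10 = b \<and> fill_inv i a (Suc b) 0 (set_reg 10 (Suc b) st'))"
    if "i \<le> n" "a \<le> L" "b \<le> L" "fill_inv i a b 0 st" for i a b st
  proof (rule runs_For[where Inv = "fill_inv i a b"])
    show "runs (M ^ d) fill_cell st (time_bound fill_cell)
        (\<lambda>st'. regs st' 11 = y \<and> fill_inv i a b (Suc y) (set_reg 11 (Suc y) st'))"
      if "y < 2 * L + 1" "fill_inv i a b y st" for y st
    proof (rule runs_loop_free[OF lf M_facts(1) _ _ d(1)])
      have y: "y \<le> 2 * L" using that by simp
      show "bounded (M ^ 8) st" by (rule fill_inv_bounded[OF that(2) \<open>i \<le> n\<close> \<open>a \<le> L\<close> \<open>b \<le> L\<close> y])
      have "regs (sem fill_cell st) = regs st"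
        using that \<open>i \<le> n\<close> \<open>a \<le> L\<close> \<open>b \<le> L\<close> fill_inv_layer[of "i - 1" a b y st]
        by (intro fill_cell_correct(1)[of _ i a b y]) (auto simp: fill_inv_def)
      then show "regs (sem fill_cell st) 11 = y \<and>
          fill_inv i a b (Suc y) (set_reg 11 (Suc y) (sem fill_cell st))"
        using fill_cell_inv[OF that(2) \<open>i \<le> n\<close> \<open>a \<le> L\<close> \<open>b \<le> L\<close> y] fill_inv_heads[OF that(2)] by simp
    qed simp
  qed (use that W fill_inv_heads fill_inv_set(1) in \<open>auto simp: fill_inv_heads(3)\<close>)
  have 2: "runs (M ^ d) (For 10 6 (For 11 7 fill_cell)) st
      ((L + 1) * (((2 * L + 1) * (time_bound fill_cell + 8) + 6) + 8) + 6)
      (\<lambda>st'. regs st' 9 = a \<and> fill_inv i (Suc a) 0 0 (set_reg 9 (Suc a) st'))"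
    if "i \<le> n" "a \<le> L" "fill_inv i a 0 0 st" for i a st
    by (rule runs_For[where Inv = "\<lambda>b. fill_inv i a b 0"])
      (use that 1 W fill_inv_heads fill_inv_set(2) in \<open>auto simp: fill_inv_heads(2)\<close>)
  have 3: "runs (M ^ d) (For 9 6 (For 10 6 (For 11 7 fill_cell))) st
      ((L + 1) * (((L + 1) * (((2 * L + 1) * (time_bound fill_cell + 8) + 6) + 8) + 6) + 8) + 6)
      (\<lambda>st'. regs st' 8 = i \<and> fill_inv (Suc i) 0 0 0 (set_reg 8 (Suc i) st'))"
    if "i \<le> n" "fill_inv i 0 0 0 st" for i st
    by (rule runs_For[where Inv = "\<lambda>a. fill_inv i a 0 0"])
      (use that 2 W fill_inv_heads fill_inv_set(3) in \<open>auto simp: fill_inv_heads(1)\<close>)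
  show ?thesis
    unfolding fill_table_def fill_time_def
  proof (rule runs_For[where Inv = "\<lambda>i. fill_inv i 0 0 0"])
    show "Q (set_reg 8 0 st)" if "fill_inv (n + 1) 0 0 0 st" for st
      using that by (intro Q) (simp_all add: fill_inv_def set_loop_regs mem_preds)
  qed (use 3 W fill_inv_heads inv in auto)
qed

section \<open>Writing jobs and breakpoints to the output\<close>

definition flip :: "nat \<Rightarrow> nat \<Rightarrow> nat" where
  "flip k x = s * (if k = 0 then x else 2 * L - x)"

lemma eval_flip:
  "regs st 2 = L \<Longrightarrow> regs st 3 = s \<Longrightarrow> eval st (flip_exp k e) = flip k (eval st e)"
  by (simp add: flip_exp_def flip_def)

definition leg_words :: "nat \<Rightarrow> nat \<Rightarrow> nat \<Rightarrow> nat \<Rightarrow> nat \<Rightarrow> nat list" where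
  "leg_words k f u g b =
    (let H = u + b - (g - f)
     in [2 * f, flip k (2 * u), 2 * f + (2 * u - H), flip k H, 2 * g - (2 * b - H), flip k H,
         2 * g, flip k (2 * b)])"

lemma length_leg_words [simp]: "length (leg_words k f u g b) = 8"
  by (simp add: leg_words_def Let_def)

definition put :: "nat \<Rightarrow> nat list \<Rightarrow> (nat \<Rightarrow> nat) \<Rightarrow> nat \<Rightarrow> nat" where
  "put p ws m a = (if p \<le> a \<and> a < p + length ws then ws ! (a - p) else m a)"

lemma put_8:
  "m(p := a, p + 1 := b, p + 2 := c, p + 3 := d, p + 4 := e, p + 5 := f, p + 6 := g, p + 7 := h)
    = put p [a, b, c, d, e, f, g, h] m"
proof
  fix x
  have "x < p \<or> x = p \<or> x = p + 1 \<or> x = p + 2 \<or> x = p + 3 \<or> x = p + 4 \<or> x = p + 5 \<or> x = p + 6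
    \<or> x = p + 7 \<or> p + 8 \<le> x" by arith
  then show "(m(p := a, p + 1 := b, p + 2 := c, p + 3 := d, p + 4 := e, p + 5 := f, p + 6 := g,
      p + 7 := h)) x = put p [a, b, c, d, e, f, g, h] m x"
    by (elim disjE) (simp_all add: put_def)
qed

lemma leg_correct:
  assumes "k < 2" "x \<noteq> 35" "z \<noteq> 35" "x \<noteq> 33 + k" "z \<noteq> 33 + k" "regs st 2 = L" "regs st 3 = s"
  defines "p \<equiv> regs st (33 + k)"
  shows "mem (sem (leg k x z) st) = put p
      (leg_words k (regs st (31 + k)) (regs st (9 + k)) (regs st x) (regs st z)) (mem st)"
    "y \<noteq> 35 \<Longrightarrow> regs (sem (leg k x z) st) y = (if y = 33 + k then p + 8 else regs st y)"
proof -
  let ?u = "regs st (9 + k)" and ?b = "regs st z" and ?f = "regs st (31 + k)" and ?g = "regs st x"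
  define s1 where "s1 = sem (Set 35 (Sub (Add (Reg (9 + k)) (Reg z)) (Sub (Reg x) (Reg (31 + k))))) st"
  have r1: "regs s1 = (regs st)(35 := ?u + ?b - (?g - ?f))" and m1: "mem s1 = mem st"
    by (simp_all add: s1_def)
  have k: "9 + k \<noteq> 35" "31 + k \<noteq> 35" "33 + k \<noteq> 35" using assms(1) by auto
  have e: "regs s1 35 = ?u + ?b - (?g - ?f)" "regs s1 (9 + k) = ?u" "regs s1 (31 + k) = ?f"
    "regs s1 x = ?g" "regs s1 z = ?b" "regs s1 (33 + k) = p" "regs s1 2 = L" "regs s1 3 = s"
    using assms k by (simp_all add: r1)
  have "mem (sem (leg k x z) st) = (mem st)(p := leg_words k ?f ?u ?g ?b ! 0,
      p + 1 := leg_words k ?f ?u ?g ?b ! 1, p + 2 := leg_words k ?f ?u ?g ?b ! 2,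
      p + 3 := leg_words k ?f ?u ?g ?b ! 3, p + 4 := leg_words k ?f ?u ?g ?b ! 4,
      p + 5 := leg_words k ?f ?u ?g ?b ! 5, p + 6 := leg_words k ?f ?u ?g ?b ! 6,
      p + 7 := leg_words k ?f ?u ?g ?b ! 7)"
    unfolding leg_def Let_def seqs.simps sem.simps(4) s1_def[symmetric]
    by (simp add: eval_flip leg_words_def Let_def e m1)
  then show "mem (sem (leg k x z) st) = put p (leg_words k ?f ?u ?g ?b) (mem st)"
    unfolding put_8 by (simp add: leg_words_def Let_def)
  show "y \<noteq> 35 \<Longrightarrow> regs (sem (leg k x z) st) y = (if y = 33 + k then p + 8 else regs st y)"
    unfolding leg_def Let_def seqs.simps sem.simps(4) s1_def[symmetric]
    by (simp add: e r1 p_def)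
qed

lemma two_legs:
  fixes st :: state
  assumes k: "k < 2" and x: "x \<notin> {33, 34, 35}" "z \<notin> {33, 34, 35}" "x' \<notin> {33, 34, 35}" "z' \<notin> {33, 34, 35}"
    and g: "regs st 2 = L" "regs st 3 = s" and p: "regs st 33 + 8 \<le> regs st 34"
  defines "st' \<equiv> sem (leg (1 - k) x' z') (sem (leg k x z) st)"
  shows "y \<noteq> 35 \<Longrightarrow> regs st' y = (if y = 33 \<or> y = 34 then regs st y + 8 else regs st y)"
    "k' < 2 \<Longrightarrow> r < 8 \<Longrightarrow> mem st' (regs st (33 + k') + r) =
      leg_words k' (regs st (31 + k')) (regs st (9 + k')) (regs st (if k' = k then x else x'))
        (regs st (if k' = k then z else z')) ! r"
    "(\<And>k'. k' < 2 \<Longrightarrow> a < regs st (33 + k') \<or> regs st (33 + k') + 8 \<le> a) \<Longrightarrow> mem st' a = mem st a"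
proof -
  let ?s1 = "sem (leg k x z) st"
  have kk: "k = 0 \<or> k = 1" and lt: "1 - k < 2" using k by auto
  have l1: "mem ?s1 = put (regs st (33 + k))
      (leg_words k (regs st (31 + k)) (regs st (9 + k)) (regs st x) (regs st z)) (mem st)"
    "\<And>y. y \<noteq> 35 \<Longrightarrow> regs ?s1 y = (if y = 33 + k then regs st (33 + k) + 8 else regs st y)"
    using kk x g by (intro leg_correct; auto)+
  have o: "regs ?s1 (33 + (1 - k)) = regs st (33 + (1 - k))" "regs ?s1 (31 + (1 - k)) = regs st (31 + (1 - k))"
    "regs ?s1 (9 + (1 - k)) = regs st (9 + (1 - k))" "regs ?s1 x' = regs st x'" "regs ?s1 z' = regs st z'"
    "regs ?s1 2 = L" "regs ?s1 3 = s"
    using kk x g by (auto simp: l1(2))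
  have l2: "mem st' = put (regs st (33 + (1 - k)))
      (leg_words (1 - k) (regs st (31 + (1 - k))) (regs st (9 + (1 - k))) (regs st x') (regs st z')) (mem ?s1)"
    "\<And>y. y \<noteq> 35 \<Longrightarrow> regs st' y = (if y = 33 + (1 - k) then regs st (33 + (1 - k)) + 8 else regs ?s1 y)"
    using kk x leg_correct[of "1 - k" x' z' ?s1, unfolded o] unfolding st'_def by auto
  show "y \<noteq> 35 \<Longrightarrow> regs st' y = (if y = 33 \<or> y = 34 then regs st y + 8 else regs st y)"
    using kk by (auto simp: l1(2) l2(2))
  show "k' < 2 \<Longrightarrow> r < 8 \<Longrightarrow> mem st' (regs st (33 + k') + r) =
      leg_words k' (regs st (31 + k')) (regs st (9 + k')) (regs st (if k' = k then x else x'))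
        (regs st (if k' = k then z else z')) ! r"
    using kk p unfolding l2(1) l1(1) by (auto simp: put_def less_2_cases_iff)
  show "mem st' a = mem st a"
    if "\<And>k'. k' < 2 \<Longrightarrow> a < regs st (33 + k') \<or> regs st (33 + k') + 8 \<le> a"
    using that[OF k] that[OF lt] k unfolding l2(1) l1(1) put_def length_leg_words by auto
qed

lemma advance_correct:
  assumes k: "k < 2" and g: "regs st 2 = L" "regs st 3 = s" and p: "regs st 33 + 8 \<le> regs st 34"
  defines "st' \<equiv> sem (advance k) st"
  shows "y \<noteq> 35 \<Longrightarrow> regs st' y =
      (if y = 33 \<or> y = 34 then regs st y + 8 else if y = 31 + k then regs st 36 + regs st 28
       else if y = 9 + k then regs st 25 else regs st y)"
    "k' < 2 \<Longrightarrow> r < 8 \<Longrightarrow> mem st' (regs st (33 + k') + r) =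
      leg_words k' (regs st (31 + k')) (regs st (9 + k')) (if k' = k then regs st 36 else regs st (31 + k'))
        (if k' = k then regs st 24 else regs st (9 + k')) ! r"
    "(\<And>k'. k' < 2 \<Longrightarrow> a < regs st (33 + k') \<or> regs st (33 + k') + 8 \<le> a) \<Longrightarrow> mem st' a = mem st a"
proof -
  define st2 where "st2 = sem (leg (1 - k) (32 - k) (10 - k)) (sem (leg k 36 24) st)"
  have kk: "k = 0 \<or> k = 1" using k by auto
  then have "36 \<notin> {33, 34, 35::nat}" "24 \<notin> {33, 34, 35::nat}" "32 - k \<notin> {33, 34, 35}"
    "10 - k \<notin> {33, 34, 35}" by auto
  note tl = two_legs[OF k this g p, folded st2_def]
  have st': "st' = sem (Set (9 + k) (Reg 25)) (sem (Set (31 + k) (Add (Reg 36) (Reg 28))) st2)"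
    unfolding st'_def st2_def advance_def seqs.simps sem.simps(4) ..
  have m: "mem st' = mem st2" unfolding st' by simp
  show "y \<noteq> 35 \<Longrightarrow> regs st' y =
      (if y = 33 \<or> y = 34 then regs st y + 8 else if y = 31 + k then regs st 36 + regs st 28
       else if y = 9 + k then regs st 25 else regs st y)"
    using kk unfolding st' by (auto simp: tl(1))
  have "regs st (if k' = k then 36 else 32 - k) = (if k' = k then regs st 36 else regs st (31 + k'))"
    "regs st (if k' = k then 24 else 10 - k) = (if k' = k then regs st 24 else regs st (9 + k'))"
    if "k' < 2" using kk that by (auto simp: less_2_cases_iff)
  then show "k' < 2 \<Longrightarrow> r < 8 \<Longrightarrow> mem st' (regs st (33 + k') + r) =
      leg_words k' (regs st (31 + k')) (regs st (9 + k')) (if k' = k then regs st 36 else regs st (31 + k'))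
        (if k' = k then regs st 24 else regs st (9 + k')) ! r"
    unfolding m using tl(2)[of k' r] by simp
  show "(\<And>k'. k' < 2 \<Longrightarrow> a < regs st (33 + k') \<or> regs st (33 + k') + 8 \<le> a) \<Longrightarrow> mem st' a = mem st a"
    unfolding m by (rule tl(3))
qed

definition path_base :: "nat \<Rightarrow> nat" where
  "path_base k = (if k = 0 then 5 * n + 5 else 13 * n + 14)"

definition word :: "nat \<Rightarrow> nat \<Rightarrow> nat \<Rightarrow> nat" where
  "word k j r = leg_words k (last_fin greedy j k) (posn greedy j k) (target_time greedy k j)
     (target_pos greedy k j) ! r"

definition pass_regs :: "nat \<Rightarrow> nat \<Rightarrow> nat" where
  "pass_regs j = (loop_regs 0 (posn greedy j 0) (posn greedy j 1) (lagc greedy j))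
     (12 := j, 30 := clock greedy j, 31 := last_fin greedy j 0, 32 := last_fin greedy j 1,
      33 := path_base 0 + 8 * j, 34 := path_base 1 + 8 * j, 37 := 3 * n + 4 + 2 * j)"

definition job_area :: "nat \<Rightarrow> nat set" where
  "job_area j = {3 * n + 4 + 2 * j, 3 * n + 5 + 2 * j} \<union> {path_base 0 + 8 * j..<path_base 0 + 8 * j + 8}
     \<union> {path_base 1 + 8 * j..<path_base 1 + 8 * j + 8}"

text \<open>Register 12 still shows j because the increment belongs to the surrounding
  \<open>For\<close>.\<close>

lemma do_job_correct:
  assumes j: "j < n" and st: "regs st = pass_regs j" and ly: "layer_ok (n - Suc j) st" and inp: "input_ok st"
  defines "st' \<equiv> sem do_job st"
  shows "regs st' = (pass_regs (Suc j))(12 := j)"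
    "mem st' (3 * n + 4 + 2 * j) = fst (chc greedy j)"
    "mem st' (3 * n + 5 + 2 * j) = 2 * begin_at greedy j"
    "k < 2 \<Longrightarrow> r < 8 \<Longrightarrow> mem st' (path_base k + 8 * j + r) = word k j r"
    "a \<notin> job_area j \<Longrightarrow> mem st' a = mem st a"
proof -
  let ?i = "n - Suc j" and ?u = "posn greedy j" and ?y = "lagc greedy j" and ?c = "chc greedy j"
  let ?k = "fst ?c" and ?X = "{8, 35, 36} \<union> {13..28}"
  have i: "?i < n" "n - j = Suc ?i" "n - Suc ?i = j" using j by auto
  define t1 where "t1 = sem (Set 8 (Sub (Reg 1) (Reg 12))) st"
  define t2 where "t2 = sem choose_best t1"
  define t3 where "t3 = sem (Set 36 (Add (Reg 30) (Reg 26))) t2"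
  define t5 where "t5 = sem (Store (Add (Reg 37) (Num 1)) (Mul (Num 2) (Reg 36))) (sem (Store (Reg 37) (Reg 23)) t3)"
  define t6 where "t6 = sem (If (Reg 23) (advance 1) (advance 0)) t5"
  define t7 where "t7 = sem (Set 30 (Add (Reg 36) (Reg 28))) t6"
  define t8 where "t8 = sem (Set 11 (Reg 27)) t7"
  define t9 where "t9 = sem (Set 37 (Add (Reg 37) (Num 2))) t8"
  have st': "st' = sem (clear (8 # 35 # 36 # [13..<29])) t9"
    unfolding st'_def do_job_def seqs.simps sem.simps(4)
      t9_def t8_def t7_def t6_def t5_def t3_def t2_def t1_def ..
  have r1: "regs t1 = (pass_regs j)(8 := Suc ?i)" and m1: "mem t1 = mem st"
    using i(2) by (simp_all add: t1_def st pass_regs_def loop_regs_def)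
  have c: "pick (option_cost ?i ?u ?y) = ?c" by (simp add: chc_def greedy_def)
  have k: "?k < 2" by (rule chc_range[OF greedy_admissible])
  have cb: "chosen ?i ?u ?y ?c t2" "same_except {13..28} t1 t2" "regs t2 28 = work j"
  proof -
    have "globals_ok t1" unfolding globals_ok_def r1 by (simp add: pass_regs_def loop_regs_def)
    moreover have "input_ok t1" "layer_ok ?i t1"
      using inp ly m1 by (simp_all add: input_ok_def layer_ok_def)
    moreover have "regs t1 8 = Suc ?i" "regs t1 9 = ?u 0" "regs t1 10 = ?u 1" "regs t1 11 = ?y"
      by (simp_all add: r1 pass_regs_def loop_regs_def)
    moreover have "?u 0 \<le> L" "?u 1 \<le> L" using posn_le j by auto
    ultimately show "chosen ?i ?u ?y ?c t2" "same_except {13..28} t1 t2" "regs t2 28 = work j"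
      using choose_best_correct[OF i(1), of t1 ?u ?y] unfolding t2_def c i(3) by auto
  qed
  note ch = cb(1)[unfolded chosen_def Let_def i(3)]
  have r2: "regs t2 x = pass_regs j x" if "x \<notin> {13..28}" "x \<noteq> 8" for x
    using cb(2) that unfolding same_except_def r1 by simp
  have r3: "regs t3 = (regs t2)(36 := begin_at greedy j)"
    using ch by (simp add: t3_def r2 begin_at_def pass_regs_def)
  have m3: "mem t3 = mem st" using cb(2) by (simp add: t3_def same_except_def m1)
  have p: "pass_regs j 2 = L" "pass_regs j 3 = s" "pass_regs j 37 = 3 * n + 4 + 2 * j"
    "pass_regs j 33 = path_base 0 + 8 * j" "pass_regs j 34 = path_base 1 + 8 * j"
    "pass_regs j 31 = last_fin greedy j 0" "pass_regs j 32 = last_fin greedy j 1"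
    "pass_regs j 9 = ?u 0" "pass_regs j 10 = ?u 1"
    by (simp_all add: pass_regs_def loop_regs_def)
  have r5: "regs t5 = regs t3" by (simp add: t5_def)
  have v5: "regs t5 36 = begin_at greedy j" "regs t5 28 = work j" "regs t5 24 = from_pos j ?c"
    "regs t5 25 = to_pos j ?c" "regs t5 27 = next_y j ?u ?y ?c" "regs t5 23 = ?k"
    "regs t5 2 = L" "regs t5 3 = s" "regs t5 37 = 3 * n + 4 + 2 * j"
    "regs t5 33 = path_base 0 + 8 * j" "regs t5 34 = path_base 1 + 8 * j"
    "regs t5 31 = last_fin greedy j 0" "regs t5 32 = last_fin greedy j 1"
    "regs t5 9 = ?u 0" "regs t5 10 = ?u 1"
    using ch cb(3) by (simp_all add: r5 r3 r2 p)
  have m5: "mem t5 = (mem st)(3 * n + 4 + 2 * j := ?k, 3 * n + 5 + 2 * j := 2 * begin_at greedy j)"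
    using ch by (simp add: t5_def r3 r2 p m3 ac_simps)
  have t6: "t6 = sem (advance ?k) t5"
  proof -
    have "?k = 0 \<or> ?k = 1" using k by auto
    then show ?thesis using v5(6) unfolding t6_def sem.simps by auto
  qed
  have sep: "regs t5 33 + 8 \<le> regs t5 34"
    using j unfolding v5 by (simp add: path_base_def)
  note adv = advance_correct[OF k v5(7,8) sep, folded t6]
  have m: "mem st' = mem t6"
    unfolding st' sem_clear t9_def t8_def t7_def by simp
  have base: "regs t5 (33 + k) = path_base k + 8 * j" "regs t5 (31 + k) = last_fin greedy j k"
    "regs t5 (9 + k) = ?u k" if "k < 2" for k
    using that v5 by (auto simp: less_2_cases_iff)
  have *: "3 * n + 4 + 2 * j < path_base k" "3 * n + 5 + 2 * j < path_base k" for k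
    using j by (auto simp: path_base_def)
  have "mem t6 a = mem t5 a" if "\<And>k. k < 2 \<Longrightarrow> a < path_base k + 8 * j \<or> path_base k + 8 * j + 8 \<le> a" for a
    using adv(3)[of a] base(1) that by simp
  note m6 = this
  have m6': "mem t6 a = mem t5 a" if "a < path_base 0" "a < path_base 1" for a
    using that by (intro m6) (auto simp: less_2_cases_iff)
  show "mem st' (3 * n + 4 + 2 * j) = ?k" "mem st' (3 * n + 5 + 2 * j) = 2 * begin_at greedy j"
    unfolding m m6'[OF *(1) *(1)] m6'[OF *(2) *(2)] by (simp_all add: m5)
  show "k < 2 \<Longrightarrow> r < 8 \<Longrightarrow> mem st' (path_base k + 8 * j + r) = word k j r"
    unfolding m word_def using adv(2)[of k r] base[of k] j v5
    by (simp add: target_time_def target_pos_def)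
  show "a \<notin> job_area j \<Longrightarrow> mem st' a = mem st a"
    unfolding m by (subst m6) (auto simp: job_area_def m5 less_2_cases_iff)
  have kk: "?k = 0 \<or> ?k = 1" using k by auto
  have "regs st' y = ((pass_regs (Suc j))(12 := j)) y" for y
  proof (cases "y \<in> ?X")
    case True
    then have "y \<in> set (8 # 35 # 36 # [13..<29])" unfolding list.set set_upt by auto
    then have "regs st' y = 0" unfolding st' sem_clear by (simp only: if_True)
    moreover have "((pass_regs (Suc j))(12 := j)) y = 0"
      using True by (auto simp: pass_regs_def loop_regs_def)
    ultimately show ?thesis by simp
  next
    case False
    then have y: "y \<notin> set (8 # 35 # 36 # [13..<29])" unfolding list.set set_upt by auto
    have y': "y \<noteq> 35" "y \<notin> {13..28}" "y \<noteq> 8" "y \<noteq> 36" using False by auto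
    have v6: "regs t6 36 = begin_at greedy j" "regs t6 28 = work j" "regs t6 27 = next_y j ?u ?y ?c"
      "regs t6 37 = 3 * n + 4 + 2 * j"
      using kk v5 by (auto simp: adv(1))
    have "regs st' y = regs t9 y" unfolding st' sem_clear using y by (simp only: if_False)
    also have "\<dots> = (if y = 37 then 3 * n + 4 + 2 * j + 2 else if y = 11 then next_y j ?u ?y ?c
        else if y = 30 then begin_at greedy j + work j else regs t6 y)"
      using v6 by (simp add: t9_def t8_def t7_def)
    also have "regs t6 y = (if y = 33 \<or> y = 34 then pass_regs j y + 8
       else if y = 31 + ?k then begin_at greedy j + work j
       else if y = 9 + ?k then to_pos j ?c else pass_regs j y)"
      using y' v5(1,2,4) unfolding adv(1)[OF y'(1)] by (simp add: r5 r3 r2)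
    also have "(if y = 37 then 3 * n + 4 + 2 * j + 2 else if y = 11 then next_y j ?u ?y ?c
        else if y = 30 then begin_at greedy j + work j else \<dots>) = ((pass_regs (Suc j))(12 := j)) y"
    proof (cases "y \<in> {9, 10, 11, 12, 30, 31, 32, 33, 34, 37}")
      case True
      then have "y = 9 \<or> y = 10 \<or> y = 11 \<or> y = 12 \<or> y = 30 \<or> y = 31 \<or> y = 32 \<or> y = 33
        \<or> y = 34 \<or> y = 37" by simp
      then show ?thesis
        using kk by (elim disjE; simp add: pass_regs_def loop_regs_def sim_Suc)
    next
      case False
      then have "pass_regs (Suc j) y = pass_regs j y"
        by (simp add: pass_regs_def loop_regs_def)
      then show ?thesis using kk False by auto
    qed
    finally show ?thesis .
  qed
  then show "regs st' = (pass_regs (Suc j))(12 := j)" by auto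
qed

end

section \<open>Correctness and running time\<close>

lemma length_concat_3:
  assumes "\<And>x. length (f x) = 3"
  shows "length (concat (map f xs)) = 3 * length xs"
  by (induction xs) (simp_all add: assms)

lemma nth_concat_3:
  assumes "\<And>x. length (f x) = 3" "j < length xs" "r < 3"
  shows "concat (map f xs) ! (3 * j + r) = f (xs ! j) ! r"
  using assms(2)
proof (induction xs arbitrary: j)
  case (Cons x xs)
  show ?case
  proof (cases j)
    case 0
    then show ?thesis using assms by (simp add: nth_append)
  next
    case (Suc i)
    then have "3 * j + r = length (f x) + (3 * i + r)" by (simp add: assms(1))
    then have "concat (map f (x # xs)) ! (3 * j + r) = concat (map f xs) ! (3 * i + r)"
      by (simp only: list.map concat.simps nth_append_length_plus)
    then show ?thesis using Cons Suc by simp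
  qed
qed simp

context scheduling
begin

lemma encode_input:
  "regs (encode I) = (\<lambda>_. 0)" "mem (encode I) 0 = n" "mem (encode I) 1 = L" "mem (encode I) 2 = s"
  "input_ok (encode I)" "mem_small (encode I)"
proof -
  have len: "length (pile_code p) = 3" for p by (simp add: pile_code_def)
  have lenI: "length (input_words I) = 3 * n + 3"
    by (simp add: input_words_def length_concat_3[OF len] num_def)
  show "regs (encode I) = (\<lambda>_. 0)" by (simp add: encode_def)
  show "mem (encode I) 0 = n" "mem (encode I) 1 = L" "mem (encode I) 2 = s"
    by (simp_all add: encode_def lenI) (simp_all add: input_words_def)
  show "input_ok (encode I)"
    unfolding input_ok_def
  proof (intro allI impI)
    fix j assume j: "j < n"
    have "input_words I ! (3 + (3 * j + r)) = pile_code (piles I ! j) ! r" if "r < 3" for r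
      using nth_concat_3[OF len _ that, of j "piles I"] j by (simp add: input_words_def num_def)
    from this[of 1] this[of 2]
    show "mem (encode I) (4 + 3 * j) = lft I j \<and> mem (encode I) (5 + 3 * j) = rgt I j"
      using j by (simp add: encode_def lenI pile_code_def lft_def rgt_def)
  qed
  have "w \<le> M" if w: "w \<in> set (input_words I)" for w
  proof -
    have "w = n \<or> w = L \<or> w = s \<or> (\<exists>p\<in>set (piles I). w \<in> set (pile_code p))"
      using w by (auto simp: input_words_def)
    moreover have "w \<le> M" if pw: "p \<in> set (piles I)" "w \<in> set (pile_code p)" for p
    proof -
      obtain j where "j < n" "p = piles I ! j"
        using pw(1) unfolding in_set_conv_nth num_def by blast
      then have "left p \<le> L" "right p \<le> L" using pile_bounds[of j] by (auto simp: lft_def rgt_def)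
      then show ?thesis using pw(2) M_facts(1)
        by (auto simp: pile_code_def split: pad.splits)
    qed
    ultimately show ?thesis by auto
  qed
  then have "mem (encode I) a \<le> 32 * M" for a
    using nth_mem[of a "input_words I"] by (fastforce simp: encode_def)
  then show "mem_small (encode I)" unfolding mem_small_def using le_M8(1) by blast
qed

lemma set_up_correct:
  "regs (sem set_up (encode I)) = loop_regs 0 0 0 0" "mem (sem set_up (encode I)) = mem (encode I)"
proof -
  show "mem (sem set_up (encode I)) = mem (encode I)"
    by (rule mem_sem) (simp add: set_up_def)
  show "regs (sem set_up (encode I)) = loop_regs 0 0 0 0"
    using encode_input(1-4) by (auto simp: set_up_def loop_regs_def fun_eq_iff)
qed

lemma word_leg:
  assumes "r < 4"
  shows "word k j (2 * r) = leg_time greedy k j r"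
    "word k j (2 * r + 1) = flip k (leg_home greedy k j r)"
proof -
  have "r = 0 \<or> r = 1 \<or> r = 2 \<or> r = 3" using assms by linarith
  then show "word k j (2 * r) = leg_time greedy k j r"
    "word k j (2 * r + 1) = flip k (leg_home greedy k j r)"
    by (elim disjE; simp add: word_def leg_words_def leg_time_def leg_home_def turn_def Let_def)+
qed

lemma makesp_le: "makesp greedy \<le> (n + 1) * (2 * s * L)"
  unfolding makesp_greedy by (rule togo_le) simp_all

lemma begin_le: "j < n \<Longrightarrow> begin_at greedy j \<le> makesp greedy"
  using clock_mono[of "Suc j" n greedy] by (simp add: makesp_def[OF greedy_admissible] sim_Suc)

lemma clock_le: "j \<le> n \<Longrightarrow> clock greedy j \<le> makesp greedy"
  using clock_mono[of j n greedy] by (simp add: makesp_def[OF greedy_admissible])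

lemma word_small:
  assumes "j \<le> n" "k < 2" "r < 8"
  shows "word k j r \<le> M ^ 8"
proof -
  have flip: "flip k x \<le> M ^ 8" if "x \<le> 2 * L" for x
  proof (rule le_M8(2))
    have "flip k x \<le> s * (2 * L)" using that by (auto simp: flip_def)
    then show "flip k x \<le> 2 * ((n + 1) * (2 * s * L))" by simp
  qed
  note T = turn_facts[OF greedy_admissible assms(1,2)] and F = leg_feasible[OF greedy_admissible assms(1,2)]
  have "last_fin greedy j k \<le> makesp greedy"
    using last_fin_le[OF greedy_admissible assms(2)] clock_le[OF assms(1)] le_trans by blast
  then have tt: "target_time greedy k j \<le> makesp greedy"
    using begin_le[of j] assms(1) by (auto simp: target_time_def)
  have time: "leg_time greedy k j i \<le> M ^ 8" if "i < 4" for i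
  proof (rule le_M8(2))
    have "i = 0 \<or> i = 1 \<or> i = 2 \<or> i = 3" using that by linarith
    then have "leg_time greedy k j i \<le> 2 * target_time greedy k j"
      using T F by (elim disjE) (simp_all add: leg_time_def)
    then show "leg_time greedy k j i \<le> 2 * ((n + 1) * (2 * s * L))"
      using tt makesp_le by linarith
  qed
  have home: "leg_home greedy k j i \<le> 2 * L" if "i < 4" for i
  proof -
    have "i = 0 \<or> i = 1 \<or> i = 2 \<or> i = 3" using that by linarith
    then show ?thesis
      using T F posn_le[OF assms(1), of greedy k] by (elim disjE) (simp_all add: leg_home_def)
  qed
  have i: "r div 2 < 4" using assms(3) by linarith
  have "r = 2 * (r div 2) \<or> r = 2 * (r div 2) + 1" by linarith
  then show ?thesis
    using word_leg[OF i, of k j] time[OF i] flip[OF home[OF i]] by metis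
qed

definition out :: "nat \<Rightarrow> state \<Rightarrow> bool" where
  "out j st \<longleftrightarrow> mem st (3 * n + 3) = 2 * s \<and> mem st (5 * n + 4) = 4 * n + 4 \<and>
     mem st (13 * n + 13) = 4 * n + 4 \<and>
     (\<forall>i<j. mem st (3 * n + 4 + 2 * i) = fst (chc greedy i) \<and>
        mem st (3 * n + 5 + 2 * i) = 2 * begin_at greedy i) \<and>
     (\<forall>k<2. \<forall>i<j. \<forall>r<8. mem st (path_base k + 8 * i + r) = word k i r)"

definition pass_inv :: "nat \<Rightarrow> state \<Rightarrow> bool" where
  "pass_inv j st \<longleftrightarrow> regs st = pass_regs j \<and> (\<forall>i\<le>n. layer_ok i st) \<and> input_ok st \<and> mem_small st \<and>
     out j st"

lemma pass_inv_bounded: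
  assumes "pass_inv j st" "j \<le> n"
  shows "bounded (M ^ 8) st"
proof -
  have sm: "clock greedy j \<le> M ^ 8" "last_fin greedy j 0 \<le> M ^ 8" "last_fin greedy j 1 \<le> M ^ 8"
    using clock_le[OF assms(2)] makesp_le last_fin_le[OF greedy_admissible, of 0 j]
      last_fin_le[OF greedy_admissible, of 1 j]
    by (intro le_M8(2); linarith)+
  have "loop_regs 0 (posn greedy j 0) (posn greedy j 1) (lagc greedy j) x \<le> 32 * M" for x
    using posn_le[OF assms(2), of greedy 0] posn_le[OF assms(2), of greedy 1] lagc_le[of greedy j] M_facts
    by (auto simp: loop_regs_def)
  then have "loop_regs 0 (posn greedy j 0) (posn greedy j 1) (lagc greedy j) x \<le> M ^ 8" for x
    using le_M8(1) by blast
  moreover have "j \<le> M ^ 8" "path_base 0 + 8 * j \<le> M ^ 8" "path_base 1 + 8 * j \<le> M ^ 8"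
    "3 * n + 4 + 2 * j \<le> M ^ 8"
    using assms(2) M_facts by (intro le_M8(1); simp add: path_base_def)+
  ultimately have "pass_regs j x \<le> M ^ 8" for x
    using sm by (simp add: pass_regs_def)
  then show ?thesis using assms(1) by (simp add: bounded_def pass_inv_def mem_small_def)
qed

lemma areas_disjoint:
  assumes "j \<le> n"
  shows "a < 3 * n + 4 \<Longrightarrow> a \<notin> job_area j" "table_base \<le> a \<Longrightarrow> a \<notin> job_area j"
    "5 * n + 4 \<notin> {path_base 0 + 8 * j..<path_base 0 + 8 * j + 8} \<union> {path_base 1 + 8 * j..<path_base 1 + 8 * j + 8}"
    "13 * n + 13 \<notin> job_area j"
  using assms by (auto simp: job_area_def path_base_def)

text \<open>The set \<open>A\<close> of written cells is separate from \<open>job_area j\<close>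
  because of the final step j = n: no job words are written then, and \<open>job_area n\<close>
  contains 5n + 4, the cell with the breakpoint count of reclaimer 0.\<close>

lemma out_step:
  assumes inv: "out j st" "\<forall>i\<le>n. layer_ok i st" "input_ok st"
    and same: "\<And>a. a \<notin> A \<Longrightarrow> mem st' a = mem st a" and A: "A \<subseteq> job_area j"
    and j: "j \<le> n" "j < n \<or> A \<subseteq> {path_base 0 + 8 * j..<path_base 0 + 8 * j + 8} \<union> {path_base 1 + 8 * j..<path_base 1 + 8 * j + 8}"
  shows "out j st'" "\<forall>i\<le>n. layer_ok i st'" "input_ok st'"
proof -
  have eq: "mem st' a = mem st a" if "a \<notin> job_area j" for a using same A that by blast
  have "mem st' (table_base + x) = mem st (table_base + x)" for x
    by (intro eq areas_disjoint(2) j(1)) simp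
  then show "\<forall>i\<le>n. layer_ok i st'" using inv(2) by (simp add: layer_ok_def)
  have "mem st' a = mem st a" if "a < 3 * n + 4" for a
    using that by (intro eq areas_disjoint(1) j(1))
  note low = this
  then show "input_ok st'" using inv(3) by (simp add: input_ok_def)
  have "5 * n + 4 \<notin> A"
    using j(2)
  proof
    assume "j < n"
    then have "5 * n + 4 \<notin> job_area j"
      unfolding job_area_def path_base_def by (auto; presburger)
    then show ?thesis using A by blast
  qed (use areas_disjoint(3)[OF j(1)] in blast)
  moreover have "3 * n + 4 + 2 * i \<notin> A" "3 * n + 5 + 2 * i \<notin> A" if "i < j" for i
  proof -
    have "3 * n + 4 + 2 * i \<notin> job_area j" "3 * n + 5 + 2 * i \<notin> job_area j"
      using that j(1) unfolding job_area_def path_base_def by (simp; presburger)+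
    then show "3 * n + 4 + 2 * i \<notin> A" "3 * n + 5 + 2 * i \<notin> A" using A by blast+
  qed
  moreover have "path_base k + 8 * i + r \<notin> A" if "i < j" "r < 8" "k < 2" for k i r
  proof -
    have "path_base k + 8 * i + r \<notin> {path_base 0 + 8 * j..<path_base 0 + 8 * j + 8}
        \<union> {path_base 1 + 8 * j..<path_base 1 + 8 * j + 8}"
      using that j(1) unfolding path_base_def less_2_cases_iff by auto
    moreover have "path_base k + 8 * i + r \<notin> job_area j" if "j < n"
      using \<open>i < j\<close> \<open>r < 8\<close> \<open>k < 2\<close> that unfolding job_area_def path_base_def less_2_cases_iff by auto
    ultimately show ?thesis using A j(2) by blast
  qed
  ultimately show "out j st'"
    using inv(1) low eq[OF areas_disjoint(4)[OF j(1)]] unfolding out_def by (simp add: same)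
qed

lemma do_job_inv:
  assumes inv: "pass_inv j st" and j: "j < n"
  shows "regs (sem do_job st) 12 = j" "pass_inv (Suc j) (set_reg 12 (Suc j) (sem do_job st))"
proof -
  let ?st = "sem do_job st"
  have ly: "layer_ok (n - Suc j) st" and st: "regs st = pass_regs j" and inp: "input_ok st"
    using inv by (simp_all add: pass_inv_def)
  note dj = do_job_correct[OF j st ly inp]
  show "regs ?st 12 = j" unfolding dj(1) by simp
  have os: "out j ?st" "\<forall>i\<le>n. layer_ok i ?st" "input_ok ?st"
    using out_step[of j st "job_area j" ?st] inv j dj(5) unfolding pass_inv_def by auto
  have o: "out (Suc j) ?st"
    using os(1) dj(2,3,4) unfolding out_def by (auto simp: less_Suc_eq)
  have "mem ?st a \<le> M ^ 8" for a
  proof (cases "a \<in> job_area j")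
    case False
    then show ?thesis using dj(5) inv by (simp add: pass_inv_def mem_small_def)
  next
    case True
    have "fst (chc greedy j) \<le> M ^ 8" "2 * begin_at greedy j \<le> M ^ 8"
      using chc_range(1)[OF greedy_admissible, of j] M_facts(1) begin_le[OF j] makesp_le
      by (intro le_M8(1), simp, intro le_M8(2), linarith)
    moreover have "mem ?st (path_base k + 8 * j + r) \<le> M ^ 8" if "k < 2" "r < 8" for k r
      using dj(4)[OF that] word_small[of j k r] that j by simp
    moreover have "a = 3 * n + 4 + 2 * j \<or> a = 3 * n + 5 + 2 * j \<or>
      (\<exists>k<2. \<exists>r<8. a = path_base k + 8 * j + r)"
    proof -
      have "\<exists>r<8. a = p + r" if "p \<le> a" "a < p + 8" for p
        using that by (intro exI[of _ "a - p"]) simp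
      then show ?thesis using True by (auto simp: job_area_def less_2_cases_iff)
    qed
    ultimately show ?thesis using dj(2,3) by auto
  qed
  moreover have "(pass_regs (Suc j))(12 := Suc j) = pass_regs (Suc j)"
    by (auto simp: pass_regs_def loop_regs_def)
  ultimately show "pass_inv (Suc j) (set_reg 12 (Suc j) ?st)"
    using os(2,3) o dj(1)
    by (simp add: pass_inv_def mem_small_def out_def layer_ok_def input_ok_def)
qed

lemma finish_up_correct:
  assumes inv: "pass_inv n st" "regs st' = (regs st)(12 := 0)" "mem st' = mem st"
  defines "st'' \<equiv> sem finish_up st'"
  shows "out n st''" "regs st'' 0 = 3 * n + 3"
    "k < 2 \<Longrightarrow> r < 8 \<Longrightarrow> mem st'' (path_base k + 8 * n + r) = word k n r"
proof -
  define t1 where "t1 = sem (Set 36 (Add (Reg 30) final_cost)) st'"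
  have st'': "st'' = sem (leg (1 - 0) 36 24) (sem (leg 0 36 24) t1)"
    unfolding st''_def finish_up_def seqs.simps sem.simps(4) t1_def by simp
  have "eval st' (Add (Reg 30) final_cost) = makesp greedy"
    using inv(1,2) by (simp add: pass_inv_def pass_regs_def loop_regs_def final_cost_def lag_exp_def
        lag_def makesp_def[OF greedy_admissible])
  then have r1: "regs t1 = (regs st')(36 := makesp greedy)" and m1: "mem t1 = mem st"
    by (simp_all add: t1_def inv(3))
  have v: "regs t1 0 = 3 * n + 3" "regs t1 2 = L" "regs t1 3 = s" "regs t1 24 = 0" "regs t1 36 = makesp greedy"
    "regs t1 33 = path_base 0 + 8 * n" "regs t1 34 = path_base 1 + 8 * n"
    "regs t1 31 = last_fin greedy n 0" "regs t1 32 = last_fin greedy n 1"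
    "regs t1 9 = posn greedy n 0" "regs t1 10 = posn greedy n 1"
    using inv(1,2) by (simp_all add: r1 pass_inv_def pass_regs_def loop_regs_def)
  have z: "36 \<notin> {33, 34, 35::nat}" "24 \<notin> {33, 34, 35::nat}" by simp_all
  have sep: "regs t1 33 + 8 \<le> regs t1 34" unfolding v by (simp add: path_base_def)
  have k0: "(0::nat) < 2" by simp
  note tl = two_legs[OF k0 z z v(2,3) sep, folded st'']
  show "regs st'' 0 = 3 * n + 3" by (simp add: tl(1) v)
  have base: "regs t1 (33 + k) = path_base k + 8 * n" "regs t1 (31 + k) = last_fin greedy n k"
    "regs t1 (9 + k) = posn greedy n k" if "k < 2" for k
    using that v by (auto simp: less_2_cases_iff)
  show "k < 2 \<Longrightarrow> r < 8 \<Longrightarrow> mem st'' (path_base k + 8 * n + r) = word k n r"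
    using tl(2)[of k r] base[of k] v
    by (simp add: word_def target_time_def target_pos_def)
  let ?A = "{path_base 0 + 8 * n..<path_base 0 + 8 * n + 8} \<union> {path_base 1 + 8 * n..<path_base 1 + 8 * n + 8}"
  have same: "mem st'' a = mem st a" if a: "a \<notin> ?A" for a
    unfolding m1[symmetric]
  proof (rule tl(3))
    fix k' :: nat assume k': "k' < 2"
    then have "k' = 0 \<or> k' = 1" by auto
    then show "a < regs t1 (33 + k') \<or> regs t1 (33 + k') + 8 \<le> a"
      using a unfolding base(1)[OF k'] by auto
  qed
  have "?A \<subseteq> job_area n" by (auto simp: job_area_def)
  then show "out n st''"
    using out_step(1)[OF _ _ _ same, of n] inv(1) unfolding pass_inv_def by blast
qed

lemma decode_optimal:
  assumes "out n st" "regs st 0 = 3 * n + 3"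
    and last: "\<And>k r. k < 2 \<Longrightarrow> r < 8 \<Longrightarrow> mem st (path_base k + 8 * n + r) = word k n r"
  shows "optimal I (decode n st)"
proof -
  let ?q = "real (2 * s)" and ?a = "\<lambda>k. if k = 0 then 5 * n + 4 else 13 * n + 13"
  let ?B = "\<lambda>k. breakpoints ?q (mem st) (?a k)"
  have m: "mem st (3 * n + 3) = 2 * s" "mem st (5 * n + 4) = 4 * n + 4" "mem st (13 * n + 13) = 4 * n + 4"
    using assms(1) by (simp_all add: out_def)
  have ad: "3 * n + 3 + 1 + 2 * n = 5 * n + 4" "5 * n + 4 + 1 + 2 * (4 * n + 4) = 13 * n + 13"
    by simp_all
  have dec: "decode n st = \<lparr>path = (\<lambda>k. polyline (?B k)), makespan = (\<lambda>k. fst (last (?B k))),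
      worker = (\<lambda>j. mem st (3 * n + 3 + 1 + 2 * j)),
      start = (\<lambda>j. real (mem st (3 * n + 3 + 2 + 2 * j)) / ?q)\<rparr>"
    unfolding decode_def Let_def assms(2) ad m by simp
  have words: "mem st (path_base k + 8 * j + r) = word k j r" if "k < 2" "j \<le> n" "r < 8" for k j r
    using assms(1) last that by (cases "j = n") (auto simp: out_def)
  have B: "?B k = poly_points (Suc (4 * n + 3)) (point_time greedy k) (point_pos greedy k)" if k: "k < 2" for k
  proof -
    have "(real (mem st (?a k + 1 + 2 * i)) / ?q, real (mem st (?a k + 2 + 2 * i)) / ?q)
        = (point_time greedy k i, point_pos greedy k i)" if i: "i < 4 * n + 4" for i
    proof -
      let ?j = "i div 4" and ?r = "i mod 4"
      have j: "?j \<le> n" "?r < 4" "2 * ?r < 8" "2 * ?r + 1 < 8" using i by linarith+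
      have ij: "2 * i = 8 * ?j + 2 * ?r" by presburger
      have "?a k + 1 + 2 * i = path_base k + 8 * ?j + 2 * ?r"
        "?a k + 2 + 2 * i = path_base k + 8 * ?j + (2 * ?r + 1)"
        unfolding ij by (auto simp: path_base_def)
      then have w: "mem st (?a k + 1 + 2 * i) = leg_time greedy k ?j ?r"
        "mem st (?a k + 2 + 2 * i) = flip k (leg_home greedy k ?j ?r)"
        using words[OF k j(1,3)] words[OF k j(1,4)] word_leg[OF j(2), of k ?j] by simp_all
      have r: "?r = 0 \<or> ?r = 1 \<or> ?r = 2 \<or> ?r = 3" using j(2) by linarith
      have "leg_home greedy k ?j ?r \<le> 2 * L"
        using r turn_facts[OF greedy_admissible j(1) k] leg_feasible[OF greedy_admissible j(1) k]
          posn_le[OF j(1), of greedy k] by (elim disjE) (simp_all add: leg_home_def)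
      then have "real (flip k (leg_home greedy k ?j ?r)) / ?q = point_pos greedy k i"
        using s_pos by (simp add: flip_def point_pos_def rhome_def of_nat_diff field_simps)
      then show ?thesis unfolding w by (simp add: point_time_def)
    qed
    note e = this
    have "mem st (?a k) = 4 * n + 4" "Suc (4 * n + 3) = 4 * n + 4" using m k by (auto simp: less_2_cases_iff)
    then show ?thesis unfolding breakpoints_def poly_points_def
      by (simp only:) (rule map_cong[OF refl], rule e, simp)
  qed
  show ?thesis
  proof (rule greedy_optimal)
    show "path (decode n st) k = polyline (poly_points (Suc (4 * n + 3)) (point_time greedy k) (point_pos greedy k))"
      if "k < 2" for k unfolding dec using B[OF that] by simp
    show "makespan (decode n st) k = real (makesp greedy) / real s" if "k < 2" for k
    proof -
      have "last (poly_points (Suc N) f g) = (f N, g N)" for N f g by (simp add: poly_points_def)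
      then show ?thesis
        unfolding dec using B[OF that] point_ends(2)[OF greedy_admissible that]
        by (simp only: schedule.simps fst_conv)
    qed
    show "worker (decode n st) j = fst (chc greedy j)" "start (decode n st) j = real (begin_at greedy j) / real s"
      if "j < n" for j
      using assms(1) that unfolding dec out_def by (simp_all add: ac_simps)
  qed
qed

lemma loop_free_choose: "loop_free choose_best"
  by (simp add: choose_best_def load_job_def test_choice_def keep_def keep_better_def)

lemma loop_free_leg: "loop_free (leg k x z)"
  by (simp add: leg_def Let_def)

lemma loop_free_parts: "loop_free set_up" "loop_free set_up_output" "loop_free do_job" "loop_free finish_up"
  by (simp_all add: set_up_def set_up_output_def do_job_def finish_up_def advance_def
      loop_free_choose loop_free_leg loop_free_clear)

lemma pass_inv_0:
  assumes "regs st = loop_regs 0 0 0 0" "filled (idx (Suc n) 0 0 0) st" "input_ok st" "mem_small st"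
  shows "pass_inv 0 (sem set_up_output st)"
proof -
  let ?st = "sem set_up_output st"
  have r: "regs ?st = pass_regs 0"
    using assms(1)
    by (auto simp: set_up_output_def pass_regs_def loop_regs_def path_base_def fun_eq_iff)
  have m: "mem ?st = (mem st)(3 * n + 3 := 2 * s, 5 * n + 4 := 4 * n + 4, 13 * n + 13 := 4 * n + 4)"
    using assms(1) by (simp add: set_up_output_def loop_regs_def ac_simps)
  have "layer_ok i st" if "i \<le> n" for i
    using assms(2) that idx_less_layer[of i "Suc n"] by (simp add: filled_def layer_ok_def)
  then have "\<forall>i\<le>n. layer_ok i ?st" unfolding layer_ok_def m by simp
  moreover have "input_ok ?st" using assms(3) unfolding input_ok_def m by simp
  moreover have "2 * s \<le> M ^ 8" "4 * n + 4 \<le> M ^ 8" using M_facts by (intro le_M8(1); simp)+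
  then have "mem_small ?st" using assms(4) unfolding mem_small_def m by simp
  moreover have "out 0 ?st" unfolding out_def m by simp
  ultimately show ?thesis using r by (simp add: pass_inv_def)
qed

lemma prog_runs:
  assumes "8 * growth set_up < d" "8 * growth fill_cell < d" "8 * growth set_up_output < d"
    "8 * growth do_job < d" "8 * growth finish_up < d" "8 \<le> d"
  shows "runs (M ^ d) prog (encode I)
    (time_bound set_up + (fill_time + (time_bound set_up_output +
      ((n * (time_bound do_job + 8) + 6) + time_bound finish_up))))
    (\<lambda>st. optimal I (decode n st))"
  unfolding prog_def
proof (rule runs_Seq)
  note lf = loop_free_parts and M2 = M_facts(1)
  let ?Q1 = "fill_inv 0 0 0 0"
    and ?Q2 = "\<lambda>st. regs st = loop_regs 0 0 0 0 \<and> filled (idx (Suc n) 0 0 0) st \<and> input_ok st \<and> mem_small st"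
  show "runs (M ^ d) set_up (encode I) (time_bound set_up) ?Q1"
  proof (rule runs_loop_free[OF lf(1) M2 _ _ assms(1)])
    show "bounded (M ^ 8) (encode I)"
      using encode_input(1,6) by (simp add: bounded_def mem_small_def)
    show "fill_inv 0 0 0 0 (sem set_up (encode I))"
      using set_up_correct encode_input(5,6)
      by (simp add: fill_inv_def filled_def idx_def input_ok_def mem_small_def)
  qed simp
  fix st1 assume "?Q1 st1"
  then have "runs (M ^ d) fill_table st1 fill_time ?Q2"
    using fill_table_runs[OF assms(2,6), of st1 ?Q2] by blast
  then show "runs (M ^ d) (Seq fill_table (Seq set_up_output (Seq (For 12 1 do_job) finish_up))) st1
      (fill_time + (time_bound set_up_output + ((n * (time_bound do_job + 8) + 6) + time_bound finish_up)))
      (\<lambda>st. optimal I (decode n st))"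
  proof (rule runs_Seq)
    fix st2 assume Q2: "?Q2 st2"
    have "runs (M ^ d) set_up_output st2 (time_bound set_up_output) (pass_inv 0)"
    proof (rule runs_loop_free[OF lf(2) M2 _ _ assms(3)])
      have "fill_inv 0 0 0 0 st2"
        using Q2 by (simp add: fill_inv_def filled_def idx_def)
      then show "bounded (M ^ 8) st2" by (rule fill_inv_bounded) simp_all
      show "pass_inv 0 (sem set_up_output st2)" using Q2 pass_inv_0 by blast
    qed simp
    then show "runs (M ^ d) (Seq set_up_output (Seq (For 12 1 do_job) finish_up)) st2
        (time_bound set_up_output + ((n * (time_bound do_job + 8) + 6) + time_bound finish_up))
        (\<lambda>st. optimal I (decode n st))"
    proof (rule runs_Seq)
      fix st3 assume st3: "pass_inv 0 st3"
      have "runs (M ^ d) (For 12 1 do_job) st3 (n * (time_bound do_job + 8) + 6)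
          (\<lambda>st'. \<exists>st. pass_inv n st \<and> st' = set_reg 12 0 st)"
      proof (rule runs_For[where Inv = "\<lambda>j st. j \<le> n \<and> pass_inv j st"])
        show "runs (M ^ d) do_job st (time_bound do_job)
            (\<lambda>st'. regs st' 12 = j \<and> Suc j \<le> n \<and> pass_inv (Suc j) (set_reg 12 (Suc j) st'))"
          if "j < n" "j \<le> n \<and> pass_inv j st" for j st
          using that do_job_inv[of j st] pass_inv_bounded[of j st]
          by (intro runs_loop_free[OF lf(3) M2 _ _ assms(4)]) simp_all
        show "regs st 12 = j \<and> regs st 1 = n" if "j \<le> n \<and> pass_inv j st" for j st
          using that by (simp add: pass_inv_def pass_regs_def loop_regs_def)
        have "M ^ 1 \<le> M ^ d" using M2 assms(6) by (intro power_increasing) simp_all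
        then show "n + 2 \<le> M ^ d" using M_facts(2) by simp
      qed (use st3 in auto)
      then show "runs (M ^ d) (Seq (For 12 1 do_job) finish_up) st3
          ((n * (time_bound do_job + 8) + 6) + time_bound finish_up) (\<lambda>st. optimal I (decode n st))"
      proof (rule runs_Seq)
        fix st' assume "\<exists>st. pass_inv n st \<and> st' = set_reg 12 0 st"
        then obtain st where st: "pass_inv n st" "st' = set_reg 12 0 st" by blast
        have "bounded (M ^ 8) st" using pass_inv_bounded[OF st(1)] by simp
        then have b: "bounded (M ^ 8) st'" using st(2) by (simp add: bounded_def)
        show "runs (M ^ d) finish_up st' (time_bound finish_up) (\<lambda>st. optimal I (decode n st))"
        proof (rule runs_loop_free[OF lf(4) M2 b _ assms(5)])
          have "regs st' = (regs st)(12 := 0)" "mem st' = mem st" using st(2) by simp_all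
          from finish_up_correct[OF st(1) this]
          show "optimal I (decode n (sem finish_up st'))" by (rule decode_optimal)
        qed simp
      qed
    qed
  qed
qed

text \<open>The factor 24 is 3 * 2 * 2 * 2, from 2L + 1 <= 3L, twice L + 1 <= 2L, and n + 1 <= 2 max
  1 n, which also covers n = 0. Each 14 is the exit cost 6 of a loop plus the 8 of the enclosing
  round. These overheads accumulate to 28 and 42, then 48, as 14 <= 12 L^3 * 6; so 56 is 8 +
  48.\<close>

lemma time_total:
  "time_bound set_up + (fill_time + (time_bound set_up_output +
      ((n * (time_bound do_job + 8) + 6) + time_bound finish_up)))
    \<le> (24 * (time_bound fill_cell + 56) + time_bound set_up + time_bound set_up_output
        + time_bound do_job + time_bound finish_up + 14) * (max 1 n * L ^ 3)"
proof -
  let ?C = "time_bound fill_cell + 8" and ?m = "max 1 n"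
  have L1: "1 \<le> L" using L_pos by simp
  have loop: "(a + 1) * x + 14 \<le> 2 * b * (x + 14)" if "1 \<le> b" "a \<le> b" for a b x :: nat
  proof -
    have "(a + 1) * x \<le> (2 * b) * x" using that by (intro mult_le_mono1) simp
    moreover have "14 \<le> 2 * b * 14" using that by simp
    ultimately show ?thesis by (simp add: distrib_left)
  qed
  define t1 where "t1 = (2 * L + 1) * ?C + 14"
  define t2 where "t2 = (L + 1) * t1 + 14"
  define t3 where "t3 = (L + 1) * t2 + 14"
  have f: "fill_time \<le> (n + 1) * t3 + 14"
    by (simp add: fill_time_def t1_def t2_def t3_def)
  have 1: "t1 + 14 \<le> 3 * L * (?C + 28)"
  proof -
    have "(2 * L + 1) * ?C \<le> 3 * L * ?C" using L1 by (intro mult_le_mono1) simp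
    moreover have "28 \<le> 3 * L * 28" using L1 by simp
    ultimately show ?thesis by (simp add: t1_def distrib_left)
  qed
  have 2: "t2 + 14 \<le> 6 * L ^ 2 * (?C + 42)"
  proof -
    have "t2 \<le> 2 * L * (t1 + 14)" unfolding t2_def by (rule loop[OF L1 order_refl])
    also have "\<dots> \<le> 2 * L * (3 * L * (?C + 28))" using 1 by (rule mult_le_mono2)
    finally have "t2 \<le> 6 * L ^ 2 * (?C + 28)" by (simp add: power2_eq_square)
    moreover have "14 \<le> 6 * L ^ 2 * 14" using L1 by simp
    ultimately show ?thesis by (simp add: distrib_left)
  qed
  have 3: "t3 + 14 \<le> 12 * L ^ 3 * (?C + 48)"
  proof -
    have "t3 \<le> 2 * L * (t2 + 14)" unfolding t3_def by (rule loop[OF L1 order_refl])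
    also have "\<dots> \<le> 2 * L * (6 * L ^ 2 * (?C + 42))" using 2 by (rule mult_le_mono2)
    finally have "t3 \<le> 12 * L ^ 3 * (?C + 42)" by (simp add: power2_eq_square power3_eq_cube)
    moreover have "1 \<le> L ^ 3" using L1 by simp
    then have "14 \<le> 12 * L ^ 3 * 6" by linarith
    ultimately show ?thesis by (simp add: distrib_left)
  qed
  have "(n + 1) * t3 + 14 \<le> 2 * ?m * (t3 + 14)" by (rule loop) simp_all
  also have "\<dots> \<le> 2 * ?m * (12 * L ^ 3 * (?C + 48))" using 3 by (rule mult_le_mono2)
  also have "\<dots> = 24 * (time_bound fill_cell + 56) * (?m * L ^ 3)" by (simp add: algebra_simps)
  finally have A: "fill_time \<le> 24 * (time_bound fill_cell + 56) * (?m * L ^ 3)"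
    using f le_trans by blast
  have p: "1 \<le> ?m * L ^ 3" "n \<le> ?m * L ^ 3" using L1 by (auto simp: max_def)
  have one: "x \<le> x * (?m * L ^ 3)" for x using p(1) by simp
  have B: "n * (time_bound do_job + 8) \<le> (time_bound do_job + 8) * (?m * L ^ 3)"
    using p(2) by (simp add: mult.commute)
  show ?thesis
    using A B one[of "time_bound set_up"] one[of "time_bound set_up_output"]
      one[of "time_bound finish_up"] one[of 6]
    unfolding distrib_right by linarith
qed

end

theorem theorem11:
  "\<exists>(P::com) (c::nat) (d::nat). \<forall>I::inst. valid_inst I \<and> speed I \<in> \<int> \<longrightarrow>
     (\<exists>T st. exec ((num I + rail I + int_speed I) ^ d) P (encode I) T st \<and>
        T \<le> c * (max 1 (num I) * rail I ^ 3) \<and>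
        optimal I (decode (num I) st))"
proof -
  \<comment> \<open>The last summand 14 is the overhead 8 + 6 of the loop over the jobs.\<close>
  define c where "c = 24 * (time_bound fill_cell + 56) + time_bound set_up + time_bound set_up_output
    + time_bound do_job + time_bound finish_up + 14"
  \<comment> \<open>Every block starts in a state bounded by M^8, so its growth counts eightfold;
    the 9 makes the inequalities strict and secures 8 <= d.\<close>
  define d where "d = 8 * (growth set_up + growth fill_cell + growth set_up_output + growth do_job
    + growth finish_up) + 9"
  have "\<exists>T st. exec ((num I + rail I + int_speed I) ^ d) prog (encode I) T st \<and>
      T \<le> c * (max 1 (num I) * rail I ^ 3) \<and> optimal I (decode (num I) st)"
    if "valid_inst I" "speed I \<in> \<int>" for I
  proof -
    interpret scheduling I using that by unfold_locales
    have "8 * growth set_up < d" "8 * growth fill_cell < d" "8 * growth set_up_output < d"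
      "8 * growth do_job < d" "8 * growth finish_up < d" "8 \<le> d"
      by (simp_all add: d_def)
    from prog_runs[OF this] show ?thesis
      unfolding runs_def c_def using time_total le_trans by meson
  qed
  then show ?thesis by blast
qed

end
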